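(* Let $t\ge2$ and let $d_1,\dots,d_t$ be positive integers. The allowable sequence $\mathrm{DC}^{cs}_{ncgen}(d_1,d_2,\dots,d_t)$ is geometrically realizable if and only if one of the following holds: (1) $d_1=d_2=\cdots=d_t=1$; (2) $t=2$; (3) $t=3$ and two entries of $(d_1,d_2,d_3)$ are equal to $1$; (4) $t=3$ and $(d_1,d_2,d_3)=(2,2,2)$.
   Context: An allowable sequence on a finite set of $N$ points is a doubly infinite sequence $\Pi=\{\pi_i\}_{i\in\mathbb{Z}}$ of permutations (linear orderings) of the points such that: (i) there is a positive integer $h=h(\Pi)$ such that $\pi_{i+h}$ is the reversal of $\pi_i$ for all $i$ (then $\pi_0,\dots,\pi_h$ is called a halfperiod, of length $h$); (ii) $\pi_i$ is obtained from $\pi_{i-1}$ by reversing one or more disjoint substrings of consecutive elements; these reversals are called switches, and the set of switches from $\pi_{i-1}$ to $\pi_i$ is the $i$-th move; (iii) any pair of points participates together in a switch exactly once within a halfperiod. A switch of two points is a transposition. Write $\pi(p)$ for the position of the point $p$ in $\pi$. An allowable sequence with $2n$ points is centrally symmetric if for every point $p$ there is a point $\overline p$ (its conjugate) with $\pi(p)+\pi(\overline p)=2n+1$ for every permutation $\pi$ of the sequence. A crossing switch is a switch reversing a centered substring of a permutation. The sequence is in noncentral general position if all switches except possibly crossing switches are transpositions. It is even-near-critical if $h(\Pi)=2n$. Its central signature is $(d_1,\dots,d_t)$, where $2d_i$ is the number of points reversed by the $i$-th crossing switch in the halfperiod $\pi_0,\pi_1,\dots,\pi_h$. Two allowable sequences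 $\{\pi_i\}$, $\{\pi'_i\}$ are combinatorially equivalent if there are a bijection $f$ between their point sets and an integer $m$ such that $\pi'_{i+m}$ is obtained from $\pi_i$ by applying $f$ to each entry, for all $i$. For every sequence $(d_1,\dots,d_t)$ of positive integers with $t\ge 2$ there is, up to combinatorial equivalence, exactly one even-near-critical centrally symmetric allowable sequence in noncentral general position with central signature $(d_1,\dots,d_t)$; $\mathrm{DC}^{cs}_{ncgen}(d_1,\dots,d_t)$ denotes this sequence, with $n=d_1+\dots+d_t$, points labeled so that $\pi_0=(1,2,\dots,n,\overline n,\dots,\overline 2,\overline 1)$, and indexed so that the first move (from $\pi_0$ to $\pi_1$) includes the crossing switch of $2d_1$ points. The circular sequence of a finite set $P$ of points in the plane is the doubly infinite sequence of permutations of $P$ given by the orders of the orthogonal projections of $P$ onto a directed line as this line rotates (passing from one permutation to the next exactly when the line becomes orthogonal to some line connecting two points of $P$; parallel connecting lines give switches in the same move). An allowable sequence is geometrically realizable if it is (combinatorially equivalent to) the circular sequence of a finite set of points in the plane. *)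

theory Defs
  imports "HOL-Analysis.Analysis"
begin

section \<open>Allowable sequences\<close>

text \<open>
  A permutation of a finite point set is a list without repetitions. For a sequence
  \<open>\<pi> :: int \<Rightarrow> 'a list\<close>, the i-th move leads from \<open>\<pi> (i - 1)\<close> to \<open>\<pi> i\<close>.
\<close>

definition position :: "'a list \<Rightarrow> 'a \<Rightarrow> nat" where
  "position xs p = Suc (length (takeWhile (\<lambda>q. q \<noteq> p) xs))"

text \<open>
  \<open>xs\<close> is cut into consecutive blocks, each of which is reversed; blocks of length at most 1
  stay unchanged. The switches are the blocks of length at least 2, given by their contents
  before the move. If \<open>xs\<close> has no repetitions, \<open>xs\<close> and \<open>ys\<close> determine these blocks.
\<close>

definition block_reversal :: "'a list list \<Rightarrow> 'a list \<Rightarrow> 'a list \<Rightarrow> bool" where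
  "block_reversal bs xs ys \<longleftrightarrow> xs = concat bs \<and> ys = concat (map rev bs)"

definition switches :: "'a list \<Rightarrow> 'a list \<Rightarrow> 'a list set" where
  "switches xs ys = {b. length b \<ge> 2 \<and> (\<exists>bs. block_reversal bs xs ys \<and> b \<in> set bs)}"

definition is_move :: "'a list \<Rightarrow> 'a list \<Rightarrow> bool" where
  "is_move xs ys \<longleftrightarrow> (\<exists>bs. block_reversal bs xs ys \<and> (\<exists>b\<in>set bs. length b \<ge> 2))"

text \<open>
  The conditions on \<open>h = h(\<pi>)\<close> in the definition of an allowable sequence; if there are at
  least two points, at most one \<open>h\<close> satisfies them.
\<close>

definition is_halfperiod :: "'a set \<Rightarrow> (int \<Rightarrow> 'a list) \<Rightarrow> nat \<Rightarrow> bool" where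
  "is_halfperiod P \<pi> h \<longleftrightarrow>
     h > 0 \<and>
     (\<forall>i. \<pi> (i + int h) = rev (\<pi> i)) \<and>
     (\<forall>p\<in>P. \<forall>q\<in>P. p \<noteq> q \<longrightarrow>
        (\<exists>!i. 1 \<le> i \<and> i \<le> int h \<and> (\<exists>b\<in>switches (\<pi> (i - 1)) (\<pi> i). p \<in> set b \<and> q \<in> set b)))"

definition allowable_sequence :: "'a set \<Rightarrow> (int \<Rightarrow> 'a list) \<Rightarrow> bool" where
  "allowable_sequence P \<pi> \<longleftrightarrow>
     finite P \<and>
     (\<forall>i. distinct (\<pi> i) \<and> set (\<pi> i) = P) \<and>
     (\<forall>i. is_move (\<pi> (i - 1)) (\<pi> i)) \<and>
     (\<exists>h. is_halfperiod P \<pi> h)"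

definition combinatorially_equivalent ::
    "'a set \<Rightarrow> (int \<Rightarrow> 'a list) \<Rightarrow> 'b set \<Rightarrow> (int \<Rightarrow> 'b list) \<Rightarrow> bool" where
  "combinatorially_equivalent P \<pi> Q \<pi>' \<longleftrightarrow>
     (\<exists>f m. bij_betw f P Q \<and> (\<forall>i. \<pi>' (i + m) = map f (\<pi> i)))"


section \<open>Centrally symmetric sequences\<close>

definition centrally_symmetric :: "'a set \<Rightarrow> (int \<Rightarrow> 'a list) \<Rightarrow> bool" where
  "centrally_symmetric P \<pi> \<longleftrightarrow>
     (\<exists>n. card P = 2 * n \<and>
        (\<forall>p\<in>P. \<exists>q\<in>P. \<forall>i. position (\<pi> i) p + position (\<pi> i) q = 2 * n + 1))"

definition crossing_switch :: "'a list \<Rightarrow> 'a list \<Rightarrow> 'a list \<Rightarrow> bool" where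
  "crossing_switch xs ys b \<longleftrightarrow>
     b \<in> switches xs ys \<and> (\<exists>us vs. xs = us @ b @ vs \<and> length us = length vs)"

definition noncentral_general_position :: "(int \<Rightarrow> 'a list) \<Rightarrow> bool" where
  "noncentral_general_position \<pi> \<longleftrightarrow>
     (\<forall>i. \<forall>b\<in>switches (\<pi> (i - 1)) (\<pi> i).
        crossing_switch (\<pi> (i - 1)) (\<pi> i) b \<or> length b = 2)"

definition even_near_critical :: "'a set \<Rightarrow> (int \<Rightarrow> 'a list) \<Rightarrow> bool" where
  "even_near_critical P \<pi> \<longleftrightarrow>
     allowable_sequence P \<pi> \<and> (\<exists>n. card P = 2 * n \<and> is_halfperiod P \<pi> (2 * n))"

text \<open>
  Switches of one move are disjoint, so a move contains at most one crossing switch, and the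
  moves \<open>1, \<dots>, h\<close> that contain one list the crossing switches in order.
\<close>

definition central_signature :: "(int \<Rightarrow> 'a list) \<Rightarrow> nat \<Rightarrow> nat list" where
  "central_signature \<pi> h =
     map (\<lambda>i. length (THE b. crossing_switch (\<pi> (i - 1)) (\<pi> i) b) div 2)
       (filter (\<lambda>i. \<exists>b. crossing_switch (\<pi> (i - 1)) (\<pi> i) b) [1..int h])"


section \<open>The sequences \<open>DC\<close>\<close>

text \<open>
  The points \<open>1, \<dots>, n\<close> are positive integers, and the conjugate of \<open>k\<close> is \<open>-k\<close>. The labelling
  and the indexing single out one sequence from its class up to combinatorial equivalence, so
  that \<open>THE\<close> below picks the unique sequence with the stated properties.
\<close>

definition DC_start :: "nat list \<Rightarrow> int list" where
  "DC_start ds = [1..int (sum_list ds)] @ rev (map uminus [1..int (sum_list ds)])"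

definition DC_points :: "nat list \<Rightarrow> int set" where
  "DC_points ds = set (DC_start ds)"

definition is_DC_cs_ncgen :: "nat list \<Rightarrow> (int \<Rightarrow> int list) \<Rightarrow> bool" where
  "is_DC_cs_ncgen ds \<pi> \<longleftrightarrow>
     even_near_critical (DC_points ds) \<pi> \<and>
     centrally_symmetric (DC_points ds) \<pi> \<and>
     noncentral_general_position \<pi> \<and>
     central_signature \<pi> (2 * sum_list ds) = ds \<and>
     \<pi> 0 = DC_start ds \<and>
     (\<exists>b. crossing_switch (\<pi> 0) (\<pi> 1) b \<and> length b = 2 * hd ds)"

definition DC_cs_ncgen :: "nat list \<Rightarrow> int \<Rightarrow> int list" where
  "DC_cs_ncgen ds = (THE \<pi>. is_DC_cs_ncgen ds \<pi>)"


section \<open>Geometric realizability\<close>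

definition direction :: "real \<Rightarrow> real \<times> real" where
  "direction \<theta> = (cos \<theta>, sin \<theta>)"

text \<open>The angles at which the directed line is orthogonal to some connecting line of \<open>P\<close>.\<close>

definition critical_angles :: "(real \<times> real) set \<Rightarrow> real set" where
  "critical_angles P = {\<theta>. \<exists>p\<in>P. \<exists>q\<in>P. p \<noteq> q \<and> (q - p) \<bullet> direction \<theta> = 0}"

text \<open>
  The line rotates counterclockwise, and \<open>\<theta>\<close> enumerates the critical angles in increasing
  order. Between consecutive critical angles, \<open>\<sigma> i\<close> lists \<open>P\<close> in the order of the projections.
  The starting angle is free, hence \<open>\<sigma>\<close> is determined up to a shift of the index.
\<close>

definition circular_sequence :: "(real \<times> real) set \<Rightarrow> (int \<Rightarrow> (real \<times> real) list) \<Rightarrow> bool" where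
  "circular_sequence P \<sigma> \<longleftrightarrow>
     (\<exists>\<theta> :: int \<Rightarrow> real.
        strict_mono \<theta> \<and> range \<theta> = critical_angles P \<and>
        (\<forall>i. set (\<sigma> i) = P \<and>
           (\<forall>\<phi>. \<theta> i < \<phi> \<and> \<phi> < \<theta> (i + 1) \<longrightarrow>
              sorted_wrt (\<lambda>p q. p \<bullet> direction \<phi> < q \<bullet> direction \<phi>) (\<sigma> i))))"

definition geometrically_realizable :: "'a set \<Rightarrow> (int \<Rightarrow> 'a list) \<Rightarrow> bool" where
  "geometrically_realizable A \<pi> \<longleftrightarrow>
     (\<exists>P \<sigma>. finite P \<and> circular_sequence P \<sigma> \<and> combinatorially_equivalent A \<pi> P \<sigma>)"

end

theory Submission
  imports Defs
begin

text \<open>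
  Count places from the centre of a permutation of \<open>2n\<close> points, with height \<open>r = 1, \<dots>, n\<close> in the
  left half; conjugation is \<open>r \<mapsto> 1 - r\<close>. A point passes the centre once per halfperiod, so it
  stays in the left half for \<open>2n\<close> moves. Suppose that a crossing at time \<open>T\<close> reverses \<open>2d\<close>
  points. The innermost of the \<open>d\<close> points that come to the left half must wait \<open>d - 1\<close> moves for the
  others to get out of its way, and waits as long at the end. In the \<open>2n - 2d + 1\<close> moves in
  between it switches with the \<open>2n - 2d\<close> points outside its class, so it pauses at most once; and it
  cannot turn round without pausing, because it would meet the same point twice. Hence it climbs,
  pauses once and descends. The other points of the class are squeezed between their inner neighbours
  and the bounds that speed and room impose, so their trajectories are forced as well
  (\<open>trajectory\<close>). The point with which the innermost one first trades places is the innermost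
  point of the next crossing, which therefore follows after \<open>d + d'\<close> moves (\<open>next_crossing\<close>).
  So the signature determines the whole motion. Conversely these trajectories form an
  allowable sequence: two of them meet exactly when they should. This computes \<open>DC_cs_ncgen\<close>
  (\<open>DC_cs_ncgen_eq\<close>) and the time of every switch: if the points of block \<open>i\<close> are numbered
  \<open>a = 0, 1, \<dots>\<close> from the inside and \<open>D i\<close> points belong to earlier blocks, then the point \<open>a\<close> of
  block \<open>i\<close> meets the conjugate of the point \<open>b\<close> of a later block \<open>j\<close> at time
  \<open>D (i + 1) + D j + b - a\<close>, up to a constant.

  In a realization, pairs that switch in the same move span parallel lines. Conjugate pairs do so,
  and averaging every point with the reflection of its conjugate makes the configuration
  centrally symmetric. Realizability thus means that there are vectors \<open>V i a\<close>, one for each point, such that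
  \<open>V i a + V j b\<close> points in a direction that depends on \<open>D (i + 1) + D j + b - a\<close> only and turns
  with it, and that the vectors of a block are collinear with the centre
  (\<open>slope_realization_realizable\<close>, \<open>realizable_slope_realization\<close>).

  If all blocks are single, the regular \<open>2n\<close>-gon does this. For two blocks, take geometric
  progressions on two lines. For three blocks of which two are single, take the points
  \<open>(\<plusminus>1, 0), \<dots>, (\<plusminus>m, 0)\<close> and \<open>\<plusminus>(1/2, 1)\<close>, \<open>\<plusminus>(-1/2, 1)\<close>; for \<open>(2, 2, 2)\<close>, take the
  multiples of three vectors \<open>c 0\<close>, \<open>c 1 = c 0 + c 2\<close>, \<open>c 2\<close> by \<open>\<plusminus>1\<close> and \<open>\<plusminus>\<phi>\<close> with the golden ratio \<open>\<phi>\<close>.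

  For the converse let \<open>c i\<close> be the vector of the innermost point of block \<open>i\<close>, and measure block \<open>i\<close> by
  multiples of \<open>c i\<close>. With at least three blocks, \<open>c (i - 1) + c (i + 1)\<close> is a multiple \<open>lam i\<close> of
  \<open>c i\<close>. Two adjacent blocks with at least two points each form geometric progressions with a
  common ratio \<open>q\<close>; comparing two of the expressions for \<open>lam i\<close> shows that neither has a third point
  (\<open>adjacent_large_blocks\<close>). For three blocks all \<open>lam i\<close> are \<open>1\<close>, and \<open>(2, 2, 1)\<close> would need both
  \<open>q - 1 = 1\<close> and \<open>q (q - 1) = 1\<close>. For four or more blocks the direction of \<open>c (i - 1) + c (i + 2)\<close> gives
  one more equation, and every arrangement of a block with at least two points next to others
  becomes contradictory (\<open>large_block_obstruction\<close>).
\<close>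

section \<open>Points moving through a halfperiod\<close>

lemma involution_shift:
  fixes f :: "int \<Rightarrow> 'a"
  assumes "\<And>s. f (s + N) = h (f s)" "\<And>y. h (h y) = y"
  shows "f (s + N * k) = (if even k then f s else h (f s))"
proof (induction k rule: int_induct[where k = 0])
  case (step1 i)
  then show ?case using assms(1)[of "s + N * i"] assms(2) by (auto simp: algebra_simps)
next
  case (step2 i)
  have "f (s + N * i) = h (f (s + N * (i - 1)))" using assms(1)[of "s + N * (i - 1)"] by (simp add: algebra_simps)
  then have "f (s + N * (i - 1)) = h (f (s + N * i))" using assms(2) by simp
  then show ?case using step2 assms(2) by auto
qed simp

lemma arithmetic_shift:
  fixes f :: "int \<Rightarrow> 'a :: comm_ring_1"
  assumes "\<And>x. f (x + c) = f x + \<delta>"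
  shows "f (x + c * k) = f x + of_int k * \<delta>"
proof (induction k rule: int_induct[where k = 0])
  case (step1 i)
  then show ?case using assms[of "x + c * i"] by (simp add: algebra_simps)
next
  case (step2 i)
  then show ?case using assms[of "x + c * (i - 1)"] by (simp add: algebra_simps)
qed simp

text \<open>
  \<open>R s p\<close> is the height of \<open>p\<close> at time \<open>s\<close>: the point at position \<open>k\<close> has height \<open>n + 1 - k\<close>. The left
  half has the heights \<open>1, \<dots>, n\<close>, and the point with the larger height comes first.
\<close>
definition flips :: "(int \<Rightarrow> 'p \<Rightarrow> int) \<Rightarrow> int \<Rightarrow> 'p \<Rightarrow> 'p \<Rightarrow> bool" where
  "flips R s p q \<longleftrightarrow> (R (s - 1) p < R (s - 1) q) \<noteq> (R s p < R s q)"

text \<open>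
  \<open>c s\<close> is half the number of points that the crossing switch of move \<open>s\<close> reverses, and \<open>0\<close> if there
  is none. Only switches of two points move a point that is not reversed, hence the bound in \<open>stay\<close>,
  which speaks of the left half; the right half follows by conjugation.
\<close>
locale central_motion =
  fixes P :: "'p set" and cj :: "'p \<Rightarrow> 'p" and n :: int
    and c :: "int \<Rightarrow> int" and R :: "int \<Rightarrow> 'p \<Rightarrow> int"
  assumes n_pos: "0 < n"
    and bij: "\<And>s. bij_betw (R s) P {1 - n..n}"
    and cj_mem: "\<And>p. p \<in> P \<Longrightarrow> cj p \<in> P"
    and cj: "\<And>s p. p \<in> P \<Longrightarrow> R s (cj p) = 1 - R s p"
    and period: "\<And>s p. p \<in> P \<Longrightarrow> R (s + 2 * n) p = 1 - R s p"
    and c_period: "\<And>s. c (s + 2 * n) = c s"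
    and c_range: "\<And>s. 0 \<le> c s \<and> c s \<le> n"
    and cross: "\<And>s p. p \<in> P \<Longrightarrow> 1 - c s \<le> R (s - 1) p \<Longrightarrow> R (s - 1) p \<le> c s \<Longrightarrow> R s p = 1 - R (s - 1) p"
    and stay: "\<And>s p. p \<in> P \<Longrightarrow> c s < R (s - 1) p \<Longrightarrow> c s < R s p \<and> \<bar>R s p - R (s - 1) p\<bar> \<le> 1"
    and once: "\<And>p q. p \<in> P \<Longrightarrow> q \<in> P \<Longrightarrow> p \<noteq> q \<Longrightarrow> \<exists>!s. 1 \<le> s \<and> s \<le> 2 * n \<and> flips R s p q"
begin

lemma R_inj: "p \<in> P \<Longrightarrow> q \<in> P \<Longrightarrow> R s p = R s q \<Longrightarrow> p = q"
  using bij[of s] by (auto simp: bij_betw_def inj_on_def)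

lemma R_range: "p \<in> P \<Longrightarrow> 1 - n \<le> R s p \<and> R s p \<le> n"
  using bij[of s] by (auto simp: bij_betw_def)

lemma R_surj: "1 - n \<le> r \<Longrightarrow> r \<le> n \<Longrightarrow> \<exists>p\<in>P. R s p = r"
  using bij[of s] unfolding bij_betw_def by (metis atLeastAtMost_iff imageE)

lemma finite_P: "finite P" and card_P: "card P = nat (2 * n)"
proof -
  show "finite P" using bij_betw_finite[OF bij[of 0]] by simp
  show "card P = nat (2 * n)" using bij_betw_same_card[OF bij[of 0]] by simp
qed

lemma period_back: "p \<in> P \<Longrightarrow> R (s - 2 * n) p = 1 - R s p"
  using period[of p "s - 2 * n"] by simp

lemma flips_commute: "p \<in> P \<Longrightarrow> q \<in> P \<Longrightarrow> p \<noteq> q \<Longrightarrow> flips R s p q = flips R s q p"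
  unfolding flips_def using R_inj by (metis not_less_iff_gr_or_eq)

lemma flips_shift:
  assumes "p \<in> P" "q \<in> P" "p \<noteq> q"
  shows "flips R (s + 2 * n) p q = flips R s p q"
proof -
  have "R (s + 2 * n - 1) x = 1 - R (s - 1) x" if "x \<in> P" for x
    using period[OF that, of "s - 1"] by (simp add: algebra_simps)
  moreover have "R s p \<noteq> R s q" "R (s - 1) p \<noteq> R (s - 1) q"
    using assms R_inj by blast+
  ultimately show ?thesis unfolding flips_def using assms period[of p s] period[of q s] by auto
qed

lemma flips_shifts:
  assumes "p \<in> P" "q \<in> P" "p \<noteq> q"
  shows "flips R (s + 2 * n * k) p q = flips R s p q"
  using involution_shift[of "\<lambda>s. flips R s p q" "2 * n" "\<lambda>y. y" s k] flips_shift[OF assms] by simp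

lemma flips_dvd:
  assumes "p \<in> P" "q \<in> P" "p \<noteq> q" "flips R s p q" "flips R s' p q"
  shows "2 * n dvd s - s'"
proof -
  define f where "f = (\<lambda>s. (s - 1) mod (2 * n) + 1)"
  have f: "1 \<le> f x \<and> f x \<le> 2 * n \<and> flips R (f x) p q" if "flips R x p q" for x
  proof -
    have "x = f x + 2 * n * ((x - 1) div (2 * n))" unfolding f_def using mult_div_mod_eq[of "2 * n" "x - 1"] by linarith
    then have "flips R (f x) p q" using flips_shifts[OF assms(1-3), of "f x"] that by metis
    moreover have "0 \<le> (x - 1) mod (2 * n)" "(x - 1) mod (2 * n) < 2 * n" using n_pos by auto
    ultimately show ?thesis unfolding f_def by auto
  qed
  have "f s = f s'" using once[OF assms(1-3)] f[OF assms(4)] f[OF assms(5)] by blast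
  then have "(s - 1) mod (2 * n) = (s' - 1) mod (2 * n)" unfolding f_def by simp
  then show ?thesis by (metis add.commute diff_add_cancel diff_diff_eq2 mod_eq_dvd_iff)
qed

lemma flips_unique:
  assumes "p \<in> P" "q \<in> P" "p \<noteq> q" "flips R s p q" "flips R s' p q" "\<bar>s - s'\<bar> < 2 * n"
  shows "s = s'"
proof -
  have "2 * n dvd s - s'" using flips_dvd assms by blast
  then show ?thesis using assms(6) dvd_imp_le_int[of "s - s'" "2 * n"] n_pos by auto
qed

lemma flips_exists:
  assumes "p \<in> P" "q \<in> P" "p \<noteq> q"
  shows "\<exists>s. a < s \<and> s \<le> a + 2 * n \<and> flips R s p q"
proof -
  obtain s0 where s0: "flips R s0 p q" using once[OF assms] by blast
  define k where "k = (a + 2 * n - s0) div (2 * n)"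
  have "a + 2 * n - s0 = 2 * n * k + (a + 2 * n - s0) mod (2 * n)" unfolding k_def by simp
  moreover have "0 \<le> (a + 2 * n - s0) mod (2 * n)" "(a + 2 * n - s0) mod (2 * n) < 2 * n"
    using n_pos by auto
  ultimately have "a < s0 + 2 * n * k" "s0 + 2 * n * k \<le> a + 2 * n" by linarith+
  then show ?thesis using flips_shifts[OF assms, of s0 k] s0 by blast
qed

lemma stay_right:
  assumes "p \<in> P" "R (s - 1) p < 1 - c s"
  shows "R s p < 1 - c s \<and> \<bar>R s p - R (s - 1) p\<bar> \<le> 1"
  using stay[OF cj_mem[OF assms(1)], of s] cj[OF assms(1)] assms by auto

lemma cross_back:
  assumes "p \<in> P" "1 - c s \<le> R s p" "R s p \<le> c s"
  shows "R (s - 1) p = 1 - R s p"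
  using cross[OF assms(1), of s] stay[OF assms(1), of s] stay_right[OF assms(1), of s] assms by linarith

lemma stay_back:
  assumes "p \<in> P" "c s < R s p"
  shows "c s < R (s - 1) p \<and> \<bar>R s p - R (s - 1) p\<bar> \<le> 1"
  using cross[OF assms(1), of s] stay[OF assms(1), of s] stay_right[OF assms(1), of s] assms
    c_range[of s] by linarith

lemma card_between:
  assumes "1 - n \<le> x" "y \<le> n"
  shows "card {q\<in>P. x \<le> R s q \<and> R s q \<le> y} = nat (y - x + 1)"
proof -
  have "bij_betw (R s) {q\<in>P. x \<le> R s q \<and> R s q \<le> y} {x..y}"
    unfolding bij_betw_def
  proof
    show "inj_on (R s) {q\<in>P. x \<le> R s q \<and> R s q \<le> y}" using R_inj unfolding inj_on_def by blast
    show "R s ` {q\<in>P. x \<le> R s q \<and> R s q \<le> y} = {x..y}"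
    proof
      show "{x..y} \<subseteq> R s ` {q\<in>P. x \<le> R s q \<and> R s q \<le> y}"
      proof
        fix r assume r: "r \<in> {x..y}"
        then obtain q where "q \<in> P" "R s q = r" using R_surj[of r s] assms by auto
        then show "r \<in> R s ` {q\<in>P. x \<le> R s q \<and> R s q \<le> y}" using r by auto
      qed
    qed auto
  qed
  then show ?thesis using bij_betw_same_card by fastforce
qed

lemma partner:
  assumes p: "p \<in> P" "c s < R (s - 1) p" "R s p \<noteq> R (s - 1) p"
  shows "\<exists>q\<in>P. R (s - 1) q = R s p \<and> R s q = R (s - 1) p"
proof -
  have left: "c s < R s p" "\<bar>R s p - R (s - 1) p\<bar> \<le> 1" using stay p by auto
  \<comment> \<open>the positions that \<open>p\<close> enters are as many before and after the move, so somebody leaves them\<close>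
  define x y where "x = (if R (s - 1) p < R s p then R s p else c s + 1)"
    and "y = (if R (s - 1) p < R s p then n else R s p)"
  define A where "A = (\<lambda>r. {q\<in>P. x \<le> R r q \<and> R r q \<le> y})"
  have card: "card (A r) = nat (y - x + 1)" for r
    unfolding A_def using left R_range[OF p(1), of s] c_range[of s]
    by (intro card_between) (auto simp: x_def y_def)
  have fin: "finite (A r)" for r unfolding A_def using finite_P by simp
  have pA: "p \<in> A s" "p \<notin> A (s - 1)" using p left R_range[OF p(1), of s] unfolding A_def x_def y_def by auto
  have "\<not> A (s - 1) \<subseteq> A s"
  proof
    assume "A (s - 1) \<subseteq> A s"
    then have "A (s - 1) = A s" using card_subset_eq[OF fin] card by metis
    then show False using pA by simp
  qed
  then obtain q where q: "q \<in> A (s - 1)" "q \<notin> A s" by blast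
  then have qP: "q \<in> P" "c s < R (s - 1) q" using left unfolding A_def x_def by (auto split: if_splits)
  have "R (s - 1) q = R s p \<and> R s q = R (s - 1) p"
    using stay[OF qP] q left p R_range[OF qP(1), of s] qP unfolding A_def x_def y_def by (auto split: if_splits)
  then show ?thesis using qP by blast
qed

text \<open>
  Running the moves backwards gives a motion of the same kind. So what holds at the beginning of a
  passage through the left half also holds at its end.
\<close>
lemma reversed: "central_motion P cj n (\<lambda>s. c (1 - s)) (\<lambda>s. R (- s))"
proof
  show "0 < n" by (rule n_pos)
  show "bij_betw (R (- s)) P {1 - n..n}" for s by (rule bij)
  show "cj p \<in> P" if "p \<in> P" for p using that by (rule cj_mem)
  show "R (- s) (cj p) = 1 - R (- s) p" if "p \<in> P" for s p using that by (rule cj)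
  show "R (- (s + 2 * n)) p = 1 - R (- s) p" if "p \<in> P" for s p
    using period_back[OF that, of "- s"] by (simp add: algebra_simps)
  show "c (1 - (s + 2 * n)) = c (1 - s)" for s
    using c_period[of "1 - (s + 2 * n)"] by (simp add: algebra_simps)
  show "0 \<le> c (1 - s) \<and> c (1 - s) \<le> n" for s by (rule c_range)
  have e: "- (s - 1) = 1 - s" "(1 - s) - 1 = - s" for s :: int by auto
  show "R (- s) p = 1 - R (- (s - 1)) p"
    if "p \<in> P" "1 - c (1 - s) \<le> R (- (s - 1)) p" "R (- (s - 1)) p \<le> c (1 - s)" for s p
    using cross_back[of p "1 - s"] that by (simp add: e)
  show "c (1 - s) < R (- s) p \<and> \<bar>R (- s) p - R (- (s - 1)) p\<bar> \<le> 1"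
    if "p \<in> P" "c (1 - s) < R (- (s - 1)) p" for s p
    using stay_back[of p "1 - s"] that by (simp add: e abs_minus_commute)
  show "\<exists>!s. 1 \<le> s \<and> s \<le> 2 * n \<and> flips (\<lambda>s. R (- s)) s p q" if "p \<in> P" "q \<in> P" "p \<noteq> q" for p q
  proof -
    have fl: "flips (\<lambda>s. R (- s)) s p q = flips R (1 - s) p q" for s
      unfolding flips_def by (auto simp: e)
    note pq = that
    obtain s where s: "- 2 * n < s" "s \<le> 0" "flips R s p q"
      using flips_exists[OF pq, of "- 2 * n"] by auto
    show ?thesis
    proof (rule ex1I[of _ "1 - s"])
      show "1 \<le> 1 - s \<and> 1 - s \<le> 2 * n \<and> flips (\<lambda>s. R (- s)) (1 - s) p q" using s fl by auto
      fix s' assume "1 \<le> s' \<and> s' \<le> 2 * n \<and> flips (\<lambda>s. R (- s)) s' p q"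
      then have "flips R (1 - s') p q" "\<bar>(1 - s') - s\<bar> < 2 * n" using fl s by auto
      then show "s' = 1 - s" using flips_unique[OF pq _ s(3)] by fastforce
    qed
  qed
qed

text \<open>
  A point leaves the left half only by meeting its conjugate, which happens once per halfperiod.
\<close>
lemma left_window:
  assumes "p \<in> P" "1 \<le> R T p" "R T p \<le> c T" "T \<le> s" "s < T + 2 * n"
  shows "1 \<le> R s p"
  using assms(4,5)
proof (induction s rule: int_ge_induct)
  case base
  then show ?case using assms by simp
next
  case (step i)
  have ne: "p \<noteq> cj p" using cj[OF assms(1), of 0] by (metis diff_add_cancel dvd_triv_left mult_2 odd_one)
  have "R (T - 1) p = 1 - R T p" using cross_back assms by auto
  then have "flips R T p (cj p)" unfolding flips_def using cj[OF assms(1)] assms by auto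
  moreover have "\<not> flips R (i + 1) p (cj p)"
    using flips_unique[OF assms(1) cj_mem[OF assms(1)] ne, of "i + 1" T] calculation step.hyps step.prems by auto
  moreover have "1 \<le> R i p" using step by simp
  ultimately show ?case unfolding flips_def using cj[OF assms(1)] by auto
qed

lemma window_noncrossing:
  assumes "p \<in> P" "1 \<le> R T p" "R T p \<le> c T" "T < s" "s < T + 2 * n"
  shows "c s < R (s - 1) p"
proof (rule ccontr)
  assume "\<not> c s < R (s - 1) p"
  moreover have "1 \<le> R (s - 1) p" "1 \<le> R s p" using left_window[OF assms(1-3)] assms by auto
  ultimately show False using cross[OF assms(1), of s] c_range[of s] by auto
qed

text \<open>
  Points that cross together meet in the crossing, and not again before they cross back.
\<close>
lemma window_order:
  assumes "p \<in> P" "1 \<le> R T p" "q \<in> P" "R T p < R T q" "R T q \<le> c T" "T \<le> s" "s < T + 2 * n"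
  shows "R s p < R s q"
  using assms(6,7)
proof (induction s rule: int_ge_induct)
  case base
  then show ?case using assms by simp
next
  case (step i)
  have ne: "p \<noteq> q" using assms(4) by blast
  have "R (T - 1) p = 1 - R T p" "R (T - 1) q = 1 - R T q" using cross_back assms by auto
  then have "flips R T p q" unfolding flips_def using assms by auto
  then have "\<not> flips R (i + 1) p q"
    using flips_unique[OF assms(1,3) ne, of "i + 1" T] step.hyps step.prems by auto
  moreover have "R i p < R i q" using step by simp
  ultimately show ?case unfolding flips_def by auto
qed

end

section \<open>Trajectories\<close>

text \<open>
  A positive walk from \<open>1\<close> to \<open>1\<close> that pauses at most once and turns round only after a pause has to
  climb, to pause at the top and to descend: climbing or descending throughout is impossible.
\<close>
lemma single_peak:
  fixes f :: "nat \<Rightarrow> int"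
  assumes ends: "f 0 = 1" "f (2 * m + 1) = 1"
    and low: "\<And>i. i \<le> 2 * m + 1 \<Longrightarrow> 1 \<le> f i"
    and step: "\<And>i. i \<le> 2 * m \<Longrightarrow> \<bar>f (Suc i) - f i\<bar> \<le> 1"
    and noback: "\<And>i. Suc i \<le> 2 * m \<Longrightarrow> f (Suc i) \<noteq> f i \<Longrightarrow> f (Suc (Suc i)) \<noteq> f (Suc i) \<Longrightarrow>
      f (Suc (Suc i)) - f (Suc i) = f (Suc i) - f i"
    and idle: "\<And>i j. i \<le> 2 * m \<Longrightarrow> j \<le> 2 * m \<Longrightarrow> f (Suc i) = f i \<Longrightarrow> f (Suc j) = f j \<Longrightarrow> i = j"
    and i: "i \<le> 2 * m + 1"
  shows "f i = 1 + min (int i) (2 * int m + 1 - int i)"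
proof -
  have rise: "\<forall>j\<le>k. f j = 1 + int j" if "\<And>i. i < k \<Longrightarrow> f (Suc i) \<noteq> f i" "k \<le> 2 * m + 1" for k
    using that
  proof (induction k)
    case 0
    then show ?case using ends by simp
  next
    case (Suc k)
    then have k: "\<forall>j\<le>k. f j = 1 + int j" by simp
    have ne: "f (Suc k) \<noteq> f k" using Suc by simp
    have "f (Suc k) = 1 + int (Suc k)"
    proof (cases k)
      case 0
      then show ?thesis using step[of 0] low[of 1] ends ne by (auto simp: abs_if split: if_splits)
    next
      case (Suc k')
      have "f (Suc k) - f k = f k - f k'" using noback[of k'] Suc.prems ne Suc k by auto
      then show ?thesis using k Suc by simp
    qed
    then show ?case using k by (auto simp: le_Suc_eq)
  qed
  have "\<exists>j\<le>2 * m. f (Suc j) = f j"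
  proof (rule ccontr)
    assume "\<not> ?thesis"
    then have "\<forall>j\<le>2 * m + 1. f j = 1 + int j" by (intro rise) auto
    then show False using ends by auto
  qed
  then obtain j where j: "j \<le> 2 * m" "f (Suc j) = f j" by blast
  have ne: "f (Suc k) \<noteq> f k" if "k \<le> 2 * m" "k \<noteq> j" for k using idle[OF that(1) j(1)] that j(2) by blast
  have up: "\<forall>i\<le>j. f i = 1 + int i" using j ne by (intro rise) auto
  \<comment> \<open>after the idle step all steps have the same sign\<close>
  define e where "e = f (Suc (Suc j)) - f (Suc j)"
  have down: "f (Suc j + k) = f j + e * int k" if "Suc j + k \<le> 2 * m + 1" for k
    using that
  proof (induction k rule: less_induct)
    case (less k)
    show ?case
    proof (cases "k \<le> 1")
      case True
      then show ?thesis using j unfolding e_def by (cases k) auto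
    next
      case False
      then obtain l where l: "k = Suc (Suc l)" by (metis One_nat_def Suc_le_eq not0_implies_Suc not_less_eq_eq zero_less_Suc less_Suc0 le_simps(2) linorder_not_le)
      have "f (Suc j + Suc (Suc l)) - f (Suc j + Suc l) = f (Suc j + Suc l) - f (Suc j + l)"
        using noback[of "Suc j + l"] ne[of "Suc j + l"] ne[of "Suc j + Suc l"] less.prems l by simp
      then show ?thesis using less.IH[of "Suc l"] less.IH[of l] less.prems l by (simp add: algebra_simps)
    qed
  qed
  have e1: "e = - 1 \<and> 2 * m - j = j \<or> j = 2 * m \<and> m = 0"
  proof (cases "j = 2 * m")
    case True
    then show ?thesis using down[of 0] up ends by auto
  next
    case False
    have e: "\<bar>e\<bar> \<le> 1" "e \<noteq> 0" using step[of "Suc j"] ne[of "Suc j"] False j unfolding e_def by auto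
    have "1 = 1 + int j + e * int (2 * m - j)"
      using down[of "2 * m - j"] up ends(2) j by auto
    then have "int j + e * int (2 * m - j) = 0" by linarith
    moreover have "e = 1 \<or> e = - 1" using e by linarith
    ultimately show ?thesis using False j by auto
  qed
  show ?thesis
  proof (cases "i \<le> j")
    case True
    then show ?thesis using up e1 j by auto
  next
    case False
    then have "int (i - Suc j) = int i - int j - 1" by auto
    then have "f i = 1 + int j + e * (int i - int j - 1)"
      using down[of "i - Suc j"] False up i by auto
    then show ?thesis using False e1 j i by (cases "i = Suc j") auto
  qed
qed

context central_motion
begin

lemma inner_bound:
  assumes "p \<in> P" "R T p = int a + 1" "int a < c T" "T \<le> s" "s < T + 2 * n"
  shows "int a + 1 \<le> R s p"
  using assms
proof (induction a arbitrary: p)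
  case 0
  then show ?case using left_window[of p T s] by auto
next
  case (Suc a)
  obtain q where q: "q \<in> P" "R T q = int a + 1"
    using R_surj[of "int a + 1" T] Suc.prems c_range[of T] by auto
  then have "int a + 1 \<le> R s q" using Suc by auto
  moreover have "R s q < R s p" using window_order[of q T p s] q Suc.prems by auto
  ultimately show ?case by simp
qed

lemma outer_bound:
  assumes "p \<in> P" "R T p = c T - int k" "1 \<le> R T p" "T \<le> s" "s < T + 2 * n"
  shows "R s p \<le> n - int k"
  using assms
proof (induction k arbitrary: p)
  case 0
  then show ?case using R_range by auto
next
  case (Suc k)
  obtain q where q: "q \<in> P" "R T q = c T - int k"
    using R_surj[of "c T - int k" T] Suc.prems c_range[of T] by auto
  then have "R s q \<le> n - int k" using Suc by auto
  moreover have "R s p < R s q" using window_order[of p T q s] q Suc.prems by auto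
  ultimately show ?case by simp
qed

text \<open>
  The points of a class leave the centre one after the other: as long as its outer neighbour has not
  moved, a point could only trade places with that neighbour, which it has just met.
\<close>
lemma wait:
  assumes "p \<in> P" "R T p = int a + 1" "int u \<le> c T - 1 - int a"
  shows "R (T + int u) p = int a + 1"
  using assms
proof (induction u arbitrary: p a)
  case 0
  then show ?case by simp
next
  case (Suc u)
  have n2: "T + int (Suc u) < T + 2 * n" using Suc.prems c_range[of T] n_pos by auto
  have now: "R (T + int u) p = int a + 1" using Suc by auto
  have low: "int a + 1 \<le> R (T + int (Suc u)) p" using inner_bound[OF Suc.prems(1,2)] Suc.prems n2 by auto
  have nc: "c (T + int (Suc u)) < R (T + int u) p"
    using window_noncrossing[of p T "T + int (Suc u)"] Suc.prems n2 by (simp add: algebra_simps)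
  show ?case
  proof (rule ccontr)
    assume ne: "R (T + int (Suc u)) p \<noteq> int a + 1"
    have m: "R (T + int (Suc u)) p = int a + 2" "R (T + int (Suc u)) p \<noteq> R (T + int u) p"
      using stay[of p "T + int (Suc u)"] Suc.prems(1) nc now low ne by (auto simp: algebra_simps)
    obtain q where q: "q \<in> P" "R (T + int u) q = int a + 2" "R (T + int (Suc u)) q = int a + 1"
      using partner[of p "T + int (Suc u)"] Suc.prems(1) nc m now by (auto simp: algebra_simps)
    obtain p' where p': "p' \<in> P" "R T p' = int (Suc a) + 1"
      using R_surj[of "int a + 2" T] Suc.prems c_range[of T] by auto
    have "R (T + int u) p' = int (Suc a) + 1" using Suc.IH[OF p'] Suc.prems by auto
    then have "q = p'" using R_inj[of q p' "T + int u"] p' q by auto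
    then show False using window_order[of p T p' "T + int (Suc u)"] Suc.prems p' q m n2 by auto
  qed
qed

lemma window_end:
  assumes "p \<in> P" "1 - c T \<le> R T p" "R T p \<le> c T"
  shows "R (T + 2 * n - 1) p = R T p"
  using cross_back[of p "T + 2 * n"] period[of p T] assms c_period[of T] by auto

lemma end_wait:
  assumes "p \<in> P" "R T p = int a + 1" "int u \<le> c T - 1 - int a"
  shows "R (T + 2 * n - 1 - int u) p = int a + 1"
proof -
  have e: "1 - - (T + 2 * n - 1) = T + 2 * n" by simp
  have "R (- (- (T + 2 * n - 1) + int u)) p = int a + 1"
    by (rule central_motion.wait[OF reversed])
      (use assms window_end[of p T] c_period[of T] in \<open>auto simp: e algebra_simps\<close>)
  then show ?thesis by (simp add: algebra_simps)
qed

text \<open>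
  In a move outside the centre a point meets at most one other point, the one with which it trades
  places.
\<close>
lemma flips_moves:
  assumes "p \<in> P" "q \<in> P" "q \<noteq> p" "c s < R (s - 1) p" "flips R s p q"
  shows "R s p \<noteq> R (s - 1) p \<and> R (s - 1) q = R s p"
proof -
  have qne: "R s q \<noteq> R s p" "R (s - 1) q \<noteq> R (s - 1) p" using R_inj assms by blast+
  have pl: "c s < R s p" "\<bar>R s p - R (s - 1) p\<bar> \<le> 1" using stay assms by auto
  have ql: "c s < R (s - 1) q"
    using cross[of q s] stay_right[of q s] assms pl c_range[of s] unfolding flips_def by force
  have q1: "\<bar>R s q - R (s - 1) q\<bar> \<le> 1" using stay ql assms by auto
  have mv: "R s p \<noteq> R (s - 1) p" using q1 qne assms(5) unfolding flips_def by linarith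
  obtain r where r: "r \<in> P" "R (s - 1) r = R s p" "R s r = R (s - 1) p"
    using partner[OF assms(1,4) mv] by blast
  have "q = r"
  proof (rule ccontr)
    assume "q \<noteq> r"
    then have "R (s - 1) q \<noteq> R s p" "R s q \<noteq> R (s - 1) p" using R_inj r assms by metis+
    then show False using q1 qne pl mv assms(5) unfolding flips_def by linarith
  qed
  then show ?thesis using r mv by simp
qed

text \<open>
  Turning round at once means meeting the same point in two consecutive moves.
\<close>
lemma no_turning_back:
  assumes "p \<in> P" "1 \<le> R T p" "R T p \<le> c T" "T < s" "s + 1 < T + 2 * n"
    and "R s p \<noteq> R (s - 1) p" "R (s + 1) p \<noteq> R s p"
  shows "R (s + 1) p - R s p = R s p - R (s - 1) p"
proof (rule ccontr)
  assume ne: "\<not> ?thesis"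
  have nc: "c s < R (s - 1) p" "c (s + 1) < R (s + 1 - 1) p"
    using window_noncrossing[OF assms(1-3), of s] window_noncrossing[OF assms(1-3), of "s + 1"] assms
    by auto
  have ret: "R (s + 1) p = R (s - 1) p"
    using stay[OF assms(1) nc(1)] stay[OF assms(1) nc(2)] ne assms(6,7) by auto
  obtain q where q: "q \<in> P" "R (s - 1) q = R s p" "R s q = R (s - 1) p"
    using partner[OF assms(1) nc(1)] assms by blast
  obtain r where r: "r \<in> P" "R s r = R (s + 1) p" "R (s + 1) r = R s p"
    using partner[OF assms(1) nc(2)] assms by auto
  have "r = q" using R_inj q r ret by metis
  then have "flips R s p q" "flips R (s + 1) p q" "p \<noteq> q"
    using q r assms ret by (auto simp: flips_def)
  then show False using flips_unique[of p q s "s + 1"] assms(1) q n_pos by auto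
qed

end

text \<open>
  The height of the point \<open>a\<close> (with \<open>0\<close> for the innermost) of a crossing of \<open>2 d\<close> points, \<open>u\<close> moves after the
  crossing: it waits, climbs, rests at the top, descends, and waits for the next crossing.
\<close>
definition trapezoid :: "int \<Rightarrow> int \<Rightarrow> int \<Rightarrow> int \<Rightarrow> int" where
  "trapezoid n d a u =
     max (a + 1) (min (n - d + 1 + a) (min (u - d + 2 + 2 * a) (2 * n - u - d + 1 + 2 * a)))"

context central_motion
begin

text \<open>
  The innermost point waits \<open>c T - 1\<close> moves at either end of its passage, has \<open>2 n - 2 * c T + 1\<close> moves
  in between, and needs \<open>2 n - 2 * c T\<close> of them to meet the points outside its class one by one.
\<close>
lemma one_idle:
  assumes p: "p \<in> P" "R T p = 1" and d: "1 \<le> c T"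
    and s: "T + c T \<le> s" "s \<le> T + 2 * n - c T" "R s p = R (s - 1) p"
    and s': "T + c T \<le> s'" "s' \<le> T + 2 * n - c T" "R s' p = R (s' - 1) p"
  shows "s = s'"
proof (rule ccontr)
  assume "s \<noteq> s'"
  define M where "M = {T + c T..T + 2 * n - c T}"
  define Q where "Q = {q\<in>P. R T q < 1 - c T \<or> c T < R T q}"
  have "\<exists>x. x \<in> M - {s, s'} \<and> R (x - 1) q = R x p" if "q \<in> Q" for q
  proof -
    have q: "q \<in> P" "q \<noteq> p" using that p d unfolding Q_def by auto
    obtain x where x: "T < x" "x \<le> T + 2 * n" "flips R x p q"
      using flips_exists[of p q T] p q by blast
    have "\<not> flips R T p q"
    proof -
      have "R (T - 1) p = 0" using cross_back[of p T] p d by auto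
      moreover have "R (T - 1) q < 1 - c T \<and> R T q < 1 - c T \<or> c T < R (T - 1) q \<and> c T < R T q"
      proof -
        have "\<not> (1 - c T \<le> R (T - 1) q \<and> R (T - 1) q \<le> c T)"
          using that cross[of q T] unfolding Q_def by auto
        then show ?thesis using stay_right[of q T] stay[of q T] q by fastforce
      qed
      ultimately show ?thesis using p d by (auto simp: flips_def)
    qed
    then have "x \<noteq> T + 2 * n" using flips_shift[of p q T] p q x by auto
    then have x2: "x < T + 2 * n" using x by simp
    have mv: "R x p \<noteq> R (x - 1) p" "R (x - 1) q = R x p"
      using flips_moves[of p q x] window_noncrossing[of p T x] p q x x2 d by auto
    have "T + c T \<le> x"
    proof (rule ccontr)
      assume "\<not> ?thesis"
      then have "R (T + int (nat (x - T))) p = 1" "R (T + int (nat (x - 1 - T))) p = 1"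
        using wait[of p T 0 "nat (x - T)"] wait[of p T 0 "nat (x - 1 - T)"] p x by auto
      then show False using mv x by simp
    qed
    moreover have "x \<le> T + 2 * n - c T"
    proof (rule ccontr)
      assume "\<not> ?thesis"
      then have "R (T + 2 * n - 1 - int (nat (T + 2 * n - 1 - x))) p = 1"
        "R (T + 2 * n - 1 - int (nat (T + 2 * n - x))) p = 1"
        using end_wait[of p T 0 "nat (T + 2 * n - 1 - x)"] end_wait[of p T 0 "nat (T + 2 * n - x)"] p x2
        by auto
      then show False using mv x2 by simp
    qed
    ultimately show ?thesis using mv s s' unfolding M_def by auto
  qed
  then obtain g where g: "\<And>q. q \<in> Q \<Longrightarrow> g q \<in> M - {s, s'} \<and> R (g q - 1) q = R (g q) p" by metis
  have "inj_on g Q"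
  proof (rule inj_onI)
    fix q r assume qr: "q \<in> Q" "r \<in> Q" "g q = g r"
    then have "R (g q - 1) q = R (g q - 1) r" using g[of q] g[of r] by simp
    then show "q = r" using R_inj[of q r "g q - 1"] qr unfolding Q_def by simp
  qed
  then have "card Q \<le> card (M - {s, s'})"
    using g by (intro card_inj_on_le) (auto simp: M_def)
  also have "\<dots> = card M - 2" using s s' \<open>s \<noteq> s'\<close> by (subst card_Diff_subset) (auto simp: M_def)
  also have "card M = nat (2 * n - 2 * c T + 1)" unfolding M_def by simp
  finally have "card Q \<le> nat (2 * n - 2 * c T + 1) - 2" .
  moreover have "card Q = nat (2 * n - 2 * c T)"
  proof -
    have "bij_betw (R T) Q ({1 - n..n} - {1 - c T..c T})"
      unfolding bij_betw_def
    proof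
      show "inj_on (R T) Q" using R_inj unfolding Q_def inj_on_def by blast
      show "R T ` Q = {1 - n..n} - {1 - c T..c T}"
      proof
        show "R T ` Q \<subseteq> {1 - n..n} - {1 - c T..c T}" using R_range unfolding Q_def by auto
        show "{1 - n..n} - {1 - c T..c T} \<subseteq> R T ` Q"
        proof
          fix r assume r: "r \<in> {1 - n..n} - {1 - c T..c T}"
          then obtain q where "q \<in> P" "R T q = r" using R_surj[of r T] by auto
          then show "r \<in> R T ` Q" using r unfolding Q_def by auto
        qed
      qed
    qed
    then have "card Q = card ({1 - n..n} - {1 - c T..c T})" by (rule bij_betw_same_card)
    also have "\<dots> = card {1 - n..n} - card {1 - c T..c T}"
      using c_range[of T] by (intro card_Diff_subset) auto
    finally show ?thesis using c_range[of T] d by (simp add: nat_diff_distrib')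
  qed
  moreover have "T + c T < T + 2 * n - c T" using \<open>s \<noteq> s'\<close> s s' by linarith
  ultimately show False by linarith
qed

lemma innermost_trajectory:
  assumes p: "p \<in> P" "R T p = 1" and d: "1 \<le> c T" and u: "c T - 1 \<le> u" "u \<le> 2 * n - c T"
  shows "R (T + u) p = 1 + min (u - c T + 1) (2 * n - c T - u)"
proof -
  define f where "f = (\<lambda>i. R (T + c T - 1 + int i) p)"
  define m where "m = nat (n - c T)"
  have m: "int m = n - c T" using c_range[of T] unfolding m_def by simp
  have f_eq: "f (Suc i) = R (T + c T + int i) p" "f i = R (T + c T + int i - 1) p" for i
    unfolding f_def by (simp_all add: algebra_simps)
  have nc: "c (T + c T + int i) < R (T + c T + int i - 1) p" if "i \<le> 2 * m" for i
    using window_noncrossing[of p T "T + c T + int i"] p d that m c_range[of T] by auto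
  have "f (nat (u - c T + 1)) = 1 + min (int (nat (u - c T + 1))) (2 * int m + 1 - int (nat (u - c T + 1)))"
  proof (rule single_peak)
    show "f 0 = 1" using wait[of p T 0 "nat (c T - 1)"] p d unfolding f_def by (simp add: algebra_simps)
    have e: "T + 2 * n - 1 - int (nat (c T - 1)) = T + c T - 1 + int (2 * m + 1)" using d m by auto
    have "R (T + 2 * n - 1 - int (nat (c T - 1))) p = 1"
      using end_wait[of p T 0 "nat (c T - 1)"] p d by simp
    then show "f (2 * m + 1) = 1" unfolding f_def e .
    show "1 \<le> f i" if "i \<le> 2 * m + 1" for i
      using left_window[of p T "T + c T - 1 + int i"] p d that m c_range[of T] unfolding f_def by auto
    show "\<bar>f (Suc i) - f i\<bar> \<le> 1" if "i \<le> 2 * m" for i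
      using stay[OF p(1) nc[OF that]] unfolding f_eq[of i] by (rule conjunct2)
    show "f (Suc (Suc i)) - f (Suc i) = f (Suc i) - f i"
      if "Suc i \<le> 2 * m" "f (Suc i) \<noteq> f i" "f (Suc (Suc i)) \<noteq> f (Suc i)" for i
    proof -
      have "f (Suc (Suc i)) = R (T + c T + int i + 1) p" unfolding f_def by (simp add: algebra_simps)
      then show ?thesis using no_turning_back[of p T "T + c T + int i"] p d that m c_range[of T]
        unfolding f_eq[of i] by auto
    qed
    show "i = j" if "i \<le> 2 * m" "j \<le> 2 * m" "f (Suc i) = f i" "f (Suc j) = f j" for i j
      using one_idle[OF p d, of "T + c T + int i" "T + c T + int j"] that m f_eq[of i] f_eq[of j] by auto
    show "nat (u - c T + 1) \<le> 2 * m + 1" using u m by auto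
  qed
  moreover have "f (nat (u - c T + 1)) = R (T + u) p" using u unfolding f_def by simp
  ultimately show ?thesis using u m by auto
qed

lemma speed:
  assumes "p \<in> P" "R T p = int a + 1" "int a < c T" "c T - 1 - int a \<le> u" "u < 2 * n"
  shows "R (T + u) p \<le> u - c T + 2 + 2 * int a"
  using assms(4,5)
proof (induction u rule: int_ge_induct)
  case base
  then show ?case using wait[of p T a "nat (c T - 1 - int a)"] assms by auto
next
  case (step u)
  have "c (T + u + 1) < R (T + u + 1 - 1) p"
    using window_noncrossing[of p T "T + u + 1"] assms step by auto
  then have "R (T + u + 1) p \<le> R (T + u) p + 1" using stay[of p "T + u + 1"] assms by auto
  then show ?case using step by (simp add: algebra_simps)
qed

lemma end_speed:
  assumes "p \<in> P" "R T p = int a + 1" "int a < c T" "0 \<le> u" "u \<le> 2 * n - c T + int a"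
  shows "R (T + u) p \<le> 2 * n - u - c T + 1 + 2 * int a"
proof -
  have e: "1 - - (T + 2 * n - 1) = T + 2 * n" by simp
  have "R (- (- (T + 2 * n - 1) + (2 * n - 1 - u))) p \<le> (2 * n - 1 - u) - c (1 - - (T + 2 * n - 1)) + 2 + 2 * int a"
    by (rule central_motion.speed[OF reversed])
      (use assms window_end[of p T] c_period[of T] in \<open>auto simp: e algebra_simps\<close>)
  then show ?thesis using c_period[of T] by (simp add: e algebra_simps)
qed

text \<open>
  If \<open>p\<close> were directly outside \<open>q\<close>, then \<open>q\<close> would trade places with \<open>p\<close> when it climbs, but the two
  belong to the same class.
\<close>
lemma gap_before_rise:
  assumes "p \<in> P" "q \<in> P" "1 \<le> R T q" "R T q < R T p" "R T p \<le> c T" "T \<le> s" "s + 1 < T + 2 * n"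
    and rise: "R (s + 1) q = R s q + 1"
  shows "R s q + 2 \<le> R s p"
proof (rule ccontr)
  assume "\<not> ?thesis"
  then have "R s p = R (s + 1) q" using window_order[of q T p s] assms by auto
  moreover have "\<exists>r\<in>P. R s r = R (s + 1) q \<and> R (s + 1) r = R s q"
    using partner[of q "s + 1"] window_noncrossing[of q T "s + 1"] assms by auto
  ultimately have "R (s + 1) p = R s q" using R_inj assms(1) by metis
  then show False using window_order[of q T p "s + 1"] assms by auto
qed

lemma gap_after_fall:
  assumes "p \<in> P" "q \<in> P" "1 \<le> R T q" "R T q < R T p" "R T p \<le> c T" "T \<le> s" "s + 1 < T + 2 * n"
    and fall: "R (s + 1) q = R s q - 1"
  shows "R (s + 1) q + 2 \<le> R (s + 1) p"
proof (rule ccontr)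
  assume "\<not> ?thesis"
  then have "R (s + 1) p = R s q" using window_order[of q T p "s + 1"] assms by auto
  moreover have "\<exists>r\<in>P. R s r = R (s + 1) q \<and> R (s + 1) r = R s q"
    using partner[of q "s + 1"] window_noncrossing[of q T "s + 1"] assms by auto
  ultimately have "R s p = R (s + 1) q" using R_inj assms(1) by metis
  then show False using window_order[of q T p s] assms by auto
qed

text \<open>
  Induction from the inside to the outside. A step of the inner neighbour \<open>q\<close> forces a gap of two
  between \<open>q\<close> and \<open>p\<close>, and this is as far as the speed of \<open>p\<close> allows it to be; while \<open>q\<close> rests at the top,
  \<open>p\<close> is squeezed between \<open>q\<close> and the points outside \<open>p\<close>.
\<close>
theorem trajectory:
  assumes "p \<in> P" "R T p = int a + 1" "int a < c T" "0 \<le> u" "u < 2 * n"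
  shows "R (T + u) p = trapezoid n (c T) (int a) u"
  using assms
proof (induction a arbitrary: p u)
  case 0
  consider "u < c T - 1" | "2 * n - c T < u" | "c T - 1 \<le> u" "u \<le> 2 * n - c T" by linarith
  then show ?case
  proof cases
    case 1
    then show ?thesis using wait[of p T 0 "nat u"] 0 c_range[of T] unfolding trapezoid_def by auto
  next
    case 2
    then show ?thesis using end_wait[of p T 0 "nat (2 * n - 1 - u)"] 0 c_range[of T]
      unfolding trapezoid_def by auto
  next
    case 3
    then show ?thesis using innermost_trajectory[of p T u] 0 c_range[of T] unfolding trapezoid_def by auto
  qed
next
  case (Suc a)
  define d where "d = c T"
  have dn: "d \<le> n" using c_range unfolding d_def by simp
  have ad: "int a + 1 < d" using Suc.prems unfolding d_def by simp
  obtain q where q: "q \<in> P" "R T q = int a + 1"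
    using R_surj[of "int a + 1" T] Suc.prems c_range[of T] by auto
  have IH: "R (T + v) q = trapezoid n d (int a) v" if "0 \<le> v" "v < 2 * n" for v
    unfolding d_def using Suc.IH[OF q] Suc.prems that by auto
  have above: "R (T + u) q < R (T + u) p" using window_order[of q T p "T + u"] q Suc.prems by auto
  consider "u \<le> d - 2 - int a" | "2 * n - d + int a + 1 \<le> u"
    | "d - 1 - int a \<le> u" "u \<le> n - int a - 2"
    | "n - int a - 1 \<le> u" "u \<le> n + int a"
    | "n + int a + 1 \<le> u" "u \<le> 2 * n - d + int a" by linarith
  then show ?case
  proof cases
    case 1
    then show ?thesis using wait[of p T "Suc a" "nat u"] Suc.prems dn unfolding trapezoid_def d_def by auto
  next
    case 2
    then show ?thesis using end_wait[of p T "Suc a" "nat (2 * n - 1 - u)"] Suc.prems dn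
      unfolding trapezoid_def d_def by auto
  next
    case 3
    have "R (T + u) q = u - d + 2 + 2 * int a" "R (T + u + 1) q = u - d + 3 + 2 * int a"
      using IH[of u] IH[of "u + 1"] 3 ad Suc.prems unfolding trapezoid_def by (auto simp: algebra_simps)
    then have "u - d + 4 + 2 * int a \<le> R (T + u) p"
      using gap_before_rise[of p q T "T + u"] q Suc.prems 3 ad by auto
    moreover have "R (T + u) p \<le> u - d + 4 + 2 * int a"
      using speed[of p T "Suc a" u] Suc.prems 3 unfolding d_def by auto
    ultimately show ?thesis using 3 ad dn unfolding d_def[symmetric] trapezoid_def by auto
  next
    case 4
    have "R (T + u) q = n - d + 1 + int a"
      using IH[of u] 4 ad dn Suc.prems unfolding trapezoid_def by auto
    moreover have "R (T + u) p \<le> n - (d - 2 - int a)"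
      using outer_bound[of p T "nat (d - 2 - int a)" "T + u"] Suc.prems ad unfolding d_def by auto
    ultimately show ?thesis using above 4 ad dn unfolding d_def[symmetric] trapezoid_def by auto
  next
    case 5
    have "R (T + u) q = 2 * n - u - d + 1 + 2 * int a" "R (T + u - 1) q = 2 * n - u - d + 2 + 2 * int a"
      using IH[of u] IH[of "u - 1"] 5 ad dn Suc.prems unfolding trapezoid_def by (auto simp: algebra_simps)
    then have "2 * n - u - d + 3 + 2 * int a \<le> R (T + u) p"
      using gap_after_fall[of p q T "T + u - 1"] q Suc.prems 5 ad dn by auto
    moreover have "R (T + u) p \<le> 2 * n - u - d + 3 + 2 * int a"
      using end_speed[of p T "Suc a" u] Suc.prems 5 unfolding d_def by auto
    ultimately show ?thesis using 5 ad dn unfolding d_def[symmetric] trapezoid_def by auto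
  qed
qed

text \<open>
  Conjugate points are on different sides of the centre, so they only meet in a crossing.
\<close>
lemma conjugate_flip_crossing:
  assumes "q \<in> P" "flips R x q (cj q)"
  shows "1 - c x \<le> R x q \<and> R x q \<le> c x"
proof (rule ccontr)
  assume "\<not> ?thesis"
  then consider "c x < R x q" | "R x q < 1 - c x" by linarith
  then show False
    using assms(2) stay_back[of q x] stay_back[OF cj_mem[OF assms(1)], of x] assms(1) cj[OF assms(1)] c_range[of x]
    unfolding flips_def by cases auto
qed

text \<open>
  The innermost point \<open>p\<close> leaves height \<open>1\<close> in move \<open>T + c T\<close> and trades places with some \<open>q\<close>. A point that
  reaches height \<open>1\<close> is the innermost one of its class, and by its trajectory \<open>q\<close> now waits for its
  crossing. Until then either \<open>p\<close> or \<open>q\<close> has height \<open>1\<close>, and no other crossing takes place.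
\<close>
theorem next_crossing:
  assumes d: "1 \<le> c T" "c T < n"
  shows "\<exists>d. 1 \<le> d \<and> c (T + c T + d) = d \<and> (\<forall>s. T < s \<and> s < T + c T + d \<longrightarrow> c s = 0)"
proof -
  obtain p where p: "p \<in> P" "R T p = 1" using R_surj[of 1 T] n_pos by auto
  define s where "s = T + c T"
  have s: "T < s" "s < T + 2 * n" using d unfolding s_def by auto
  have ps: "R (s - 1) p = 1" "R s p = 2"
    using trajectory[of p T 0 "c T - 1"] trajectory[of p T 0 "c T"] p d
    unfolding s_def trapezoid_def by (auto simp: algebra_simps)
  obtain q where q: "q \<in> P" "R (s - 1) q = 2" "R s q = 1"
    using partner[of p s] window_noncrossing[of p T s] p d s ps by auto
  have ne: "q \<noteq> cj q" using cj[OF q(1), of s] q by auto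
  \<comment> \<open>the move at which the partner of the innermost point has entered its half\<close>
  obtain x where x: "s - 2 * n < x" "x \<le> s" "flips R x q (cj q)"
    using flips_exists[OF q(1) cj_mem[OF q(1)] ne, of "s - 2 * n"] by auto
  have qx: "1 \<le> R x q \<and> R x q \<le> c x"
  proof -
    have "1 - c x \<le> R x q \<and> R x q \<le> c x" using conjugate_flip_crossing[OF q(1) x(3)] .
    moreover have "1 \<le> R x q"
    proof (rule ccontr)
      assume "\<not> ?thesis"
      then have "1 \<le> R x (cj q)" "R x (cj q) \<le> c x" using calculation cj[OF q(1)] by auto
      then have "1 \<le> R s (cj q)" using left_window[of "cj q" x s] cj_mem[OF q(1)] x by auto
      then show False using cj[OF q(1)] q by auto
    qed
    ultimately show ?thesis by simp
  qed
  have xs: "x < s"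
  proof (rule ccontr)
    assume "\<not> x < s"
    then have "x = s" using x by simp
    then show False using cross_back[of q s] qx q by auto
  qed
  define d' where "d' = c x"
  have d': "1 \<le> d'" "d' \<le> n" using qx c_range unfolding d'_def by auto
  have qx1: "R x q = 1"
    using inner_bound[of q x "nat (R x q - 1)" s] q qx x by auto
  have "x + 2 * n = s + d'"
    using trajectory[of q x 0 "s - x"] trajectory[of q x 0 "s - 1 - x"] q qx1 qx x xs d'
    unfolding d'_def[symmetric] trapezoid_def by (auto simp: max_def min_def split: if_splits)
  then have x2: "x + 2 * n = T + c T + d'" unfolding s_def by simp
  show ?thesis
  proof (intro exI[of _ d'] conjI allI impI)
    show "1 \<le> d'" by fact
    show "c (T + c T + d') = d'" using c_period[of x] x2 unfolding d'_def by simp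
    fix y assume y: "T < y \<and> y < T + c T + d'"
    show "c y = 0"
    proof (cases "y \<le> s")
      case True
      have "R (y - 1) p = 1" using trajectory[of p T 0 "y - 1 - T"] p d y True s
        unfolding s_def trapezoid_def by (auto simp: algebra_simps)
      then show ?thesis using window_noncrossing[of p T y] p d y True s c_range[of y] by auto
    next
      case False
      have "R (y - 1) q = 1" using trajectory[of q x 0 "y - 1 - x"] q qx qx1 y False x x2 d'
        unfolding s_def d'_def[symmetric] trapezoid_def by (auto simp: algebra_simps)
      then show ?thesis using window_noncrossing[of q x y] q qx y False x x2 xs c_range[of y] by auto
    qed
  qed
qed

end

section \<open>The model motion of a cyclic sequence of blocks\<close>

text \<open>
  The two points have crossed \<open>d + d' + 2 g\<close> moves apart. By parity a climbing and a descending point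
  never have the same height, and so they pass each other once, at the stated time.
\<close>
lemma trapezoid_overtakes:
  assumes "0 \<le> a" "a < d" "0 \<le> b" "b < d'" "0 \<le> g" "g + d + d' \<le> n"
    and "0 \<le> u" "u < d + d' + 2 * g"
  shows "u < d + g + b - a \<Longrightarrow> trapezoid n d a u < trapezoid n d' b (u - (d + d' + 2 * g) + 2 * n)"
    and "d + g + b - a \<le> u \<Longrightarrow> trapezoid n d' b (u - (d + d' + 2 * g) + 2 * n) < trapezoid n d a u"
  using assms unfolding trapezoid_def max_def min_def by (simp_all split: if_splits)

lemma trapezoid_mono: "a < b \<Longrightarrow> trapezoid n d a u < trapezoid n d b u"
  unfolding trapezoid_def by auto

lemma trapezoid_bounds: "0 \<le> a \<Longrightarrow> a < d \<Longrightarrow> d \<le> n \<Longrightarrow> 1 \<le> trapezoid n d a u \<and> trapezoid n d a u \<le> n"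
  unfolding trapezoid_def by auto

lemma trapezoid_lipschitz: "\<bar>trapezoid n d a (u + 1) - trapezoid n d a u\<bar> \<le> 1"
  unfolding trapezoid_def max_def min_def by auto

lemma trapezoid_ends:
  assumes "0 \<le> a" "a < d" "d \<le> n"
  shows "trapezoid n d a 0 = a + 1" "trapezoid n d a (2 * n - 1) = a + 1"
  using assms unfolding trapezoid_def max_def min_def by auto

lemma antiperiodic_multiple:
  fixes f :: "int \<Rightarrow> int"
  assumes "\<And>s. f (s + N) = 1 - f s"
  shows "f (s + N * k) = (if even k then f s else 1 - f s)"
  using involution_shift[of f N "\<lambda>y. 1 - y" s k] assms by simp

lemma antiperiodic_order:
  fixes f g :: "int \<Rightarrow> int"
  assumes "0 < N" "\<And>s. f (s + N) = 1 - f s" "\<And>s. g (s + N) = 1 - g s"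
    and "\<And>s. \<tau> \<le> s \<Longrightarrow> s < \<tau> + N \<Longrightarrow> g s < f s"
  shows "(f s < g s \<longleftrightarrow> odd ((s - \<tau>) div N)) \<and> f s \<noteq> g s"
proof -
  define k where "k = (s - \<tau>) div N"
  define r where "r = (s - \<tau>) mod N"
  have s: "s = (\<tau> + r) + N * k" unfolding k_def r_def by (simp add: algebra_simps)
  have "0 \<le> r" "r < N" using assms(1) unfolding r_def by auto
  then have "g (\<tau> + r) < f (\<tau> + r)" using assms(4)[of "\<tau> + r"] by simp
  then show ?thesis
    using antiperiodic_multiple[of f N "\<tau> + r" k] antiperiodic_multiple[of g N "\<tau> + r" k] assms(2,3)
    unfolding k_def[symmetric] s[symmetric] by auto
qed

lemma odd_div_step:
  fixes N x :: int
  assumes "0 < N"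
  shows "odd ((x - 1) div N) \<noteq> odd (x div N) \<longleftrightarrow> N dvd x"
proof (cases "N dvd x")
  case True
  then obtain k where k: "x = N * k" by blast
  have "(x - 1) div N = k - 1"
    by (rule int_div_pos_eq[of _ N _ "N - 1"]) (use assms in \<open>simp_all add: k right_diff_distrib\<close>)
  then show ?thesis using True assms k by simp
next
  case False
  then have "x mod N \<noteq> 0" by auto
  then have "1 \<le> x mod N" using pos_mod_sign[OF assms, of x] by linarith
  then have "(x - 1) div N = x div N"
    using pos_mod_bound[OF assms, of x] mult_div_mod_eq[of N x]
    by (intro int_div_pos_eq[of _ N _ "x mod N - 1"]) linarith+
  then show ?thesis using False by simp
qed

lemma index_shifts:
  fixes i :: int
  shows "i + 1 + 1 = i + 2" "i + 2 + 1 = i + 3" "i + 1 + 2 = i + 3" "i + 1 - 1 = i" "i + 2 - 1 = i + 1"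
  by simp_all

text \<open>
  Block \<open>i\<close> consists of the \<open>d i\<close> points that come to the left half in the crossing number \<open>i\<close>. All
  crossings are numbered, so block \<open>i + t\<close> consists of the conjugates of block \<open>i\<close>. The number \<open>e\<close> shifts
  the time.
\<close>
locale blocks =
  fixes d D :: "int \<Rightarrow> int" and t n e :: int
  assumes t2: "2 \<le> t"
    and d_pos: "\<And>i. 1 \<le> d i"
    and D_Suc: "\<And>i. D (i + 1) = D i + d i"
    and D_per: "\<And>i. D (i + t) = D i + n"
begin

definition crossing_time :: "int \<Rightarrow> int" where
  "crossing_time i = D i + D (i + 1) + e"

text \<open>
  When the point \<open>a\<close> of block \<open>i\<close>, on its way out, passes the conjugate of the point \<open>b\<close> of block \<open>j\<close>, which
  is on its way to crossing \<open>j\<close>.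
\<close>
definition swap_time :: "int \<Rightarrow> int \<Rightarrow> int \<Rightarrow> int \<Rightarrow> int" where
  "swap_time i a j b = D (i + 1) + D j + b - a + e"

definition height :: "int \<Rightarrow> int \<Rightarrow> int \<Rightarrow> int" where
  "height i a s = (let u = s - crossing_time i; h = trapezoid n (d i) a (u mod (2 * n))
     in if even (u div (2 * n)) then h else 1 - h)"

lemma d_per: "d (i + t) = d i"
  using D_Suc[of "i + t"] D_Suc[of i] D_per[of i] D_per[of "i + 1"] by (simp add: algebra_simps)

lemma D_less: "i < j \<Longrightarrow> D (i + 1) \<le> D j"
proof (induction j rule: int_gr_induct)
  case base
  then show ?case by simp
next
  case (step j)
  then show ?case using D_Suc[of j] d_pos[of j] by simp
qed

lemma D_window: "i < j \<Longrightarrow> j < i + t \<Longrightarrow> D (j + 1) \<le> D i + n"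
  using D_less[of j "i + t"] D_per by simp

lemma d_less_n: "d i < n"
  using D_window[of i "i + 1"] t2 D_Suc[of i] D_Suc[of "i + 1"] d_pos[of "i + 1"] by simp

lemma n_pos: "0 < n" using d_less_n[of 0] d_pos[of 0] by simp

lemma crossing_time_per: "crossing_time (i + t) = crossing_time i + 2 * n"
  using D_per[of i] D_per[of "i + 1"] unfolding crossing_time_def by (simp add: algebra_simps)

lemma crossing_time_less: "i < j \<Longrightarrow> crossing_time i + d i + d j \<le> crossing_time j"
  using D_less[of i j] D_Suc[of i] D_Suc[of j] unfolding crossing_time_def by simp

lemma crossing_time_inj: "crossing_time i = crossing_time j \<longleftrightarrow> i = j"
  using crossing_time_less[of i j] crossing_time_less[of j i] d_pos[of i] d_pos[of j]
  by (metis add_le_same_cancel1 add_mono dual_order.strict_iff_not linorder_less_linear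
      not_one_le_zero order_trans add.assoc zero_le_one)

lemma height_per: "height i a (s + 2 * n) = 1 - height i a s"
proof -
  have eq: "s + 2 * n - crossing_time i = (s - crossing_time i) + 2 * n" by simp
  have "(s + 2 * n - crossing_time i) div (2 * n) = (s - crossing_time i) div (2 * n) + 1"
    unfolding eq by (rule div_add_self2) (use n_pos in simp)
  moreover have "(s + 2 * n - crossing_time i) mod (2 * n) = (s - crossing_time i) mod (2 * n)"
    unfolding eq by (rule mod_add_self2)
  ultimately show ?thesis unfolding height_def Let_def by auto
qed

lemma height_conj: "height (i + t) a s = 1 - height i a s"
proof -
  have "height (i + t) a s = height i a (s - 2 * n)"
    unfolding height_def Let_def crossing_time_per d_per by (simp add: algebra_simps)
  then show ?thesis using height_per[of i a "s - 2 * n"] by simp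
qed

lemma height_conj_back: "height (i - t) a s = 1 - height i a s"
  using height_conj[of "i - t"] by simp

lemma height_left:
  assumes "crossing_time i \<le> s" "s < crossing_time i + 2 * n"
  shows "height i a s = trapezoid n (d i) a (s - crossing_time i)"
proof -
  have "(s - crossing_time i) div (2 * n) = 0" "(s - crossing_time i) mod (2 * n) = s - crossing_time i"
    using assms by auto
  then show ?thesis unfolding height_def Let_def by simp
qed

lemma height_right:
  assumes "crossing_time i - 2 * n \<le> s" "s < crossing_time i"
  shows "height i a s = 1 - trapezoid n (d i) a (s - crossing_time i + 2 * n)"
  using height_left[of i "s + 2 * n" a] height_per[of i a s] assms by (simp add: algebra_simps)

text \<open>
  The window reaches from crossing \<open>j\<close> of the previous halfperiod to the crossing in which block \<open>i\<close> goes back. At its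
  two ends the points are on different sides of the centre; in between both are in the left half,
  and \<open>trapezoid_overtakes\<close> applies.
\<close>
lemma height_blocks:
  assumes "0 \<le> a" "a < d i" "0 \<le> b" "b < d j" "i < j" "j < i + t"
    and "crossing_time j - 2 * n \<le> s" "s < crossing_time i + 2 * n"
  shows "s < swap_time i a j b \<Longrightarrow> height i a s < height (j - t) b s"
    and "swap_time i a j b \<le> s \<Longrightarrow> height (j - t) b s < height i a s"
proof -
  define g where "g = D j - D (i + 1)"
  have g: "0 \<le> g" "g + d i + d j \<le> n"
    using D_less[of i j] D_window[of i j] assms D_Suc[of i] D_Suc[of j] unfolding g_def by auto
  have T: "crossing_time j = crossing_time i + (d i + d j + 2 * g)"
    "swap_time i a j b = crossing_time i + (d i + g + b - a)"
    unfolding crossing_time_def swap_time_def g_def using D_Suc[of i] D_Suc[of j] by auto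
  have dn: "d i \<le> n" "d j \<le> n" using d_less_n[of i] d_less_n[of j] by auto
  have Tj: "crossing_time (j - t) = crossing_time j - 2 * n" "d (j - t) = d j"
    using crossing_time_per[of "j - t"] d_per[of "j - t"] by auto
  consider "s < crossing_time i" | "crossing_time i \<le> s" "s < crossing_time j" | "crossing_time j \<le> s"
    by linarith
  then have "(s < swap_time i a j b \<longrightarrow> height i a s < height (j - t) b s) \<and>
    (swap_time i a j b \<le> s \<longrightarrow> height (j - t) b s < height i a s)"
  proof cases
    case 1
    have "height i a s \<le> 0"
      using height_right[of i s a] 1 assms T g trapezoid_bounds[of a "d i" n] dn by auto
    moreover have "1 \<le> height (j - t) b s"
      using height_left[of "j - t" s b] 1 assms T g trapezoid_bounds[of b "d j" n] dn Tj by auto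
    moreover have "s < swap_time i a j b" using 1 T assms g by auto
    ultimately show ?thesis by auto
  next
    case 2
    have h: "height i a s = trapezoid n (d i) a (s - crossing_time i)"
      "height (j - t) b s = trapezoid n (d j) b ((s - crossing_time i) - (d i + d j + 2 * g) + 2 * n)"
      using height_left[of i s a] height_left[of "j - t" s b] 2 assms Tj T g by (auto simp: algebra_simps)
    show ?thesis
      using trapezoid_overtakes[of a "d i" b "d j" g n "s - crossing_time i"] 2 assms g T unfolding h by auto
  next
    case 3
    have "height (j - t) b s \<le> 0"
      using height_right[of j s b] height_left[of j s b] height_conj_back[of j b s] 3 assms T g
        trapezoid_bounds[of b "d j" n] dn by auto
    moreover have "1 \<le> height i a s"
      using height_left[of i s a] 3 assms T g trapezoid_bounds[of a "d i" n] dn by auto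
    moreover have "swap_time i a j b \<le> s" using 3 T assms g by auto
    ultimately show ?thesis by auto
  qed
  then show "s < swap_time i a j b \<Longrightarrow> height i a s < height (j - t) b s"
    and "swap_time i a j b \<le> s \<Longrightarrow> height (j - t) b s < height i a s" by auto
qed

lemma order_blocks:
  assumes "0 \<le> a" "a < d i" "0 \<le> b" "b < d j" "i < j" "j < i + t"
  shows "(height i a s < height (j - t) b s \<longleftrightarrow> odd ((s - swap_time i a j b) div (2 * n)))
    \<and> height i a s \<noteq> height (j - t) b s"
proof (rule antiperiodic_order)
  fix s assume s: "swap_time i a j b \<le> s" "s < swap_time i a j b + 2 * n"
  define g where "g = D j - D (i + 1)"
  have g: "0 \<le> g" "g + d i + d j \<le> n"
    using D_less[of i j] D_window[of i j] assms D_Suc[of i] D_Suc[of j] unfolding g_def by auto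
  have T: "crossing_time j = crossing_time i + (d i + d j + 2 * g)"
    "swap_time i a j b = crossing_time i + (d i + g + b - a)"
    unfolding crossing_time_def swap_time_def g_def using D_Suc[of i] D_Suc[of j] by auto
  show "height (j - t) b s < height i a s"
  proof (cases "s < crossing_time i + 2 * n")
    case True
    then show ?thesis using height_blocks(2)[OF assms] s T assms g by auto
  next
    case False
    then have "height i a (s - 2 * n) < height (j - t) b (s - 2 * n)"
      using height_blocks(1)[OF assms, of "s - 2 * n"] s T assms g by auto
    then show ?thesis using height_per[of i a "s - 2 * n"] height_per[of "j - t" b "s - 2 * n"] by simp
  qed
qed (use n_pos height_per in auto)

lemma order_conjugate_block:
  assumes "0 \<le> a" "a < d i" "0 \<le> b" "b < d i"
  shows "(height i a s < height (i - t) b s \<longleftrightarrow> odd ((s - crossing_time i) div (2 * n)))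
    \<and> height i a s \<noteq> height (i - t) b s"
proof (rule antiperiodic_order)
  fix s assume s: "crossing_time i \<le> s" "s < crossing_time i + 2 * n"
  then have "height i a s = trapezoid n (d i) a (s - crossing_time i)"
    "height (i - t) b s = 1 - trapezoid n (d i) b (s - crossing_time i)"
    using height_left[of i s] height_conj_back[of i b s] by auto
  then show "height (i - t) b s < height i a s"
    using trapezoid_bounds[of a "d i" n] trapezoid_bounds[of b "d i" n] assms d_less_n[of i]
    by (smt (verit))
qed (use n_pos height_per in auto)

lemma order_same_block:
  assumes "0 \<le> a" "a < b" "b < d i"
  shows "(height i b s < height i a s \<longleftrightarrow> odd ((s - crossing_time i) div (2 * n)))
    \<and> height i b s \<noteq> height i a s"
proof (rule antiperiodic_order)
  fix s assume s: "crossing_time i \<le> s" "s < crossing_time i + 2 * n"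
  then show "height i a s < height i b s"
    using height_left[of i s] trapezoid_mono[OF assms(2)] by auto
qed (use n_pos height_per in auto)

end

section \<open>Pairs and labels in the model motion\<close>

definition points :: "int \<Rightarrow> int set" where
  "points n = {- n..- 1} \<union> {1..n}"

text \<open>
  The label of the point that has height \<open>r\<close> in the starting permutation of the sequence.
\<close>
definition label_of_height :: "int \<Rightarrow> int \<Rightarrow> int" where
  "label_of_height n r = (if 1 \<le> r then n + 1 - r else - (n + r))"

lemma label_of_height_bij: "bij_betw (label_of_height n) {1 - n..n} (points n)"
proof (rule bij_betw_byWitness[where f' = "\<lambda>p. if 1 \<le> p then n + 1 - p else - n - p"])
qed (auto simp: label_of_height_def points_def)

lemma label_of_height_conj: "label_of_height n (1 - r) = - label_of_height n r"
  unfolding label_of_height_def by auto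

context blocks
begin

lemma height_shift: "height (i + t * k) a s = (if even k then height i a s else 1 - height i a s)"
  using antiperiodic_multiple[of "\<lambda>i. height i a s" t i k] height_conj by auto

lemma d_shift: "d (i + t * k) = d i"
  using arithmetic_shift[of d t 0 i k] d_per by simp

lemma crossing_time_shift: "crossing_time (i + t * k) = crossing_time i + 2 * n * k"
  using arithmetic_shift[of crossing_time t "2 * n" i k] crossing_time_per by (simp add: mult.commute)

definition alternating :: "(int \<Rightarrow> int) \<Rightarrow> (int \<Rightarrow> int) \<Rightarrow> bool" where
  "alternating f g \<longleftrightarrow> (\<exists>\<tau>. (\<forall>s. f s \<noteq> g s) \<and>
     (\<forall>s. (f (s - 1) < g (s - 1)) \<noteq> (f s < g s) \<longleftrightarrow> 2 * n dvd s - \<tau>))"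

lemma alternatingI:
  assumes "\<And>s. (f s < g s \<longleftrightarrow> odd ((s - \<tau>) div (2 * n))) \<and> f s \<noteq> g s"
  shows "alternating f g"
proof -
  have "(f (s - 1) < g (s - 1)) \<noteq> (f s < g s) \<longleftrightarrow> 2 * n dvd s - \<tau>" for s
  proof -
    have e: "s - 1 - \<tau> = (s - \<tau>) - 1" by simp
    show ?thesis unfolding assms[THEN conjunct1] e by (rule odd_div_step) (use n_pos in simp)
  qed
  then show ?thesis using assms unfolding alternating_def by blast
qed

lemma alternating_sym: "alternating f g \<Longrightarrow> alternating g f"
  unfolding alternating_def by (metis linorder_less_linear not_less_iff_gr_or_eq)

text \<open>
  In move \<open>\<tau>\<close> the point \<open>(i, a)\<close> comes in front of \<open>(j, b)\<close>. Two points of different blocks meet according to \<open>swap_time\<close>,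
  points of the same block or of conjugate blocks meet in the crossing.
\<close>
definition meets :: "int \<Rightarrow> int \<Rightarrow> int \<Rightarrow> int \<Rightarrow> int \<Rightarrow> bool" where
  "meets i a j b \<tau> \<longleftrightarrow> 0 \<le> a \<and> a < d i \<and> 0 \<le> b \<and> b < d j \<and>
     (i < j + t \<and> j < i \<and> \<tau> = swap_time i a (j + t) b \<or>
      j = i - t \<and> \<tau> = crossing_time i \<or>
      j = i \<and> b < a \<and> \<tau> = crossing_time i)"

lemma meets_order:
  assumes "meets i a j b \<tau>"
  shows "(height i a s < height j b s \<longleftrightarrow> odd ((s - \<tau>) div (2 * n))) \<and> height i a s \<noteq> height j b s"
  using assms order_blocks[of a i b "j + t" s] order_conjugate_block[of a i b s] order_same_block[of b a i s]
    d_per[of j] d_per[of "i - t"] unfolding meets_def by auto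

text \<open>
  Adding a multiple of \<open>2 t\<close> to the number of a block gives the same points. In this way one of the
  blocks becomes equal or conjugate to the other one, or comes less than \<open>t\<close> before it.
\<close>
lemma meets_exists:
  assumes "0 \<le> a" "a < d i" "0 \<le> b" "b < d j" "\<not> (a = b \<and> 2 * t dvd j - i)"
  obtains k \<tau> where "meets i a (j + t * (2 * k)) b \<tau> \<or> meets j b (i + t * (2 * k)) a \<tau>"
proof -
  define k r where "k = (j - i) div t" and "r = (j - i) mod t"
  have j: "j = (i + r) + t * k" unfolding k_def r_def by (simp add: algebra_simps)
  have r: "0 \<le> r" "r < t" using t2 unfolding r_def by auto
  have dj: "d (j + t * l) = d j" "d (i + t * l) = d i" for l by (rule d_shift)+
  have dr: "d j = d (i + r)" unfolding j by (rule d_shift)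
  consider l where "r = 0" "k = 2 * l" | l where "r = 0" "k = 2 * l + 1"
    | l where "0 < r" "k = 2 * l" | l where "0 < r" "k = 2 * l + 1"
    using r by (metis evenE oddE order_le_less)
  then show thesis
  proof cases
    case (1 l)
    have e: "j + t * (2 * (- l)) = i" "i + t * (2 * l) = j" using j 1 by (simp_all add: algebra_simps)
    have "a \<noteq> b"
    proof
      assume "a = b"
      moreover have "j - i = 2 * t * l" using j 1 by simp
      ultimately show False using assms by auto
    qed
    then show thesis using that[of "- l" "crossing_time i"] that[of l "crossing_time j"] assms e dr 1
      unfolding meets_def by (cases "b < a") auto
  next
    case (2 l)
    have e: "j + t * (2 * (- l - 1)) = i - t" using j 2 by (simp add: algebra_simps)
    then have "meets i a (j + t * (2 * (- l - 1))) b (crossing_time i)"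
      using assms dj(1)[of "2 * (- l - 1)"] unfolding meets_def by simp
    then show thesis using that by blast
  next
    case (3 l)
    have e: "i + t * (2 * l) = j - r" using j 3 by (simp add: algebra_simps)
    then have "meets j b (i + t * (2 * l)) a (swap_time j b (j - r + t) a)"
      using assms dj(2)[of "2 * l"] 3 r unfolding meets_def by simp
    then show thesis using that by blast
  next
    case (4 l)
    have e: "j + t * (2 * (- l - 1)) = i + r - t" using j 4 by (simp add: algebra_simps)
    then have "meets i a (j + t * (2 * (- l - 1))) b (swap_time i a (i + r) b)"
      using assms dj(1)[of "2 * (- l - 1)"] 4 r unfolding meets_def by simp
    then show thesis using that by blast
  qed
qed

lemma pair_alternating:
  assumes "0 \<le> a" "a < d i" "0 \<le> b" "b < d j" "\<not> (a = b \<and> 2 * t dvd j - i)"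
  shows "alternating (height i a) (height j b)"
proof -
  obtain k \<tau> where m: "meets i a (j + t * (2 * k)) b \<tau> \<or> meets j b (i + t * (2 * k)) a \<tau>"
    using meets_exists[OF assms] .
  have e: "height (j + t * (2 * k)) b = height j b" "height (i + t * (2 * k)) a = height i a"
    using height_shift by auto
  from m show ?thesis
  proof
    assume "meets i a (j + t * (2 * k)) b \<tau>"
    then have "alternating (height i a) (height (j + t * (2 * k)) b)"
      by (rule alternatingI[OF meets_order])
    then show ?thesis unfolding e(1) .
  next
    assume "meets j b (i + t * (2 * k)) a \<tau>"
    then have "alternating (height j b) (height (i + t * (2 * k)) a)"
      by (rule alternatingI[OF meets_order])
    then show ?thesis unfolding e(2) by (rule alternating_sym)
  qed
qed

lemma height_eq_iff:
  assumes "0 \<le> a" "a < d i" "0 \<le> b" "b < d j"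
  shows "height i a s = height j b s \<longleftrightarrow> a = b \<and> 2 * t dvd j - i"
proof
  assume "height i a s = height j b s"
  then show "a = b \<and> 2 * t dvd j - i"
    using pair_alternating[OF assms] unfolding alternating_def by blast
next
  assume ab: "a = b \<and> 2 * t dvd j - i"
  then obtain k where "j - i = 2 * t * k" by blast
  then have "j = i + t * (2 * k)" by simp
  then show "height i a s = height j b s" using height_shift[of i "2 * k" a s] ab by simp
qed

lemma height_range: "0 \<le> a \<Longrightarrow> a < d i \<Longrightarrow> 1 - n \<le> height i a s \<and> height i a s \<le> n"
  using trapezoid_bounds[of a "d i" n] d_less_n[of i] unfolding height_def Let_def
  by (smt (verit))

definition indices :: "(int \<times> int) set" where
  "indices = (SIGMA i : {0..<2 * t}. {0..<d i})"

lemma sum_d: "(\<Sum>i\<in>{0..<int m}. d i) = D (int m) - D 0"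
proof (induction m)
  case (Suc m)
  have "{0..<int (Suc m)} = insert (int m) {0..<int m}" by auto
  then show ?case using Suc D_Suc[of "int m"] by (simp add: algebra_simps)
qed simp

lemma card_indices: "card indices = nat (2 * n)"
proof -
  have "int (card indices) = (\<Sum>i\<in>{0..<2 * t}. int (card {0..<d i}))"
    unfolding indices_def by (subst card_SigmaI) auto
  also have "\<dots> = (\<Sum>i\<in>{0..<2 * t}. d i)"
    using d_pos by (intro sum.cong) (auto intro: order_trans[of _ 1])
  also have "\<dots> = D (2 * t) - D 0" using sum_d[of "nat (2 * t)"] t2 by simp
  also have "\<dots> = 2 * n" using D_per[of 0] D_per[of t] by simp
  finally show ?thesis by simp
qed

lemma height_bij: "bij_betw (\<lambda>(i, a). height i a s) indices {1 - n..n}"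
proof -
  have inj: "inj_on (\<lambda>(i, a). height i a s) indices"
  proof (rule inj_onI, clarify)
    fix i a j b assume ij: "(i, a) \<in> indices" "(j, b) \<in> indices" "height i a s = height j b s"
    then have "a = b" "2 * t dvd j - i" using height_eq_iff[of a i b j s] unfolding indices_def by auto
    moreover have "\<bar>j - i\<bar> < 2 * t" using ij unfolding indices_def by auto
    ultimately show "i = j \<and> a = b" using dvd_imp_le_int[of "j - i" "2 * t"] by auto
  qed
  have "(\<lambda>(i, a). height i a s) ` indices = {1 - n..n}"
  proof (rule card_subset_eq)
    show "(\<lambda>(i, a). height i a s) ` indices \<subseteq> {1 - n..n}"
      using height_range unfolding indices_def by fastforce
    show "card ((\<lambda>(i, a). height i a s) ` indices) = card {1 - n..n}"
      using card_image[OF inj] card_indices by simp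
  qed simp
  then show ?thesis using inj unfolding bij_betw_def by simp
qed

definition label :: "int \<Rightarrow> int \<Rightarrow> int" where
  "label i a = label_of_height n (height i a 0)"

lemma label_bij: "bij_betw (\<lambda>(i, a). label i a) indices (points n)"
  using bij_betw_trans[OF height_bij[of 0] label_of_height_bij]
  by (simp add: label_def comp_def case_prod_unfold)

text \<open>
  The height as a function of the label, well defined because every label belongs to exactly one pair
  in \<open>indices\<close>.
\<close>
definition rank :: "int \<Rightarrow> int \<Rightarrow> int" where
  "rank s p = (case inv_into indices (\<lambda>(i, a). label i a) p of (i, a) \<Rightarrow> height i a s)"

lemma rank_bij: "bij_betw (rank s) (points n) {1 - n..n}"
  using bij_betw_trans[OF bij_betw_inv_into[OF label_bij] height_bij[of s]]
  by (simp add: rank_def[abs_def] comp_def)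

lemma label_shift: "label (i + t * k) a = (if even k then label i a else - label i a)"
  unfolding label_def height_shift by (simp add: label_of_height_conj)

lemma rank_label:
  assumes "0 \<le> a" "a < d i"
  shows "label i a \<in> points n" "rank s (label i a) = height i a s"
proof -
  define j where "j = i mod (2 * t)"
  have i: "i = j + t * (2 * (i div (2 * t)))"
    unfolding j_def by (metis mod_mult_div_eq mult.assoc mult.left_commute)
  have "0 \<le> j" "j < 2 * t" using t2 unfolding j_def by auto
  moreover have "d j = d i" using d_shift[of j "2 * (i div (2 * t))"] i by simp
  ultimately have ind: "(j, a) \<in> indices" using assms unfolding indices_def by auto
  have "label i a = label j a" using label_shift[of j "2 * (i div (2 * t))" a] i by simp
  moreover have "height i a s = height j a s" using height_shift[of j "2 * (i div (2 * t))" a s] i by simp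
  moreover have "inv_into indices (\<lambda>(i, a). label i a) (label j a) = (j, a)"
    using inv_into_f_f[OF bij_betw_imp_inj_on[OF label_bij] ind] by simp
  moreover have "label j a \<in> points n" using bij_betwE[OF label_bij] ind by auto
  ultimately show "label i a \<in> points n" "rank s (label i a) = height i a s"
    unfolding rank_def by auto
qed

lemma points_label:
  assumes "p \<in> points n"
  obtains i a where "0 \<le> i" "i < 2 * t" "0 \<le> a" "a < d i" "p = label i a"
  using assms label_bij unfolding bij_betw_def indices_def by force

lemma label_conj: "label (i + t) a = - label i a"
  using label_shift[of i 1 a] by simp

lemma rank_conj: "p \<in> points n \<Longrightarrow> rank s (- p) = 1 - rank s p"
  by (metis points_label rank_label(2) label_conj height_conj d_per)

lemma rank_per: "p \<in> points n \<Longrightarrow> rank (s + 2 * n) p = 1 - rank s p"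
  by (metis points_label rank_label(2) height_per)

lemma rank_inj: "p \<in> points n \<Longrightarrow> q \<in> points n \<Longrightarrow> rank s p = rank s q \<Longrightarrow> p = q"
  using rank_bij[of s] unfolding bij_betw_def inj_on_def by blast

lemma left_label:
  assumes "p \<in> points n" "1 \<le> rank s p"
  obtains i a where "0 \<le> a" "a < d i" "p = label i a" "crossing_time i \<le> s" "s < crossing_time i + 2 * n"
proof -
  obtain i a where ia: "0 \<le> a" "a < d i" "p = label i a" using points_label[OF assms(1)] by metis
  define k where "k = (s - crossing_time i) div (2 * n)"
  have h: "1 \<le> height i a s" using assms rank_label ia by auto
  have k: "even k"
  proof (rule ccontr)
    assume "odd k"
    then have "height i a s = 1 - trapezoid n (d i) a ((s - crossing_time i) mod (2 * n))"
      unfolding height_def Let_def k_def by simp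
    then show False using h trapezoid_bounds[of a "d i" n] d_less_n[of i] ia by (smt (verit))
  qed
  have s: "s - crossing_time i = 2 * n * k + (s - crossing_time i) mod (2 * n)"
    unfolding k_def by simp
  have "0 \<le> (s - crossing_time i) mod (2 * n)" "(s - crossing_time i) mod (2 * n) < 2 * n"
    using n_pos by auto
  then have "crossing_time (i + t * k) \<le> s" "s < crossing_time (i + t * k) + 2 * n"
    using s unfolding crossing_time_shift by linarith+
  then show thesis using that[of a "i + t * k"] ia k d_shift[of i k] label_shift[of i k a] by auto
qed

definition half_size :: "int \<Rightarrow> int" where
  "half_size s = (if \<exists>i. s = crossing_time i then d (THE i. s = crossing_time i) else 0)"

lemma half_size_crossing: "half_size (crossing_time i) = d i"
  unfolding half_size_def crossing_time_inj by simp

lemma half_size_cases: "half_size s = 0 \<or> (\<exists>i. s = crossing_time i \<and> half_size s = d i)"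
  by (metis half_size_def half_size_crossing)

lemma rank_at_crossing:
  assumes "0 \<le> a" "a < d i"
  shows "height i a (crossing_time i) = a + 1" "height i a (crossing_time i - 1) = - a"
    "height (i + t) a (crossing_time i) = - a" "height (i + t) a (crossing_time i - 1) = a + 1"
  using height_left[of i "crossing_time i" a] height_right[of i "crossing_time i - 1" a]
    trapezoid_ends[of a "d i" n] assms d_less_n[of i] n_pos height_conj[of i a] by auto

lemma half_size_per: "half_size (s + 2 * n) = half_size s"
proof (cases "\<exists>i. s = crossing_time i")
  case True
  then obtain i where "s = crossing_time i" by blast
  then show ?thesis
    using half_size_crossing[of i] half_size_crossing[of "i + t"] crossing_time_per[of i] d_per[of i] by simp
next
  case False
  have "\<nexists>i. s + 2 * n = crossing_time i"
  proof
    assume "\<exists>i. s + 2 * n = crossing_time i"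
    then obtain i where "s + 2 * n = crossing_time i" by blast
    then have "s = crossing_time (i - t)" using crossing_time_per[of "i - t"] by simp
    then show False using False by blast
  qed
  then show ?thesis using False unfolding half_size_def by simp
qed

lemma half_size_range: "0 \<le> half_size s" "half_size s \<le> n"
proof -
  consider "half_size s = 0" | i where "half_size s = d i" using half_size_cases[of s] by blast
  then have "0 \<le> half_size s \<and> half_size s \<le> n"
  proof cases
    case (2 i)
    then show ?thesis using d_pos[of i] d_less_n[of i] by simp
  qed (use n_pos in simp)
  then show "0 \<le> half_size s" "half_size s \<le> n" by auto
qed

text \<open>
  The points \<open>(i, a)\<close> and \<open>(i + t, a)\<close> fill the \<open>2 * d i\<close> central places before and after crossing \<open>i\<close>, so
  nobody else is there.
\<close>
lemma rank_crossing:
  assumes "q \<in> points n" "s = crossing_time i" "1 - d i \<le> r" "r \<le> d i"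
    and "rank s q = 1 - r \<or> rank (s - 1) q = r"
  shows "rank s q = 1 - r \<and> rank (s - 1) q = r"
proof -
  define x where "x = (if r \<le> 0 then label i (- r) else label (i + t) (r - 1))"
  have x: "x \<in> points n \<and> rank s x = 1 - r \<and> rank (s - 1) x = r"
  proof (cases "r \<le> 0")
    case True
    then show ?thesis using rank_label[of "- r" i] rank_at_crossing[of "- r" i] assms unfolding x_def by simp
  next
    case False
    then show ?thesis
      using rank_label[of "r - 1" "i + t"] d_per[of i] rank_at_crossing[of "r - 1" i] assms
      unfolding x_def by simp
  qed
  then have "q = x" using assms(1,5) rank_inj[of q x s] rank_inj[of q x "s - 1"] by auto
  then show ?thesis using x by simp
qed

lemma rank_stay:
  assumes p: "p \<in> points n" and l: "half_size s < rank (s - 1) p"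
  shows "half_size s < rank s p \<and> \<bar>rank s p - rank (s - 1) p\<bar> \<le> 1"
proof -
    have "1 \<le> rank (s - 1) p" using l half_size_range(1)[of s] by linarith
    obtain i a where ia: "0 \<le> a" "a < d i" "p = label i a" "crossing_time i \<le> s - 1"
      "s - 1 < crossing_time i + 2 * n" using left_label[OF p \<open>1 \<le> rank (s - 1) p\<close>] by metis
    have r: "rank s p = height i a s" "rank (s - 1) p = height i a (s - 1)" using ia rank_label by auto
    have "s \<noteq> crossing_time i + 2 * n"
    proof
      assume s: "s = crossing_time i + 2 * n"
      then have "half_size s = d i" using half_size_crossing[of "i + t"] crossing_time_per d_per by simp
      moreover have "height i a (s - 1) = a + 1"
        using height_left[of i "s - 1" a] trapezoid_ends[of a "d i" n] d_less_n[of i] ia s by simp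
      ultimately show False using l r ia by simp
    qed
    then have "s < crossing_time i + 2 * n" using ia by simp
    then have h: "height i a s = trapezoid n (d i) a ((s - 1 - crossing_time i) + 1)"
      "height i a (s - 1) = trapezoid n (d i) a (s - 1 - crossing_time i)"
      using height_left[of i s a] height_left[of i "s - 1" a] ia by auto
    have lip: "\<bar>rank s p - rank (s - 1) p\<bar> \<le> 1" unfolding r h by (rule trapezoid_lipschitz)
    have pos: "1 \<le> rank s p"
      unfolding r h using trapezoid_bounds[of a "d i" n] d_less_n[of i] ia by auto
    have "half_size s < rank s p"
    proof (rule ccontr)
      assume "\<not> ?thesis"
      then obtain j where "s = crossing_time j" "rank s p \<le> d j" "half_size s = d j"
        using half_size_cases[of s] pos by auto
      then show False using rank_crossing[OF p, of s j "1 - rank s p"] pos l by auto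
    qed
    then show ?thesis using lip by simp
  qed

lemma rank_flips:
  assumes p: "p \<in> points n" and q: "q \<in> points n" "p \<noteq> q"
  obtains \<tau> where "\<And>s. flips rank s p q \<longleftrightarrow> 2 * n dvd s - \<tau>"
proof -
  obtain i a where ia: "0 \<le> a" "a < d i" "p = label i a" using points_label[OF p] by metis
  obtain j b where jb: "0 \<le> b" "b < d j" "q = label j b" using points_label[OF q(1)] by metis
  have "\<not> (a = b \<and> 2 * t dvd j - i)"
    using height_eq_iff[of a i b j 0] ia jb q unfolding label_def by auto
  then obtain \<tau> where \<tau>: "\<And>s. (height i a (s - 1) < height j b (s - 1)) \<noteq> (height i a s < height j b s) \<longleftrightarrow> 2 * n dvd s - \<tau>"
    using pair_alternating[of a i b j] ia jb unfolding alternating_def by blast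
  have fl: "flips rank s p q \<longleftrightarrow> 2 * n dvd s - \<tau>" for s
    unfolding flips_def \<tau>[symmetric] using rank_label ia jb by simp
  then show thesis using that by blast
qed

lemma rank_once:
  assumes p: "p \<in> points n" and q: "q \<in> points n" "p \<noteq> q"
  shows "\<exists>!s. 1 \<le> s \<and> s \<le> 2 * n \<and> flips rank s p q"
proof -
  obtain \<tau> where fl: "\<And>s. flips rank s p q \<longleftrightarrow> 2 * n dvd s - \<tau>" using rank_flips[OF assms] by blast
  define s0 where "s0 = (\<tau> - 1) mod (2 * n) + 1"
  have "1 \<le> s0" "s0 \<le> 2 * n" using n_pos unfolding s0_def by (auto simp: add1_zle_eq)
  moreover have "2 * n dvd s0 - \<tau>"
  proof -
    have "s0 - \<tau> = 2 * n * (- ((\<tau> - 1) div (2 * n)))"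
      using mult_div_mod_eq[of "2 * n" "\<tau> - 1"] unfolding s0_def by (simp add: algebra_simps)
    then show ?thesis by simp
  qed
  moreover have "s = s0" if "1 \<le> s \<and> s \<le> 2 * n \<and> flips rank s p q" for s
  proof -
    have "2 * n dvd s - s0" using that fl calculation(3) dvd_diff[of "2 * n" "s - \<tau>" "s0 - \<tau>"] by simp
    moreover have "\<bar>s - s0\<bar> < 2 * n" using that \<open>1 \<le> s0\<close> \<open>s0 \<le> 2 * n\<close> by auto
    ultimately show ?thesis using dvd_imp_le_int[of "s - s0" "2 * n"] by auto
  qed
  ultimately show "\<exists>!s. 1 \<le> s \<and> s \<le> 2 * n \<and> flips rank s p q" using fl by blast
qed

sublocale motion: central_motion "points n" uminus n half_size rank
proof
  show "0 < n" by (rule n_pos)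
  show "bij_betw (rank s) (points n) {1 - n..n}" for s by (rule rank_bij)
  show "- p \<in> points n" if "p \<in> points n" for p using that unfolding points_def by auto
  show "rank s (- p) = 1 - rank s p" if "p \<in> points n" for s p using that by (rule rank_conj)
  show "rank (s + 2 * n) p = 1 - rank s p" if "p \<in> points n" for s p using that by (rule rank_per)
  show "half_size (s + 2 * n) = half_size s" for s by (rule half_size_per)
  show "0 \<le> half_size s \<and> half_size s \<le> n" for s by (simp add: half_size_range)
  show "rank s p = 1 - rank (s - 1) p"
    if "p \<in> points n" "1 - half_size s \<le> rank (s - 1) p" "rank (s - 1) p \<le> half_size s" for s p
  proof -
    have "half_size s \<noteq> 0" using that by auto
    then obtain i where "s = crossing_time i" "half_size s = d i" using half_size_cases[of s] by blast
    then show ?thesis using rank_crossing[of p s i "rank (s - 1) p"] that by simp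
  qed
  show "half_size s < rank s p \<and> \<bar>rank s p - rank (s - 1) p\<bar> \<le> 1"
    if "p \<in> points n" "half_size s < rank (s - 1) p" for s p using that by (rule rank_stay)
  show "\<exists>!s. 1 \<le> s \<and> s \<le> 2 * n \<and> flips rank s p q"
    if "p \<in> points n" "q \<in> points n" "p \<noteq> q" for p q using that by (rule rank_once)
qed

end

section \<open>Moves of lists\<close>

lemma position_append:
  "position (us @ vs) p = (if p \<in> set us then position us p else length us + position vs p)"
  unfolding position_def by (auto simp: takeWhile_append)

lemma position_Cons: "position (x # xs) p = (if x = p then 1 else Suc (position xs p))"
  unfolding position_def by simp

lemma position_range: "p \<in> set xs \<Longrightarrow> 1 \<le> position xs p \<and> position xs p \<le> length xs"
  by (induction xs) (auto simp: position_Cons)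

lemma nth_position: "p \<in> set xs \<Longrightarrow> xs ! (position xs p - 1) = p"
proof (induction xs)
  case (Cons x xs)
  show ?case
  proof (cases "x = p")
    case False
    then have "p \<in> set xs" using Cons.prems by simp
    then show ?thesis using Cons.IH position_range[of p xs] False by (simp add: position_Cons nth_Cons')
  qed (simp add: position_Cons)
qed simp

lemma block_containing: "block_reversal bs xs ys \<Longrightarrow> p \<in> set xs \<Longrightarrow> \<exists>b\<in>set bs. p \<in> set b"
  unfolding block_reversal_def by auto

lemma position_nth:
  assumes "distinct xs" "i < length xs"
  shows "position xs (xs ! i) = Suc i"
proof -
  have r: "1 \<le> position xs (xs ! i)" "position xs (xs ! i) \<le> length xs"
    using position_range[of "xs ! i" xs] assms by auto
  moreover have "xs ! (position xs (xs ! i) - 1) = xs ! i" using nth_position[of "xs ! i" xs] assms by auto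
  ultimately have "position xs (xs ! i) - 1 = i"
    using nth_eq_iff_index_eq[OF assms(1), of "position xs (xs ! i) - 1" i] assms(2) by linarith
  then show ?thesis using r by linarith
qed

lemma ex_position:
  assumes "distinct xs" "1 \<le> k" "k \<le> length xs"
  shows "\<exists>p\<in>set xs. position xs p = k"
proof
  show "xs ! (k - 1) \<in> set xs" using assms by simp
  show "position xs (xs ! (k - 1)) = k" using position_nth[OF assms(1), of "k - 1"] assms by simp
qed

lemma position_inj:
  assumes "p \<in> set xs" "q \<in> set xs" "position xs p = position xs q"
  shows "p = q"
  using nth_position[OF assms(1)] nth_position[OF assms(2)] assms(3) by simp

lemma position_rev:
  assumes "distinct xs" "p \<in> set xs"
  shows "position (rev xs) p + position xs p = Suc (length xs)"
proof -
  obtain i where i: "i < length xs" "p = xs ! i" using assms by (metis in_set_conv_nth)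
  have "rev xs ! (length xs - Suc i) = p" using i by (simp add: rev_nth)
  then have "position (rev xs) p = Suc (length xs - Suc i)"
    using position_nth[of "rev xs" "length xs - Suc i"] assms i by auto
  then show ?thesis using position_nth[of xs i] assms i by auto
qed

lemma position_eqI:
  assumes "distinct xs" "distinct ys" "set xs = set ys" "\<And>p. p \<in> set xs \<Longrightarrow> position xs p = position ys p"
  shows "xs = ys"
proof (rule nth_equalityI)
  show "length xs = length ys" using assms by (metis distinct_card)
  fix i assume i: "i < length xs"
  then have "position ys (xs ! i) = Suc i" using assms(1,4) position_nth[of xs i] by simp
  moreover have "xs ! i \<in> set ys" using i assms(3) nth_mem by blast
  ultimately show "xs ! i = ys ! i" using nth_position[of "xs ! i" ys] by simp
qed

lemma block_split:
  assumes "block_reversal bs xs ys" "b \<in> set bs"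
  obtains us vs us' vs' where "xs = us @ b @ vs" "ys = us' @ rev b @ vs'"
    "length us' = length us" "set us' = set us" "length vs' = length vs" "set vs' = set vs"
proof -
  have len: "length (concat (map rev cs)) = length (concat cs)" for cs :: "'a list list"
    by (induction cs) auto
  have set: "set (concat (map rev cs)) = set (concat cs)" for cs :: "'a list list"
    by (induction cs) auto
  obtain as cs where "bs = as @ b # cs" using split_list[OF assms(2)] by blast
  then show thesis
    using that[of "concat as" "concat cs" "concat (map rev as)" "concat (map rev cs)"] assms(1) len set
    unfolding block_reversal_def by auto
qed

lemma block_positions:
  assumes "distinct xs" "xs = us @ b @ vs" "ys = us' @ rev b @ vs'"
    "length us' = length us" "set us' = set us" "length vs' = length vs" "set vs' = set vs"
  shows "p \<in> set b \<Longrightarrow> position xs p = length us + position b p"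
    and "p \<in> set b \<Longrightarrow> position xs p + position ys p = 2 * length us + length b + 1"
    and "p \<in> set us \<Longrightarrow> position xs p \<le> length us \<and> position ys p \<le> length us"
    and "p \<in> set vs \<Longrightarrow> length us + length b < position xs p \<and> length us + length b < position ys p"
proof -
  show 1: "position xs p = length us + position b p" if "p \<in> set b"
    using assms that by (auto simp: position_append)
  have 2: "position ys p = length us + position (rev b) p" if "p \<in> set b"
    using assms that by (auto simp: position_append)
  show "position xs p + position ys p = 2 * length us + length b + 1" if "p \<in> set b"
    using 1 2 that position_rev[of b p] assms(1,2) by auto
  show "position xs p \<le> length us \<and> position ys p \<le> length us" if "p \<in> set us"
    using assms that position_range[of p us] position_range[of p us'] by (auto simp: position_append)
  have "p \<notin> set us \<and> p \<notin> set b" if "p \<in> set vs" using assms that by auto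
  then show "length us + length b < position xs p \<and> length us + length b < position ys p" if "p \<in> set vs"
    using assms that position_range[of p vs] position_range[of p vs'] by (auto simp: position_append)
qed

text \<open>
  A block that is reversed occupies the same places before and after the move, so the order changes
  within blocks only.
\<close>
lemma switch_iff_order_change:
  assumes "distinct xs" "is_move xs ys" "p \<in> set xs" "q \<in> set xs" "p \<noteq> q"
  shows "(\<exists>b\<in>switches xs ys. p \<in> set b \<and> q \<in> set b) \<longleftrightarrow>
    (position xs p < position xs q) \<noteq> (position ys p < position ys q)"
proof
  assume "\<exists>b\<in>switches xs ys. p \<in> set b \<and> q \<in> set b"
  then obtain b bs where b: "block_reversal bs xs ys" "b \<in> set bs" "p \<in> set b" "q \<in> set b"
    unfolding switches_def by blast
  obtain us vs us' vs' where sp: "xs = us @ b @ vs" "ys = us' @ rev b @ vs'"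
    "length us' = length us" "set us' = set us" "length vs' = length vs" "set vs' = set vs"
    using block_split[OF b(1,2)] .
  have "position xs p \<noteq> position xs q" using position_inj assms by metis
  then show "(position xs p < position xs q) \<noteq> (position ys p < position ys q)"
    using block_positions(2)[OF assms(1) sp b(3)] block_positions(2)[OF assms(1) sp b(4)] by linarith
next
  assume ch: "(position xs p < position xs q) \<noteq> (position ys p < position ys q)"
  obtain bs where bs: "block_reversal bs xs ys" using assms(2) unfolding is_move_def by blast
  obtain b where b: "b \<in> set bs" "p \<in> set b" using block_containing[OF bs assms(3)] by blast
  obtain us vs us' vs' where sp: "xs = us @ b @ vs" "ys = us' @ rev b @ vs'"
    "length us' = length us" "set us' = set us" "length vs' = length vs" "set vs' = set vs"
    using block_split[OF bs b(1)] .
  have qb: "q \<in> set b"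
  proof (rule ccontr)
    assume "q \<notin> set b"
    then have "q \<in> set us \<or> q \<in> set vs" using assms(4) sp by auto
    moreover have "length us < position xs p" "position xs p \<le> length us + length b"
      using block_positions(1)[OF assms(1) sp b(2)] position_range[OF b(2)] by auto
    moreover have "position xs p + position ys p = 2 * length us + length b + 1"
      using block_positions(2)[OF assms(1) sp b(2)] .
    ultimately show False
      using block_positions(3)[OF assms(1) sp, of q] block_positions(4)[OF assms(1) sp, of q] ch by linarith
  qed
  have "card {p, q} \<le> card (set b)" using b qb by (intro card_mono) auto
  then have "2 \<le> length b" using assms(5) card_length[of b] by auto
  then show "\<exists>b\<in>switches xs ys. p \<in> set b \<and> q \<in> set b"
    using bs b qb unfolding switches_def by blast
qed

lemma crossing_switch_split:
  assumes "distinct xs" "length xs = 2 * n" "crossing_switch xs ys b"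
  obtains us vs us' vs' where "xs = us @ b @ vs" "ys = us' @ rev b @ vs'"
    "length us' = length us" "set us' = set us" "length vs' = length vs" "set vs' = set vs"
    "length us < n" "length b = 2 * (n - length us)"
proof -
  obtain bs where bs: "block_reversal bs xs ys" "b \<in> set bs" "2 \<le> length b"
    using assms unfolding crossing_switch_def switches_def by blast
  obtain us vs us' vs' where sp: "xs = us @ b @ vs" "ys = us' @ rev b @ vs'"
    "length us' = length us" "set us' = set us" "length vs' = length vs" "set vs' = set vs"
    using block_split[OF bs(1,2)] .
  obtain us1 vs1 where sp1: "xs = us1 @ b @ vs1" "length us1 = length vs1"
    using assms unfolding crossing_switch_def by blast
  have b0: "b \<noteq> []" using bs by auto
  then have hb: "hd b \<in> set b" by simp
  have at: "position xs (hd b) = length u + position b (hd b)" if "xs = u @ b @ v" for u v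
  proof -
    have "distinct (u @ b @ v)" using assms(1) that by simp
    then have "hd b \<notin> set u" using hb by auto
    then show ?thesis unfolding that using hb by (simp add: position_append)
  qed
  have "length us = length us1" using at[OF sp(1)] at[OF sp1(1)] by simp
  moreover have "length us1 + length b + length us1 = 2 * n"
    using arg_cong[OF sp1(1), of length] sp1(2) assms(2) by simp
  ultimately have "length b = 2 * (n - length us)" "length us < n" using bs(3) by auto
  then show thesis using that sp by blast
qed

text \<open>
  What the move does to positions: the \<open>2 m\<close> central places are mirrored, and every other point keeps
  to its side and moves by at most one place.
\<close>
definition central_move :: "nat \<Rightarrow> nat \<Rightarrow> 'a list \<Rightarrow> 'a list \<Rightarrow> bool" where
  "central_move n m xs ys \<longleftrightarrow> m \<le> n \<and> (\<forall>p\<in>set xs.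
     (n - m < position xs p \<and> position xs p \<le> n + m \<longrightarrow> position xs p + position ys p = 2 * n + 1) \<and>
     (position xs p \<le> n - m \<longrightarrow> position ys p \<le> n - m) \<and>
     (n + m < position xs p \<longrightarrow> n + m < position ys p) \<and>
     (position xs p \<le> n - m \<or> n + m < position xs p \<longrightarrow>
        position ys p \<le> position xs p + 1 \<and> position xs p \<le> position ys p + 1))"

lemma crossing_switch_size:
  assumes "distinct xs" "length xs = 2 * n" "crossing_switch xs ys b"
  obtains m where "1 \<le> m" "m \<le> n" "length b = 2 * m"
proof -
  obtain us vs us' vs' where "xs = us @ b @ vs" "ys = us' @ rev b @ vs'"
    "length us' = length us" "set us' = set us" "length vs' = length vs" "set vs' = set vs"
    and l: "length us < n" "length b = 2 * (n - length us)"
    using crossing_switch_split[OF assms(1-3)] .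
  show thesis using that[of "n - length us"] l by auto
qed

lemma crossing_switch_positions:
  assumes "distinct xs" "length xs = 2 * n" "crossing_switch xs ys b" "p \<in> set xs"
  shows "p \<in> set b \<longleftrightarrow> n < position xs p + length b div 2 \<and> position xs p \<le> n + length b div 2"
    "p \<in> set b \<Longrightarrow> position xs p + position ys p = 2 * n + 1"
    "p \<notin> set b \<Longrightarrow> position xs p \<le> n \<Longrightarrow> position ys p \<le> n - length b div 2"
    "p \<notin> set b \<Longrightarrow> n < position xs p \<Longrightarrow> n + length b div 2 < position ys p"
proof -
  obtain us vs us' vs' where sp: "xs = us @ b @ vs" "ys = us' @ rev b @ vs'"
    "length us' = length us" "set us' = set us" "length vs' = length vs" "set vs' = set vs"
    and l: "length us < n" "length b = 2 * (n - length us)"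
    using crossing_switch_split[OF assms(1-3)] .
  note bp = block_positions[OF assms(1) sp, of p]
  have cs: "p \<in> set us \<or> p \<in> set b \<or> p \<in> set vs" using assms(4) sp by auto
  have pb: "p \<in> set b \<Longrightarrow> length us < position xs p \<and> position xs p \<le> length us + length b"
    using bp(1) position_range[of p b] by auto
  show "p \<in> set b \<longleftrightarrow> n < position xs p + length b div 2 \<and> position xs p \<le> n + length b div 2"
    using cs pb bp(3,4) l by fastforce
  show "p \<in> set b \<Longrightarrow> position xs p + position ys p = 2 * n + 1" using bp(2) l by auto
  show "p \<notin> set b \<Longrightarrow> position xs p \<le> n \<Longrightarrow> position ys p \<le> n - length b div 2"
    using cs bp(3,4) l by auto
  show "p \<notin> set b \<Longrightarrow> n < position xs p \<Longrightarrow> n + length b div 2 < position ys p"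
    using cs bp(3,4) l by auto
qed

text \<open>
  The points of a crossing switch are exactly those that change sides.
\<close>
lemma crossing_switch_length:
  assumes "distinct xs" "length xs = 2 * n" "crossing_switch xs ys b" "central_move n m xs ys"
  shows "length b = 2 * m"
proof -
  note cp = crossing_switch_positions[OF assms(1-3)]
  have m: "m \<le> n" using assms(4) unfolding central_move_def by blast
  obtain k where k: "1 \<le> k" "k \<le> n" "length b = 2 * k" using crossing_switch_size[OF assms(1-3)] .
  have bnd: "1 \<le> n + 1 - k" "n + 1 - k \<le> length xs" using k assms(2) by linarith+
  obtain p where p: "p \<in> set xs" "position xs p = n + 1 - k"
    using ex_position[OF assms(1), of "n + 1 - k", OF bnd(1) bnd(2)] by blast
  have "p \<in> set b" using cp(1)[OF p(1)] p k by auto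
  then have "position ys p = n + k" using cp(2)[OF p(1)] p k by auto
  then have "\<not> position xs p \<le> n - m" using assms(4) p k unfolding central_move_def by fastforce
  then have "k \<le> m" using p k by auto
  moreover have "m \<le> k"
  proof (rule ccontr)
    assume "\<not> m \<le> k"
    have bnd: "1 \<le> n + 1 - m" "n + 1 - m \<le> length xs" using m assms(2) \<open>\<not> m \<le> k\<close> k by linarith+
    obtain q where q: "q \<in> set xs" "position xs q = n + 1 - m"
      using ex_position[OF assms(1), of "n + 1 - m", OF bnd(1) bnd(2)] by blast
    have "n - m < position xs q" "position xs q \<le> n + m" using q m \<open>\<not> m \<le> k\<close> by auto
    then have "position xs q + position ys q = 2 * n + 1" using assms(4) q unfolding central_move_def by blast
    moreover have "q \<notin> set b" using cp(1)[OF q(1)] q k m \<open>\<not> m \<le> k\<close> by auto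
    moreover have "position xs q \<le> n" using q m k \<open>\<not> m \<le> k\<close> by linarith
    ultimately have "position ys q \<le> n - length b div 2" "position xs q + position ys q = 2 * n + 1"
      using cp(3)[OF q(1)] by auto
    then show False using q k m \<open>\<not> m \<le> k\<close> by linarith
  qed
  ultimately show ?thesis using k by simp
qed

lemma crossing_switch_central:
  assumes "distinct xs" "length xs = 2 * n" "crossing_switch xs ys b" "is_move xs ys"
    and "\<And>b'. b' \<in> switches xs ys \<Longrightarrow> crossing_switch xs ys b' \<or> length b' = 2"
    and "\<And>b'. crossing_switch xs ys b' \<Longrightarrow> b' = b"
  shows "central_move n (length b div 2) xs ys"
proof -
  note cp = crossing_switch_positions[OF assms(1-3)]
  obtain k where k: "1 \<le> k" "k \<le> n" "length b = 2 * k" using crossing_switch_size[OF assms(1-3)] .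
  obtain bs where bs: "block_reversal bs xs ys" using assms(4) unfolding is_move_def by blast
  have step: "position ys p \<le> position xs p + 1 \<and> position xs p \<le> position ys p + 1"
    if "p \<in> set xs" "p \<notin> set b" for p
  proof -
    note pp = that
    obtain b' where b': "b' \<in> set bs" "p \<in> set b'" using block_containing[OF bs pp(1)] by blast
    have "b' \<noteq> b" using b' pp by auto
    then have "length b' \<le> 2" using assms(5,6)[of b'] bs b' unfolding switches_def by fastforce
    obtain us vs us' vs' where sp: "xs = us @ b' @ vs" "ys = us' @ rev b' @ vs'"
      "length us' = length us" "set us' = set us" "length vs' = length vs" "set vs' = set vs"
      using block_split[OF bs b'(1)] .
    show ?thesis
      using block_positions(1,2)[OF assms(1) sp b'(2)] position_range[OF b'(2)] \<open>length b' \<le> 2\<close> by linarith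
  qed
  show ?thesis
    unfolding central_move_def
  proof (intro conjI ballI impI)
    show "length b div 2 \<le> n" using k by auto
    fix p assume p: "p \<in> set xs"
    show "position xs p + position ys p = 2 * n + 1"
      if "n - length b div 2 < position xs p \<and> position xs p \<le> n + length b div 2"
      using cp(1,2)[OF p] that k by auto
    show "position ys p \<le> n - length b div 2" if "position xs p \<le> n - length b div 2"
      using cp(1,3)[OF p] that k by auto
    show "n + length b div 2 < position ys p" if "n + length b div 2 < position xs p"
      using cp(1,4)[OF p] that k by auto
    have "p \<notin> set b" if "position xs p \<le> n - length b div 2 \<or> n + length b div 2 < position xs p"
      using cp(1)[OF p] that k by auto
    then show "position ys p \<le> position xs p + 1" "position xs p \<le> position ys p + 1"
      if "position xs p \<le> n - length b div 2 \<or> n + length b div 2 < position xs p"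
      using step[OF p] that by auto
  qed
qed

lemma crossing_switch_unique:
  assumes "distinct xs" "length xs = 2 * n" "crossing_switch xs ys b" "crossing_switch xs ys b'"
  shows "b = b'"
proof -
  have le: "length c \<le> length c'" if c: "crossing_switch xs ys c" "crossing_switch xs ys c'" for c c'
  proof (rule ccontr)
    assume "\<not> length c \<le> length c'"
    moreover obtain k where k: "1 \<le> k" "k \<le> n" "length c = 2 * k" using crossing_switch_size[OF assms(1,2) c(1)] .
    moreover obtain k' where k': "1 \<le> k'" "k' \<le> n" "length c' = 2 * k'" using crossing_switch_size[OF assms(1,2) c(2)] .
    ultimately have "k' < k" by auto
    have bnd: "1 \<le> n + 1 - k" "n + 1 - k \<le> length xs" using k assms(2) by linarith+
    obtain p where p: "p \<in> set xs" "position xs p = n + 1 - k"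
      using ex_position[OF assms(1), of "n + 1 - k", OF bnd(1) bnd(2)] by blast
    have "position ys p = n + k"
      using crossing_switch_positions(1,2)[OF assms(1,2) c(1) p(1)] p k by auto
    moreover have "p \<notin> set c'"
      using crossing_switch_positions(1)[OF assms(1,2) c(2) p(1)] p k k' \<open>k' < k\<close> by auto
    moreover have "position xs p \<le> n" using p k by linarith
    ultimately have "n + k \<le> n - length c' div 2"
      using crossing_switch_positions(3)[OF assms(1,2) c(2) p(1)] by metis
    then show False using k by linarith
  qed
  have l: "length b = length b'" using le[OF assms(3,4)] le[OF assms(4,3)] by simp
  obtain us vs where 1: "xs = us @ b @ vs" "length us = length vs"
    using assms(3) unfolding crossing_switch_def by blast
  obtain us' vs' where 2: "xs = us' @ b' @ vs'" "length us' = length vs'"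
    using assms(4) unfolding crossing_switch_def by blast
  have "length xs = 2 * length us + length b" "length xs = 2 * length us' + length b'"
    using arg_cong[OF 1(1), of length] arg_cong[OF 2(1), of length] 1(2) 2(2) by auto
  then have "length us = length us'" using l by linarith
  moreover have "us @ b @ vs = us' @ b' @ vs'" using 1(1) 2(1) by (rule subst)
  ultimately show ?thesis using l by simp
qed

lemma noncrossing_central:
  assumes "distinct xs" "length xs = 2 * n" "is_move xs ys"
    and "\<And>b'. b' \<in> switches xs ys \<Longrightarrow> length b' = 2" "\<And>b'. \<not> crossing_switch xs ys b'"
  shows "central_move n 0 xs ys"
proof -
  obtain bs where bs: "block_reversal bs xs ys" using assms(3) unfolding is_move_def by blast
  have step: "position ys p \<le> position xs p + 1 \<and> position xs p \<le> position ys p + 1 \<and>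
      (position xs p \<le> n \<longrightarrow> position ys p \<le> n) \<and> (n < position xs p \<longrightarrow> n < position ys p)"
    if "p \<in> set xs" for p
  proof -
    note pp = that
    obtain b' where b': "b' \<in> set bs" "p \<in> set b'" using block_containing[OF bs pp] by blast
    have l2: "length b' = 2 \<and> b' \<in> switches xs ys \<or> length b' = 1"
    proof -
      have "length b' \<noteq> 0" using b' by auto
      moreover have "b' \<in> switches xs ys" if "2 \<le> length b'" using bs b' that unfolding switches_def by blast
      ultimately show ?thesis using assms(4)[of b'] by linarith
    qed
    obtain us vs us' vs' where sp: "xs = us @ b' @ vs" "ys = us' @ rev b' @ vs'"
      "length us' = length us" "set us' = set us" "length vs' = length vs" "set vs' = set vs"
      using block_split[OF bs b'(1)] .
    note bp = block_positions(1,2)[OF assms(1) sp b'(2)] position_range[OF b'(2)]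
    have "length us + 1 \<noteq> n \<or> length b' = 1"
    proof (rule ccontr)
      assume "\<not> ?thesis"
      then have "crossing_switch xs ys b'" using l2 sp assms(2) unfolding crossing_switch_def
        by (intro conjI exI[of _ us] exI[of _ vs]) auto
      then show False using assms(5) by blast
    qed
    then show ?thesis using bp l2 by linarith
  qed
  then show ?thesis unfolding central_move_def by simp
qed

text \<open>
  If nobody moves by more than one place, then the first entry either stays or trades places with the
  second one.
\<close>
lemma short_blocks:
  assumes "distinct xs" "distinct ys" "set xs = set ys"
    and "\<And>p. p \<in> set xs \<Longrightarrow> position ys p \<le> position xs p + 1 \<and> position xs p \<le> position ys p + 1"
  shows "\<exists>bs. block_reversal bs xs ys \<and> (\<forall>b\<in>set bs. length b \<le> 2)"
  using assms
proof (induction xs arbitrary: ys rule: length_induct)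
  case (1 xs)
  have len: "length xs = length ys" using 1(2-4) by (metis distinct_card)
  show ?case
  proof (cases xs)
    case Nil
    then show ?thesis using len by (intro exI[of _ "[]"]) (auto simp: block_reversal_def)
  next
    case (Cons x xs')
    have x: "position xs x = 1" "x \<in> set xs" using Cons by (auto simp: position_def)
    then have "position ys x \<le> 2" using 1(5)[of x] by auto
    moreover have "1 \<le> position ys x" using position_range[of x ys] x 1(4) by auto
    ultimately consider "position ys x = 1" | "position ys x = 2" by linarith
    then show ?thesis
    proof cases
      case 1
      then obtain ys' where ys: "ys = x # ys'" using nth_position[of x ys] x \<open>set xs = set ys\<close> len Cons
        by (cases ys) auto
      have "\<exists>bs. block_reversal bs xs' ys' \<and> (\<forall>b\<in>set bs. length b \<le> 2)"
      proof (rule "1.IH"[rule_format])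
        show "length xs' < length xs" "distinct xs'" "distinct ys'"
          using "1.prems" Cons ys by auto
        show "set xs' = set ys'" using "1.prems"(1-3) Cons ys by (simp add: insert_ident)
        fix p assume p: "p \<in> set xs'"
        then have "p \<noteq> x" using "1.prems" Cons by auto
        then show "position ys' p \<le> position xs' p + 1 \<and> position xs' p \<le> position ys' p + 1"
          using "1.prems"(4)[of p] p Cons ys by (auto simp: position_def)
      qed
      then obtain bs where "block_reversal bs xs' ys'" "\<forall>b\<in>set bs. length b \<le> 2" by blast
      then show ?thesis using Cons ys by (intro exI[of _ "[x] # bs"]) (auto simp: block_reversal_def)
    next
      case 2
      have x1: "ys ! 1 = x" using nth_position[of x ys] x \<open>set xs = set ys\<close> 2 by simp
      have "2 \<le> length ys" using position_range[of x ys] x \<open>set xs = set ys\<close> 2 by simp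
      then obtain y z ys' where yz: "ys = y # z # ys'" by (cases ys; cases "tl ys") auto
      have ys: "ys = y # x # ys'" using yz x1 by simp
      have y: "y \<in> set xs" "y \<noteq> x" "position ys y = 1" using ys "1.prems" by (auto simp: position_def)
      then have "position xs y \<le> 2" using "1.prems"(4)[of y] by auto
      moreover have "position xs y \<noteq> 1" using position_inj[of x xs y] x y by auto
      moreover have "1 \<le> position xs y" using position_range[of y xs] y by auto
      ultimately have "position xs y = 2" by simp
      then have "xs ! 1 = y" using nth_position[of y xs] y by simp
      moreover obtain w xs'' where "xs' = w # xs''" using \<open>2 \<le> length ys\<close> len Cons by (cases xs') auto
      ultimately have xs: "xs = x # y # xs''" using Cons by simp
      have "\<exists>bs. block_reversal bs xs'' ys' \<and> (\<forall>b\<in>set bs. length b \<le> 2)"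
      proof (rule "1.IH"[rule_format])
        show "length xs'' < length xs" "distinct xs''" "distinct ys'"
          using "1.prems" xs ys by auto
        have "set xs'' = set xs - {x, y}" "set ys' = set ys - {x, y}"
          using "1.prems"(1,2) unfolding xs ys by auto
        then show "set xs'' = set ys'" using "1.prems"(3) by simp
        fix p assume p: "p \<in> set xs''"
        then have "p \<noteq> x" "p \<noteq> y" using "1.prems" xs by auto
        then show "position ys' p \<le> position xs'' p + 1 \<and> position xs'' p \<le> position ys' p + 1"
          using "1.prems"(4)[of p] p xs ys by (auto simp: position_def)
      qed
      then obtain bs where "block_reversal bs xs'' ys'" "\<forall>b\<in>set bs. length b \<le> 2" by blast
      then show ?thesis using xs ys by (intro exI[of _ "[x, y] # bs"]) (auto simp: block_reversal_def)
    qed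
  qed
qed

lemma central_move_blocks:
  assumes "distinct xs" "distinct ys" "set xs = set ys" "length xs = 2 * n" "central_move n m xs ys"
  obtains as cs where
    "block_reversal (as @ take (2 * m) (drop (n - m) xs) # cs) xs ys"
    "\<forall>b\<in>set as \<union> set cs. length b \<le> 2" "length (concat as) = n - m"
proof -
  have m: "m \<le> n" using assms(5) unfolding central_move_def by blast
  have len: "length ys = 2 * n" using assms by (metis distinct_card)
  define us b vs where "us = take (n - m) xs" and "b = take (2 * m) (drop (n - m) xs)" and "vs = drop (n + m) xs"
  have xs: "xs = us @ b @ vs"
  proof -
    have "drop (n + m) xs = drop (2 * m) (drop (n - m) xs)" using m by (simp add: add.commute)
    then show ?thesis unfolding us_def b_def vs_def by (metis append_take_drop_id)
  qed
  define us' b' vs' where "us' = take (n - m) ys" and "b' = take (2 * m) (drop (n - m) ys)" and "vs' = drop (n + m) ys"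
  have ys: "ys = us' @ b' @ vs'"
  proof -
    have "drop (n + m) ys = drop (2 * m) (drop (n - m) ys)" using m by (simp add: add.commute)
    then show ?thesis unfolding us'_def b'_def vs'_def by (metis append_take_drop_id)
  qed
  have l: "length us = n - m" "length b = 2 * m" "length vs = n - m"
    "length us' = n - m" "length b' = 2 * m" "length vs' = n - m"
    using m assms(4) len unfolding us_def b_def vs_def us'_def b'_def vs'_def by auto
  have pos: "p \<in> set us \<longleftrightarrow> position xs p \<le> n - m" "p \<in> set vs \<longleftrightarrow> n + m < position xs p"
    "p \<in> set us' \<longleftrightarrow> position ys p \<le> n - m" "p \<in> set vs' \<longleftrightarrow> n + m < position ys p"
    if "p \<in> set xs" for p
  proof -
    have pc: "p \<in> set us \<or> p \<in> set b \<or> p \<in> set vs" "p \<in> set us' \<or> p \<in> set b' \<or> p \<in> set vs'"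
      using that assms(3) xs ys by auto
    have dj: "p \<in> set b \<Longrightarrow> p \<notin> set us" "p \<in> set vs \<Longrightarrow> p \<notin> set us \<and> p \<notin> set b"
      "p \<in> set b' \<Longrightarrow> p \<notin> set us'" "p \<in> set vs' \<Longrightarrow> p \<notin> set us' \<and> p \<notin> set b'"
      using assms(1,2) xs ys by auto
    have px: "position xs p = (if p \<in> set us then position us p else length us + (if p \<in> set b then position b p else length b + position vs p))"
      unfolding xs by (simp add: position_append)
    have py: "position ys p = (if p \<in> set us' then position us' p else length us' + (if p \<in> set b' then position b' p else length b' + position vs' p))"
      unfolding ys by (simp add: position_append)
    show "p \<in> set us \<longleftrightarrow> position xs p \<le> n - m" "p \<in> set vs \<longleftrightarrow> n + m < position xs p"
      using pc(1) dj px l m position_range[of p us] position_range[of p b] position_range[of p vs] by auto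
    show "p \<in> set us' \<longleftrightarrow> position ys p \<le> n - m" "p \<in> set vs' \<longleftrightarrow> n + m < position ys p"
      using pc(2) dj py l m position_range[of p us'] position_range[of p b'] position_range[of p vs'] by auto
  qed
  have cm: "position xs p \<le> n - m \<Longrightarrow> position ys p \<le> n - m" "n + m < position xs p \<Longrightarrow> n + m < position ys p"
    "position xs p \<le> n - m \<or> n + m < position xs p \<Longrightarrow>
        position ys p \<le> position xs p + 1 \<and> position xs p \<le> position ys p + 1"
    "n - m < position xs p \<Longrightarrow> position xs p \<le> n + m \<Longrightarrow> position xs p + position ys p = 2 * n + 1"
    if "p \<in> set xs" for p using assms(5) that unfolding central_move_def by auto
  have dist: "distinct us" "distinct us'" "distinct vs" "distinct vs'" "distinct b" "distinct b'"
    using assms(1,2) xs ys by auto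
  have "set us \<subseteq> set us'" using pos(1,3) cm(1) xs by auto
  then have us: "set us = set us'" using l dist card_subset_eq[of "set us'" "set us"] by (simp add: distinct_card)
  have "set vs \<subseteq> set vs'" using pos(2,4) cm(2) xs by auto
  then have vs: "set vs = set vs'" using l dist card_subset_eq[of "set vs'" "set vs"] by (simp add: distinct_card)
  have b: "b' = rev b"
  proof (rule nth_equalityI)
    show "length b' = length (rev b)" using l by simp
    fix i assume i: "i < length b'"
    define p where "p = b ! (2 * m - Suc i)"
    have "n + m - Suc i = length us + (2 * m - Suc i)" using i l m by linarith
    then have "xs ! (n + m - Suc i) = (b @ vs) ! (2 * m - Suc i)" unfolding xs by simp
    then have "p = xs ! (n + m - Suc i)" using i l unfolding p_def by (simp add: nth_append)
    moreover have "n + m - Suc i < length xs" using i l m assms(4) by auto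
    moreover have "Suc (n + m - Suc i) = n + m - i" using i l m by linarith
    ultimately have p: "p \<in> set xs" "position xs p = n + m - i"
      using position_nth[OF assms(1), of "n + m - Suc i"] by simp_all
    have "n - m < position xs p" "position xs p \<le> n + m" using p(2) i l m by linarith+
    then have "position ys p = n - m + i + 1" using cm(4)[OF p(1)] p(2) i l m by linarith
    then have "ys ! (n - m + i) = p" using nth_position[of p ys] p assms(3) by simp
    then have "b' ! i = p" using i l ys by (auto simp: nth_append)
    then show "b' ! i = rev b ! i" using i l unfolding p_def by (simp add: rev_nth)
  qed
  obtain as where as: "block_reversal as us us'" "\<forall>b\<in>set as. length b \<le> 2"
  proof -
    have "\<exists>bs. block_reversal bs us us' \<and> (\<forall>b\<in>set bs. length b \<le> 2)"
    proof (rule short_blocks[OF dist(1,2) us])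
      fix p assume "p \<in> set us"
      then have "p \<in> set xs" "position xs p = position us p" "position ys p = position us' p"
        "position xs p \<le> n - m"
        using us pos(1)[of p] by (auto simp: xs ys position_append)
      then show "position us' p \<le> position us p + 1 \<and> position us p \<le> position us' p + 1"
        using cm(3)[of p] by auto
    qed
    then show thesis using that by blast
  qed
  obtain cs where cs: "block_reversal cs vs vs'" "\<forall>b\<in>set cs. length b \<le> 2"
  proof -
    have "\<exists>bs. block_reversal bs vs vs' \<and> (\<forall>b\<in>set bs. length b \<le> 2)"
    proof (rule short_blocks[OF dist(3,4) vs])
      fix p assume p: "p \<in> set vs"
      then have px: "p \<in> set xs" "n + m < position xs p" using pos(2)[of p] by (auto simp: xs)
      have "p \<notin> set us" "p \<notin> set b" "p \<notin> set us'" "p \<notin> set b'" using p vs assms(1,2) xs ys by auto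
      then have "position xs p = n + m + position vs p" "position ys p = n + m + position vs' p"
        using l m by (auto simp: xs ys position_append)
      then show "position vs' p \<le> position vs p + 1 \<and> position vs p \<le> position vs' p + 1"
        using cm(3)[OF px(1)] px(2) by auto
    qed
    then show thesis using that by blast
  qed
  show thesis
  proof (rule that[of as cs])
    show "block_reversal (as @ take (2 * m) (drop (n - m) xs) # cs) xs ys"
      using as(1) cs(1) xs ys b unfolding b_def[symmetric] block_reversal_def by simp
    show "\<forall>b\<in>set as \<union> set cs. length b \<le> 2" using as cs by auto
    show "length (concat as) = n - m" using as(1) l unfolding block_reversal_def by simp
  qed
qed

lemma central_move_is_move:
  assumes "distinct xs" "distinct ys" "set xs = set ys" "length xs = 2 * n" "central_move n m xs ys"
    and "xs \<noteq> ys"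
  shows "is_move xs ys"
proof -
  obtain as cs where br: "block_reversal (as @ take (2 * m) (drop (n - m) xs) # cs) xs ys"
    using central_move_blocks[OF assms(1-5)] by metis
  have "\<exists>b\<in>set (as @ take (2 * m) (drop (n - m) xs) # cs). 2 \<le> length b"
  proof (rule ccontr)
    assume s: "\<not> ?thesis"
    have "map rev bs = bs" if "\<forall>b\<in>set bs. \<not> 2 \<le> length b" for bs :: "'a list list"
      using that
    proof (induction bs)
      case (Cons b bs)
      then show ?case by (cases b; cases "tl b") auto
    qed simp
    then have "xs = ys" using br s unfolding block_reversal_def by metis
    then show False using assms(6) by simp
  qed
  then show ?thesis using br unfolding is_move_def by blast
qed

text \<open>
  The first point of a switch moves by the length of the switch minus one, so only a central point
  can belong to a switch of three or more points.
\<close>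
lemma central_move_switches:
  assumes "distinct xs" "length xs = 2 * n" "central_move n m xs ys" "b \<in> switches xs ys"
  shows "crossing_switch xs ys b \<or> length b = 2"
proof -
  obtain bs where bs: "block_reversal bs xs ys" "b \<in> set bs" "2 \<le> length b"
    using assms(4) unfolding switches_def by blast
  obtain us vs us' vs' where sp: "xs = us @ b @ vs" "ys = us' @ rev b @ vs'"
    "length us' = length us" "set us' = set us" "length vs' = length vs" "set vs' = set vs"
    using block_split[OF bs(1,2)] .
  define p where "p = hd b"
  have p: "p \<in> set b" "p \<in> set xs" "position b p = 1" using bs(3) sp unfolding p_def by (cases b; auto simp: position_def)+
  have px: "position xs p = length us + 1" "position ys p = length us + length b"
    using block_positions(1,2)[OF assms(1) sp p(1)] p by auto
  show ?thesis
  proof (cases "length b = 2")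
    case False
    then have "n - m < position xs p \<and> position xs p \<le> n + m"
      using assms(3) p(2) px bs(3) unfolding central_move_def by fastforce
    then have "position xs p + position ys p = 2 * n + 1" using assms(3) p(2) unfolding central_move_def by blast
    then have "length us = length vs" using px sp assms(2) by simp
    then show ?thesis using assms(4) sp unfolding crossing_switch_def by blast
  qed simp
qed

lemma central_move_crossing:
  assumes "distinct xs" "distinct ys" "set xs = set ys" "length xs = 2 * n" "central_move n m xs ys"
  shows "(\<exists>b. crossing_switch xs ys b) \<longleftrightarrow> 0 < m"
proof
  assume "\<exists>b. crossing_switch xs ys b"
  then obtain b where b: "crossing_switch xs ys b" by blast
  then have "length b = 2 * m" using crossing_switch_length assms by blast
  moreover have "2 \<le> length b" using b unfolding crossing_switch_def switches_def by blast
  ultimately show "0 < m" by simp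
next
  assume m: "0 < m"
  have mn: "m \<le> n" using assms(5) unfolding central_move_def by blast
  obtain as cs where br: "block_reversal (as @ take (2 * m) (drop (n - m) xs) # cs) xs ys"
    and l: "length (concat as) = n - m" using central_move_blocks[OF assms(1-5)] by metis
  define b where "b = take (2 * m) (drop (n - m) xs)"
  have b: "length b = 2 * m" using mn assms(4) unfolding b_def by simp
  have "b \<in> switches xs ys" using br b m unfolding switches_def b_def[symmetric] by fastforce
  moreover have "xs = concat as @ b @ concat cs" using br unfolding block_reversal_def b_def by simp
  moreover have "length (concat as) = length (concat cs)"
    using arg_cong[OF calculation(2), of length] b l mn assms(4) by auto
  ultimately show "\<exists>b. crossing_switch xs ys b" unfolding crossing_switch_def by blast
qed

section \<open>The permutations of the model motion\<close>

context blocks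
begin

lemma block_containing_time:
  obtains i k where "crossing_time i \<le> s + 2 * n * k" "s + 2 * n * k < crossing_time (i + 1)"
proof -
  define k where "k = - ((s - crossing_time 0) div (2 * n))"
  define s' where "s' = s + 2 * n * k"
  have "s' = crossing_time 0 + (s - crossing_time 0) mod (2 * n)"
  proof -
    have "2 * n * k = - (2 * n * ((s - crossing_time 0) div (2 * n)))" unfolding k_def by simp
    then show ?thesis using mult_div_mod_eq[of "2 * n" "s - crossing_time 0"] unfolding s'_def by linarith
  qed
  moreover have "0 \<le> (s - crossing_time 0) mod (2 * n)" "(s - crossing_time 0) mod (2 * n) < 2 * n"
    using n_pos by auto
  ultimately have s': "crossing_time 0 \<le> s'" "s' < crossing_time t"
    using crossing_time_per[of 0] by auto
  define S where "S = {i\<in>{0..<t}. crossing_time i \<le> s'}"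
  have "0 \<in> S" using s' t2 unfolding S_def by auto
  moreover have "S \<subseteq> {0..<t}" unfolding S_def by auto
  ultimately have S: "finite S" "S \<noteq> {}" using finite_subset[of S "{0..<t}"] by auto
  then have M: "Max S \<in> S" by (rule Max_in)
  have "s' < crossing_time (Max S + 1)"
  proof (rule ccontr)
    assume "\<not> ?thesis"
    moreover then have "Max S + 1 \<noteq> t" using s' by auto
    ultimately have "Max S + 1 \<in> S" using M unfolding S_def by auto
    then show False using Max_ge[OF S(1), of "Max S + 1"] by simp
  qed
  then show thesis using that[of "Max S" k] M unfolding S_def s'_def by simp
qed

text \<open>
  In a crossing conjugate points meet. At any time between two crossings some point of the one block
  meets the conjugate of some point of the other.
\<close>
lemma every_move_flips:
  obtains p q where "p \<in> points n" "q \<in> points n" "p \<noteq> q" "flips rank s p q"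
proof -
  obtain i k where i: "crossing_time i \<le> s + 2 * n * k" "s + 2 * n * k < crossing_time (i + 1)"
    using block_containing_time .
  define x where "x = s + 2 * n * k"
  have "\<exists>p\<in>points n. \<exists>q\<in>points n. p \<noteq> q \<and> flips rank x p q"
  proof (cases "x = crossing_time i")
    case True
    have "0 < d i" using d_pos[of i] by simp
    then have "label i 0 \<in> points n" "label (i + t) 0 \<in> points n" "rank x (label i 0) = 1"
      "rank (x - 1) (label i 0) = 0" "rank x (label (i + t) 0) = 0" "rank (x - 1) (label (i + t) 0) = 1"
      using rank_label[of 0 i] rank_label[of 0 "i + t"] d_per[of i] rank_at_crossing[of 0 i] True by auto
    then have "flips rank x (label i 0) (label (i + t) 0)" "label i 0 \<noteq> label (i + t) 0"
      "label i 0 \<in> points n" "label (i + t) 0 \<in> points n" unfolding flips_def by auto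
    then show ?thesis by blast
  next
    case False
    define y where "y = x - 2 * D (i + 1) - e"
    define a b where "a = max 0 (- y)" and "b = max 0 y"
    have ab: "0 \<le> a" "a < d i" "0 \<le> b" "b < d (i + 1)" "x = swap_time i a (i + 1) b"
      using False i D_Suc[of i] D_Suc[of "i + 1"] d_pos[of i] d_pos[of "i + 1"]
      unfolding x_def[symmetric] y_def a_def b_def crossing_time_def swap_time_def by auto
    have t1: "i < i + 1" "i + 1 < i + t" using t2 by auto
    have w: "crossing_time (i + 1) - 2 * n \<le> x - 1" "x < crossing_time i + 2 * n"
      using i False crossing_time_less[of "i + 1" "i + t"] crossing_time_per[of i] t1 d_pos[of "i + 1"]
        d_pos[of "i + t"] unfolding x_def by auto
    have "height (i + 1 - t) b x < height i a x" "height i a (x - 1) < height (i + 1 - t) b (x - 1)"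
      using height_blocks[OF ab(1-4) t1, of x] height_blocks[OF ab(1-4) t1, of "x - 1"] w ab(5) by auto
    moreover have "b < d (i + 1 - t)" using d_per[of "i + 1 - t"] ab by simp
    ultimately have "label i a \<in> points n" "label (i + 1 - t) b \<in> points n"
      "flips rank x (label i a) (label (i + 1 - t) b)" "label i a \<noteq> label (i + 1 - t) b"
      using rank_label[of a i] rank_label[of b "i + 1 - t"] ab unfolding flips_def by auto
    then show ?thesis by blast
  qed
  then show thesis using that motion.flips_shifts[of _ _ s k] unfolding x_def by blast
qed

text \<open>
  The list of the labels in the order of decreasing height.
\<close>
definition arrangement :: "int \<Rightarrow> int list" where
  "arrangement s = map (\<lambda>k. inv_into (points n) (rank s) (n - int k)) [0..<nat (2 * n)]"

lemma arrangement_nth: "k < nat (2 * n) \<Longrightarrow> arrangement s ! k \<in> points n \<and> rank s (arrangement s ! k) = n - int k"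
  using bij_betw_inv_into_right[OF rank_bij[of s], of "n - int k"]
    bij_betwE[OF bij_betw_inv_into[OF rank_bij[of s]], rule_format, of "n - int k"]
  unfolding arrangement_def by auto

lemma length_arrangement: "length (arrangement s) = nat (2 * n)"
  unfolding arrangement_def by simp

lemma distinct_arrangement: "distinct (arrangement s)"
  unfolding distinct_conv_nth length_arrangement
proof (intro allI impI notI)
  fix i j assume "i < nat (2 * n)" "j < nat (2 * n)" "i \<noteq> j" "arrangement s ! i = arrangement s ! j"
  then show False using arrangement_nth[of i s] arrangement_nth[of j s] by simp
qed

lemma set_arrangement: "set (arrangement s) = points n"
proof (rule card_subset_eq)
  show "finite (points n)" unfolding points_def by simp
  show "set (arrangement s) \<subseteq> points n"
    using arrangement_nth length_arrangement by (metis in_set_conv_nth subsetI)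
  show "card (set (arrangement s)) = card (points n)"
    using motion.card_P distinct_card[OF distinct_arrangement] length_arrangement by simp
qed

lemma position_arrangement:
  assumes "p \<in> points n"
  shows "int (position (arrangement s) p) = n + 1 - rank s p"
proof -
  have "p \<in> set (arrangement s)" using assms set_arrangement by simp
  then obtain k where k: "k < nat (2 * n)" "arrangement s ! k = p"
    using length_arrangement by (metis in_set_conv_nth)
  then have "position (arrangement s) p = Suc k"
    using position_nth[OF distinct_arrangement, of k s] length_arrangement by simp
  then show ?thesis using arrangement_nth[OF k(1), of s] k(2) by simp
qed

lemma central_move_arrangement:
  "central_move (nat n) (nat (half_size s)) (arrangement (s - 1)) (arrangement s)"
  unfolding central_move_def
proof (intro conjI ballI impI)
  have c: "0 \<le> half_size s" "half_size s \<le> n" using half_size_range by auto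
  then show "nat (half_size s) \<le> nat n" by simp
  fix p assume "p \<in> set (arrangement (s - 1))"
  then have p: "p \<in> points n" using set_arrangement by simp
  note pos = position_arrangement[OF p, of s] position_arrangement[OF p, of "s - 1"]
  show "position (arrangement (s - 1)) p + position (arrangement s) p = 2 * nat n + 1"
    if "nat n - nat (half_size s) < position (arrangement (s - 1)) p \<and>
      position (arrangement (s - 1)) p \<le> nat n + nat (half_size s)"
    using motion.cross[OF p, of s] pos that c by linarith
  show "position (arrangement s) p \<le> nat n - nat (half_size s)"
    if "position (arrangement (s - 1)) p \<le> nat n - nat (half_size s)"
    using motion.stay[OF p, of s] pos that c by linarith
  show "nat n + nat (half_size s) < position (arrangement s) p"
    if "nat n + nat (half_size s) < position (arrangement (s - 1)) p"
    using motion.stay_right[OF p, of s] pos that c by linarith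
  have "\<bar>rank s p - rank (s - 1) p\<bar> \<le> 1"
    if "position (arrangement (s - 1)) p \<le> nat n - nat (half_size s) \<or>
      nat n + nat (half_size s) < position (arrangement (s - 1)) p"
    using motion.stay[OF p, of s] motion.stay_right[OF p, of s] pos that c by linarith
  then show "position (arrangement s) p \<le> position (arrangement (s - 1)) p + 1"
    "position (arrangement (s - 1)) p \<le> position (arrangement s) p + 1"
    if "position (arrangement (s - 1)) p \<le> nat n - nat (half_size s) \<or>
      nat n + nat (half_size s) < position (arrangement (s - 1)) p"
    using pos that by linarith+
qed

lemma arrangement_order:
  assumes "p \<in> points n" "q \<in> points n"
  shows "position (arrangement s) p < position (arrangement s) q \<longleftrightarrow> rank s q < rank s p"
  using position_arrangement[OF assms(1), of s] position_arrangement[OF assms(2), of s] by linarith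

lemma arrangement_flips:
  assumes "p \<in> points n" "q \<in> points n" "p \<noteq> q"
  shows "flips rank s p q \<longleftrightarrow> (position (arrangement (s - 1)) p < position (arrangement (s - 1)) q) \<noteq>
    (position (arrangement s) p < position (arrangement s) q)"
  unfolding arrangement_order[OF assms(1,2)]
  using motion.flips_commute[OF assms, of s] unfolding flips_def by blast

lemma arrangement_move: "is_move (arrangement (s - 1)) (arrangement s)"
proof (rule central_move_is_move[OF distinct_arrangement distinct_arrangement _ _ central_move_arrangement])
  show "set (arrangement (s - 1)) = set (arrangement s)" unfolding set_arrangement by simp
  show "length (arrangement (s - 1)) = 2 * nat n" unfolding length_arrangement using n_pos by simp
  obtain p q where "p \<in> points n" "q \<in> points n" "p \<noteq> q" "flips rank s p q" using every_move_flips .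
  then show "arrangement (s - 1) \<noteq> arrangement s" using arrangement_flips by metis
qed

lemma arrangement_per: "arrangement (s + 2 * n) = rev (arrangement s)"
proof (rule position_eqI)
  show "distinct (arrangement (s + 2 * n))" "distinct (rev (arrangement s))"
    "set (arrangement (s + 2 * n)) = set (rev (arrangement s))"
    using distinct_arrangement set_arrangement by simp_all
  fix p assume "p \<in> set (arrangement (s + 2 * n))"
  then have p: "p \<in> points n" using set_arrangement by simp
  then have "position (rev (arrangement s)) p + position (arrangement s) p = Suc (nat (2 * n))"
    using position_rev[OF distinct_arrangement, of p s] set_arrangement length_arrangement by simp
  then show "position (arrangement (s + 2 * n)) p = position (rev (arrangement s)) p"
    using position_arrangement[OF p, of s] position_arrangement[OF p, of "s + 2 * n"] rank_per[OF p, of s] n_pos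
    by linarith
qed

lemma arrangement_halfperiod: "is_halfperiod (points n) arrangement (nat (2 * n))"
  unfolding is_halfperiod_def
proof (intro conjI allI ballI impI)
  show "0 < nat (2 * n)" using n_pos by simp
  show "arrangement (i + int (nat (2 * n))) = rev (arrangement i)" for i
    using arrangement_per n_pos by simp
  fix p q assume pq: "p \<in> points n" "q \<in> points n" "p \<noteq> q"
  have "(\<exists>b\<in>switches (arrangement (i - 1)) (arrangement i). p \<in> set b \<and> q \<in> set b) \<longleftrightarrow> flips rank i p q" for i
    using switch_iff_order_change[OF distinct_arrangement arrangement_move, of p i q] pq
      arrangement_flips[OF pq, of i] set_arrangement by simp
  then show "\<exists>!i. 1 \<le> i \<and> i \<le> int (nat (2 * n)) \<and>
      (\<exists>b\<in>switches (arrangement (i - 1)) (arrangement i). p \<in> set b \<and> q \<in> set b)"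
    using rank_once[OF pq] n_pos by simp
qed

end

definition crossing_half_size :: "'a list \<Rightarrow> 'a list \<Rightarrow> nat" where
  "crossing_half_size xs ys =
    (if \<exists>b. crossing_switch xs ys b then length (THE b. crossing_switch xs ys b) div 2 else 0)"

lemma crossing_half_size_eq:
  assumes "distinct xs" "distinct ys" "set xs = set ys" "length xs = 2 * n" "central_move n m xs ys"
  shows "crossing_half_size xs ys = m"
proof (cases "\<exists>b. crossing_switch xs ys b")
  case True
  then obtain b where b: "crossing_switch xs ys b" by blast
  then have "(THE b. crossing_switch xs ys b) = b"
    using crossing_switch_unique[OF assms(1,4)] by (intro the_equality) auto
  then show ?thesis
    using crossing_switch_length[OF assms(1,4) b assms(5)] True unfolding crossing_half_size_def by simp
next
  case False
  then show ?thesis using central_move_crossing[OF assms] unfolding crossing_half_size_def by auto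
qed

lemma central_signature_half_sizes:
  assumes "\<And>i. (\<exists>b. crossing_switch (\<pi> (i - 1)) (\<pi> i) b) \<longleftrightarrow> 0 < crossing_half_size (\<pi> (i - 1)) (\<pi> i)"
  shows "central_signature \<pi> h =
    map (\<lambda>i. crossing_half_size (\<pi> (i - 1)) (\<pi> i))
      (filter (\<lambda>i. 0 < crossing_half_size (\<pi> (i - 1)) (\<pi> i)) [1..int h])"
  unfolding central_signature_def assms[symmetric]
  by (intro map_cong refl) (auto simp: crossing_half_size_def)

section \<open>Existence: the model has the given signature\<close>

text \<open>
  The signature, read cyclically, gives the sizes of the blocks; block \<open>0\<close> crosses in the first move.
\<close>
definition block_size :: "nat list \<Rightarrow> int \<Rightarrow> int" where
  "block_size ds i = int (ds ! nat (i mod int (length ds)))"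

definition block_start :: "nat list \<Rightarrow> int \<Rightarrow> int" where
  "block_start ds i = (i div int (length ds)) * int (sum_list ds) +
     int (sum_list (take (nat (i mod int (length ds))) ds))"

lemma blocks_of_list:
  assumes "2 \<le> length ds" "\<forall>d\<in>set ds. 0 < d"
  shows "blocks (block_size ds) (block_start ds) (int (length ds)) (int (sum_list ds))"
proof
  define t where "t = int (length ds)"
  have t: "2 \<le> t" using assms unfolding t_def by simp
  show "2 \<le> int (length ds)" using t unfolding t_def .
  have r: "0 \<le> i mod t" "i mod t < t" for i using t by auto
  show "1 \<le> block_size ds i" for i
  proof -
    have "nat (i mod t) < length ds" using r[of i] unfolding t_def by linarith
    then have "0 < ds ! nat (i mod t)" using assms(2) nth_mem by blast
    then show ?thesis unfolding block_size_def t_def by simp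
  qed
  show "block_start ds (i + int (length ds)) = block_start ds i + int (sum_list ds)" for i
    using t unfolding block_start_def t_def[symmetric] by (simp add: algebra_simps)
  show "block_start ds (i + 1) = block_start ds i + block_size ds i" for i
  proof -
    define q k where "q = i div t" and "k = i mod t"
    have i: "i = t * q + k" unfolding q_def k_def by simp
    have k: "0 \<le> k" "k < t" using r unfolding k_def by auto
    show ?thesis
    proof (cases "k + 1 < t")
      case True
      have "(i + 1) div t = q" "(i + 1) mod t = k + 1"
        using int_div_pos_eq[of "i + 1" t q "k + 1"] int_mod_pos_eq[of "i + 1" t q "k + 1"] True k i by auto
      moreover have "nat (k + 1) = Suc (nat k)" "nat k < length ds" using k unfolding t_def by auto
      ultimately show ?thesis
        unfolding block_start_def block_size_def t_def[symmetric] q_def[symmetric] k_def[symmetric]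
        by (simp add: take_Suc_conv_app_nth)
    next
      case False
      then have k1: "k = t - 1" using k by simp
      have "i + 1 = t * (q + 1)" using k1 i by (simp add: algebra_simps)
      then have "(i + 1) div t = q + 1" "(i + 1) mod t = 0" using t by simp_all
      moreover have "take (Suc (nat k)) ds = ds" "nat k < length ds" using k1 t unfolding t_def by auto
      then have "sum_list (take (nat k) ds) + ds ! nat k = sum_list ds"
        using take_Suc_conv_app_nth[of "nat k" ds] by (metis sum_list.append sum_list.Cons sum_list.Nil add.right_neutral)
      ultimately show ?thesis
        unfolding block_start_def block_size_def t_def[symmetric] q_def[symmetric] k_def[symmetric]
        by (simp add: algebra_simps flip: of_nat_add)
    qed
  qed
qed

definition start_rank :: "int \<Rightarrow> int \<Rightarrow> int" where
  "start_rank n p = (if 0 < p then n + 1 - p else - n - p)"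

lemma start_rank_label:
  assumes "1 - n \<le> r" "r \<le> n"
  shows "start_rank n (label_of_height n r) = r"
  using assms unfolding start_rank_def label_of_height_def by auto

lemma label_start_rank: "p \<in> points n \<Longrightarrow> label_of_height n (start_rank n p) = p"
  unfolding start_rank_def label_of_height_def points_def by auto

lemma DC_points_eq: "DC_points ds = points (int (sum_list ds))"
proof -
  have "uminus ` {1..n} = {- n..- 1}" for n :: int by force
  then show ?thesis unfolding DC_points_def DC_start_def points_def by auto
qed

lemma length_DC_start: "length (DC_start ds) = 2 * sum_list ds"
  unfolding DC_start_def by simp

lemma distinct_DC_start: "distinct (DC_start ds)"
  unfolding DC_start_def by (auto simp: distinct_map)

lemma position_DC_start:
  assumes "p \<in> DC_points ds"
  shows "int (position (DC_start ds) p) = int (sum_list ds) + 1 - start_rank (int (sum_list ds)) p"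
proof -
  define N where "N = sum_list ds"
  have p: "1 \<le> p \<and> p \<le> int N \<or> - int N \<le> p \<and> p \<le> - 1"
    using assms unfolding DC_points_eq points_def N_def by auto
  define k where "k = (if 0 < p then nat p - 1 else nat (2 * int N + p))"
  have k: "k < length (DC_start ds)" using p unfolding k_def length_DC_start N_def[symmetric] by auto
  have "DC_start ds ! k = p"
  proof (cases "0 < p")
    case True
    then show ?thesis using p unfolding DC_start_def N_def[symmetric] k_def
      by (auto simp: nth_append nth_upto)
  next
    case False
    define j where "j = nat (int N + p)"
    have j: "k = N + j" "j < N" "int j = int N + p" using p False unfolding j_def k_def by auto
    have "rev (map uminus [1..int N]) ! j = p"
      using j by (simp add: rev_nth nth_upto)
    then show ?thesis using j unfolding DC_start_def N_def[symmetric] by (simp add: nth_append)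
  qed
  then have "position (DC_start ds) p = Suc k" using position_nth[OF distinct_DC_start k] by simp
  then show ?thesis using p unfolding k_def start_rank_def N_def[symmetric] by auto
qed

locale dc_signature =
  fixes ds :: "nat list"
  assumes len: "2 \<le> length ds" and pos: "\<forall>d\<in>set ds. 0 < d"

sublocale dc_signature \<subseteq>
  B: blocks "block_size ds" "block_start ds" "int (length ds)" "int (sum_list ds)" "1 - int (hd ds)"
  using blocks_of_list[OF len pos] .

context dc_signature
begin

lemma hd_block_size: "block_size ds 0 = int (hd ds)"
  using len unfolding block_size_def by (cases ds) auto

lemma block_size_nth: "i < length ds \<Longrightarrow> block_size ds (int i) = int (ds ! i)"
  unfolding block_size_def by simp

lemma first_crossing: "B.crossing_time 0 = 1"
proof -
  have "B.crossing_time 0 = block_size ds 0 + 1 - int (hd ds) + 2 * block_start ds 0"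
    unfolding B.crossing_time_def using B.D_Suc[of 0] by simp
  moreover have "block_start ds 0 = 0" unfolding block_start_def using len by simp
  ultimately show ?thesis using hd_block_size by simp
qed

lemma crossing_time_Suc: "B.crossing_time (i + 1) = B.crossing_time i + block_size ds i + block_size ds (i + 1)"
  unfolding B.crossing_time_def using B.D_Suc[of i] B.D_Suc[of "i + 1"] by simp

lemma crossing_time_strict: "B.crossing_time i < B.crossing_time j \<longleftrightarrow> i < j"
  using B.crossing_time_less[of i j] B.crossing_time_less[of j i] B.d_pos[of i] B.d_pos[of j]
  by (cases i j rule: linorder_cases) auto

lemma model_crossings:
  "filter (\<lambda>s. 0 < B.half_size s) [1..int (2 * sum_list ds)] =
     map (\<lambda>i. B.crossing_time (int i)) [0..<length ds]"
proof (rule sorted_distinct_set_unique)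
  show "sorted (filter (\<lambda>s. 0 < B.half_size s) [1..int (2 * sum_list ds)])"
    by (intro sorted_wrt_filter) simp
  show "distinct (filter (\<lambda>s. 0 < B.half_size s) [1..int (2 * sum_list ds)])" by simp
  show "sorted (map (\<lambda>i. B.crossing_time (int i)) [0..<length ds])"
    unfolding sorted_map sorted_wrt_iff_nth_less using crossing_time_strict by (auto intro!: less_imp_le)
  show "distinct (map (\<lambda>i. B.crossing_time (int i)) [0..<length ds])"
    using B.crossing_time_inj by (auto simp: distinct_map inj_on_def)
  show "set (filter (\<lambda>s. 0 < B.half_size s) [1..int (2 * sum_list ds)]) =
    set (map (\<lambda>i. B.crossing_time (int i)) [0..<length ds])"
  proof (intro equalityI subsetI)
    fix s assume "s \<in> set (filter (\<lambda>s. 0 < B.half_size s) [1..int (2 * sum_list ds)])"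
    then have s: "0 < B.half_size s" "1 \<le> s" "s \<le> 2 * int (sum_list ds)" by auto
    then obtain i where i: "s = B.crossing_time i" using B.half_size_cases[of s] by auto
    have "\<not> i < 0" using crossing_time_strict[of i 0] first_crossing s i by auto
    moreover have "i < int (length ds)"
      using crossing_time_strict[of i "0 + int (length ds)"] B.crossing_time_per[of 0] first_crossing s i by auto
    ultimately have "s = B.crossing_time (int (nat i))" "nat i < length ds" using i by auto
    then show "s \<in> set (map (\<lambda>i. B.crossing_time (int i)) [0..<length ds])"
      unfolding set_map by (intro image_eqI[of _ _ "nat i"]) auto
  next
    fix s assume "s \<in> set (map (\<lambda>i. B.crossing_time (int i)) [0..<length ds])"
    then obtain i where i: "i < length ds" "s = B.crossing_time (int i)" by auto
    have "1 \<le> s" using crossing_time_strict[of 0 "int i"] first_crossing i by (cases i) auto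
    moreover have "s < 1 + 2 * int (sum_list ds)"
      using crossing_time_strict[of "int i" "0 + int (length ds)"] B.crossing_time_per[of 0] first_crossing i by auto
    moreover have "0 < B.half_size s" using B.half_size_crossing[of "int i"] B.d_pos[of "int i"] i by simp
    ultimately show "s \<in> set (filter (\<lambda>s. 0 < B.half_size s) [1..int (2 * sum_list ds)])" by auto
  qed
qed

lemma arrangement_facts:
  "distinct (B.arrangement s)" "set (B.arrangement s) = DC_points ds"
  "length (B.arrangement s) = 2 * sum_list ds"
  "central_move (sum_list ds) (nat (B.half_size s)) (B.arrangement (s - 1)) (B.arrangement s)"
proof -
  have "nat (2 * int (sum_list ds)) = 2 * sum_list ds" by simp
  then show "distinct (B.arrangement s)" "set (B.arrangement s) = DC_points ds"
    "length (B.arrangement s) = 2 * sum_list ds"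
    "central_move (sum_list ds) (nat (B.half_size s)) (B.arrangement (s - 1)) (B.arrangement s)"
    using B.distinct_arrangement B.set_arrangement B.length_arrangement B.central_move_arrangement[of s]
    unfolding DC_points_eq by auto
qed

lemma arrangement_half_size:
  "crossing_half_size (B.arrangement (s - 1)) (B.arrangement s) = nat (B.half_size s)"
  by (rule crossing_half_size_eq) (use arrangement_facts in auto)

lemma arrangement_crossing:
  "(\<exists>b. crossing_switch (B.arrangement (s - 1)) (B.arrangement s) b) \<longleftrightarrow> 0 < nat (B.half_size s)"
  by (rule central_move_crossing) (use arrangement_facts in auto)

lemma rank_start: "p \<in> DC_points ds \<Longrightarrow> B.rank 0 p = start_rank (int (sum_list ds)) p"
proof -
  assume "p \<in> DC_points ds"
  then obtain i a where ia: "0 \<le> a" "a < block_size ds i" "p = B.label i a"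
    using B.points_label unfolding DC_points_eq by metis
  then show ?thesis
    using B.rank_label(2)[OF ia(1,2), of 0] B.height_range[OF ia(1,2), of 0] start_rank_label
    unfolding B.label_def by simp
qed

lemma arrangement_start: "B.arrangement 0 = DC_start ds"
proof (rule position_eqI)
  show "distinct (B.arrangement 0)" "distinct (DC_start ds)" "set (B.arrangement 0) = set (DC_start ds)"
    using arrangement_facts distinct_DC_start unfolding DC_points_def by auto
  fix p assume "p \<in> set (B.arrangement 0)"
  then have p: "p \<in> DC_points ds" using arrangement_facts by simp
  then show "position (B.arrangement 0) p = position (DC_start ds) p"
    using position_DC_start[OF p] B.position_arrangement[of p 0] rank_start[OF p] unfolding DC_points_eq by simp
qed

lemma arrangement_is_DC: "is_DC_cs_ncgen ds B.arrangement"
proof -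
  have card: "card (DC_points ds) = 2 * sum_list ds"
    using B.motion.card_P unfolding DC_points_eq by simp
  have hp: "is_halfperiod (DC_points ds) B.arrangement (2 * sum_list ds)"
    using B.arrangement_halfperiod unfolding DC_points_eq by (simp add: nat_mult_distrib)
  have al: "allowable_sequence (DC_points ds) B.arrangement"
    unfolding allowable_sequence_def using arrangement_facts B.arrangement_move hp
    by (auto simp: DC_points_def)
  have enc: "even_near_critical (DC_points ds) B.arrangement"
    unfolding even_near_critical_def using al card hp by blast
  have cs: "centrally_symmetric (DC_points ds) B.arrangement"
    unfolding centrally_symmetric_def
  proof (intro exI[of _ "sum_list ds"] conjI ballI)
    show "card (DC_points ds) = 2 * sum_list ds" by (rule card)
    fix p assume p: "p \<in> DC_points ds"
    show "\<exists>q\<in>DC_points ds. \<forall>i. position (B.arrangement i) p + position (B.arrangement i) q = 2 * sum_list ds + 1"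
    proof (intro bexI[of _ "- p"] allI)
      show m: "- p \<in> DC_points ds" using p B.motion.cj_mem unfolding DC_points_eq by simp
      fix i
      show "position (B.arrangement i) p + position (B.arrangement i) (- p) = 2 * sum_list ds + 1"
        using B.position_arrangement[of p i] B.position_arrangement[of "- p" i] B.rank_conj[of p i] p m
        unfolding DC_points_eq by linarith
    qed
  qed
  have nc: "noncentral_general_position B.arrangement"
    unfolding noncentral_general_position_def
    using central_move_switches[OF arrangement_facts(1,3,4)] by blast
  have sg: "central_signature B.arrangement (2 * sum_list ds) = ds"
  proof -
    have "central_signature B.arrangement (2 * sum_list ds) =
      map (\<lambda>s. nat (B.half_size s)) (filter (\<lambda>s. 0 < B.half_size s) [1..int (2 * sum_list ds)])"
      using central_signature_half_sizes[of B.arrangement "2 * sum_list ds"]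
      unfolding arrangement_half_size arrangement_crossing by simp
    also have "\<dots> = map (\<lambda>i. ds ! i) [0..<length ds]"
      unfolding model_crossings map_map comp_def B.half_size_crossing
      by (intro map_cong) (auto simp: block_size_nth)
    finally show ?thesis by (simp add: map_nth)
  qed
  have "0 < nat (B.half_size 1)"
    using B.half_size_crossing[of 0] first_crossing B.d_pos[of 0] by simp
  then obtain b where b: "crossing_switch (B.arrangement 0) (B.arrangement 1) b"
    using arrangement_crossing[of 1] by auto
  have "length b = 2 * nat (B.half_size 1)"
    using crossing_switch_length[OF _ _ b, of "sum_list ds"] arrangement_facts[of 0] arrangement_facts(4)[of 1]
    by simp
  also have "\<dots> = 2 * hd ds"
    using B.half_size_crossing[of 0] first_crossing hd_block_size by simp
  finally show ?thesis
    unfolding is_DC_cs_ncgen_def using enc cs nc sg arrangement_start b by auto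
qed

end

section \<open>Uniqueness: the signature determines the motion\<close>

lemma central_move_rev:
  assumes "distinct xs" "distinct ys" "set xs = set ys" "length xs = 2 * n" "central_move n m xs ys"
  shows "central_move n m (rev xs) (rev ys)"
proof -
  have l: "length ys = 2 * n" using assms by (metis distinct_card)
  have m: "m \<le> n" using assms(5) unfolding central_move_def by blast
  have "(n - m < position (rev xs) p \<and> position (rev xs) p \<le> n + m \<longrightarrow> position (rev xs) p + position (rev ys) p = 2 * n + 1) \<and>
     (position (rev xs) p \<le> n - m \<longrightarrow> position (rev ys) p \<le> n - m) \<and>
     (n + m < position (rev xs) p \<longrightarrow> n + m < position (rev ys) p) \<and>
     (position (rev xs) p \<le> n - m \<or> n + m < position (rev xs) p \<longrightarrow>
        position (rev ys) p \<le> position (rev xs) p + 1 \<and> position (rev xs) p \<le> position (rev ys) p + 1)"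
    if p: "p \<in> set xs" for p
  proof -
    have "position (rev xs) p + position xs p = 2 * n + 1" "position (rev ys) p + position ys p = 2 * n + 1"
      using position_rev[OF assms(1) p] position_rev[OF assms(2), of p] p assms(3,4) l by auto
    moreover have "(n - m < position xs p \<and> position xs p \<le> n + m \<longrightarrow> position xs p + position ys p = 2 * n + 1) \<and>
     (position xs p \<le> n - m \<longrightarrow> position ys p \<le> n - m) \<and>
     (n + m < position xs p \<longrightarrow> n + m < position ys p) \<and>
     (position xs p \<le> n - m \<or> n + m < position xs p \<longrightarrow>
        position ys p \<le> position xs p + 1 \<and> position xs p \<le> position ys p + 1)"
      using assms(5) p unfolding central_move_def by blast
    ultimately show ?thesis using m by linarith
  qed
  then show ?thesis using m unfolding central_move_def by simp
qed

context dc_signature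
begin

context
  fixes \<pi> :: "int \<Rightarrow> int list"
  assumes DC: "is_DC_cs_ncgen ds \<pi>"
begin

definition list_rank :: "int \<Rightarrow> int \<Rightarrow> int" where
  "list_rank s p = int (sum_list ds) + 1 - int (position (\<pi> s) p)"

definition list_half_size :: "int \<Rightarrow> int" where
  "list_half_size s = int (crossing_half_size (\<pi> (s - 1)) (\<pi> s))"

lemma card_DC_points: "card (DC_points ds) = 2 * sum_list ds"
  using B.motion.card_P unfolding DC_points_eq by simp

lemma DC_lists: "distinct (\<pi> s)" "set (\<pi> s) = DC_points ds" "length (\<pi> s) = 2 * sum_list ds"
  "is_move (\<pi> (s - 1)) (\<pi> s)"
proof -
  have al: "allowable_sequence (DC_points ds) \<pi>"
    using DC unfolding is_DC_cs_ncgen_def even_near_critical_def by blast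
  then show *: "distinct (\<pi> s)" "set (\<pi> s) = DC_points ds" "is_move (\<pi> (s - 1)) (\<pi> s)"
    unfolding allowable_sequence_def by blast+
  show "length (\<pi> s) = 2 * sum_list ds" using *(1,2) card_DC_points by (metis distinct_card)
qed

lemma DC_halfperiod: "is_halfperiod (DC_points ds) \<pi> (2 * sum_list ds)"
  using DC card_DC_points unfolding is_DC_cs_ncgen_def even_near_critical_def by auto

lemma DC_central_move: "central_move (sum_list ds) (crossing_half_size (\<pi> (s - 1)) (\<pi> s)) (\<pi> (s - 1)) (\<pi> s)"
proof -
  have nc: "crossing_switch (\<pi> (s - 1)) (\<pi> s) b \<or> length b = 2" if "b \<in> switches (\<pi> (s - 1)) (\<pi> s)" for b
  proof -
    have "noncentral_general_position \<pi>" using DC unfolding is_DC_cs_ncgen_def by (elim conjE)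
    then show ?thesis using that unfolding noncentral_general_position_def by (elim allE ballE) auto
  qed
  show ?thesis
  proof (cases "\<exists>b. crossing_switch (\<pi> (s - 1)) (\<pi> s) b")
    case True
    then obtain b where b: "crossing_switch (\<pi> (s - 1)) (\<pi> s) b" by blast
    have u: "b' = b" if "crossing_switch (\<pi> (s - 1)) (\<pi> s) b'" for b'
      using crossing_switch_unique[OF DC_lists(1,3) that b] .
    have "(THE b. crossing_switch (\<pi> (s - 1)) (\<pi> s) b) = b" using b u by (rule the_equality)
    then have eq: "crossing_half_size (\<pi> (s - 1)) (\<pi> s) = length b div 2"
      using True unfolding crossing_half_size_def by simp
    show ?thesis unfolding eq
      using nc u by (rule crossing_switch_central[OF DC_lists(1,3) b DC_lists(4)])
  next
    case False
    then have eq: "crossing_half_size (\<pi> (s - 1)) (\<pi> s) = 0" unfolding crossing_half_size_def by auto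
    show ?thesis unfolding eq
    proof (rule noncrossing_central[OF DC_lists(1,3) DC_lists(4)])
      show "length b = 2" if "b \<in> switches (\<pi> (s - 1)) (\<pi> s)" for b using nc[OF that] False by metis
      show "\<not> crossing_switch (\<pi> (s - 1)) (\<pi> s) b" for b using False by metis
    qed
  qed
qed

lemma DC_reversal: "\<pi> (s + 2 * int (sum_list ds)) = rev (\<pi> s)"
proof -
  have "\<forall>i. \<pi> (i + int (2 * sum_list ds)) = rev (\<pi> i)" using DC_halfperiod unfolding is_halfperiod_def by (elim conjE)
  then have "\<pi> (s + int (2 * sum_list ds)) = rev (\<pi> s)" by (rule spec)
  then show ?thesis by simp
qed

lemma DC_start_rank: "p \<in> DC_points ds \<Longrightarrow> list_rank 0 p = start_rank (int (sum_list ds)) p"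
  using DC position_DC_start[of p ds] unfolding is_DC_cs_ncgen_def list_rank_def by simp

lemma list_rank_conj:
  assumes p: "p \<in> DC_points ds"
  shows "- p \<in> DC_points ds" "list_rank s (- p) = 1 - list_rank s p"
proof -
  show m: "- p \<in> DC_points ds" using p unfolding DC_points_eq points_def by auto
  obtain q where q: "q \<in> DC_points ds" "\<And>i. position (\<pi> i) p + position (\<pi> i) q = 2 * sum_list ds + 1"
  proof -
    obtain n where n: "card (DC_points ds) = 2 * n"
      "\<forall>p\<in>DC_points ds. \<exists>q\<in>DC_points ds. \<forall>i. position (\<pi> i) p + position (\<pi> i) q = 2 * n + 1"
      using DC unfolding is_DC_cs_ncgen_def centrally_symmetric_def by blast
    then have "n = sum_list ds" using card_DC_points by simp
    then show thesis using n(2) p that by blast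
  qed
  have "list_rank 0 q = 1 - list_rank 0 p" using q(2)[of 0] unfolding list_rank_def by linarith
  then have "start_rank (int (sum_list ds)) q = 1 - start_rank (int (sum_list ds)) p"
    using DC_start_rank p q(1) by simp
  then have "q = - p" using p q(1) unfolding start_rank_def DC_points_eq points_def by (auto split: if_splits)
  then have "position (\<pi> s) p + position (\<pi> s) (- p) = 2 * sum_list ds + 1" using q(2)[of s] by simp
  then show "list_rank s (- p) = 1 - list_rank s p" unfolding list_rank_def by linarith
qed

lemma list_rank_period:
  assumes p: "p \<in> DC_points ds"
  shows "list_rank (s + 2 * int (sum_list ds)) p = 1 - list_rank s p"
  using position_rev[OF DC_lists(1), of p s] DC_lists(2,3)[of s] p DC_reversal[of s] unfolding list_rank_def by simp

lemma list_rank_bij: "bij_betw (list_rank s) (DC_points ds) {1 - int (sum_list ds)..int (sum_list ds)}"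
proof -
  have inj: "inj_on (list_rank s) (DC_points ds)"
  proof (rule inj_onI)
    fix p q assume "p \<in> DC_points ds" "q \<in> DC_points ds" "list_rank s p = list_rank s q"
    then show "p = q" using position_inj[of p "\<pi> s" q] DC_lists(2)[of s] unfolding list_rank_def by simp
  qed
  have "list_rank s ` DC_points ds = {1 - int (sum_list ds)..int (sum_list ds)}"
  proof (rule card_subset_eq)
    show "list_rank s ` DC_points ds \<subseteq> {1 - int (sum_list ds)..int (sum_list ds)}"
    proof
      fix r assume "r \<in> list_rank s ` DC_points ds"
      then obtain p where "p \<in> set (\<pi> s)" "r = list_rank s p" using DC_lists(2)[of s] by auto
      then show "r \<in> {1 - int (sum_list ds)..int (sum_list ds)}"
        using position_range[of p "\<pi> s"] DC_lists(3)[of s] unfolding list_rank_def by auto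
    qed
    show "card (list_rank s ` DC_points ds) = card {1 - int (sum_list ds)..int (sum_list ds)}"
      using card_image[OF inj] card_DC_points by simp
  qed simp
  then show ?thesis using inj unfolding bij_betw_def by simp
qed

lemma list_rank_flips:
  assumes "p \<in> DC_points ds" "q \<in> DC_points ds" "p \<noteq> q"
  shows "flips list_rank s p q \<longleftrightarrow> (\<exists>b\<in>switches (\<pi> (s - 1)) (\<pi> s). p \<in> set b \<and> q \<in> set b)"
proof -
  have ne: "position (\<pi> s) p \<noteq> position (\<pi> s) q" "position (\<pi> (s - 1)) p \<noteq> position (\<pi> (s - 1)) q"
    using position_inj assms DC_lists(2) by metis+
  show ?thesis
    unfolding switch_iff_order_change[OF DC_lists(1) DC_lists(4), of p s q, unfolded DC_lists(2), OF assms]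
    using ne unfolding flips_def list_rank_def by auto
qed

lemma DC_motion: "central_motion (DC_points ds) uminus (int (sum_list ds)) list_half_size list_rank"
proof
  show "0 < int (sum_list ds)" by (rule B.n_pos)
  show "bij_betw (list_rank s) (DC_points ds) {1 - int (sum_list ds)..int (sum_list ds)}" for s
    by (rule list_rank_bij)
  show "- p \<in> DC_points ds" if "p \<in> DC_points ds" for p using list_rank_conj that by blast
  show "list_rank s (- p) = 1 - list_rank s p" if "p \<in> DC_points ds" for s p using list_rank_conj that by blast
  show "list_rank (s + 2 * int (sum_list ds)) p = 1 - list_rank s p" if "p \<in> DC_points ds" for s p
    using list_rank_period that by blast
  show "list_half_size (s + 2 * int (sum_list ds)) = list_half_size s" for s
  proof -
    have "central_move (sum_list ds) (crossing_half_size (\<pi> (s - 1)) (\<pi> s)) (rev (\<pi> (s - 1))) (rev (\<pi> s))"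
      using central_move_rev[OF DC_lists(1,1) _ DC_lists(3) DC_central_move] DC_lists(2) by simp
    then have "crossing_half_size (rev (\<pi> (s - 1))) (rev (\<pi> s)) = crossing_half_size (\<pi> (s - 1)) (\<pi> s)"
      by (intro crossing_half_size_eq[where n = "sum_list ds"]) (use DC_lists in auto)
    moreover have "\<pi> (s + 2 * int (sum_list ds) - 1) = rev (\<pi> (s - 1))"
      using DC_reversal[of "s - 1"] by (simp add: algebra_simps)
    ultimately show ?thesis unfolding list_half_size_def DC_reversal by simp
  qed
  have cm: "list_half_size s \<le> int (sum_list ds)" for s
    using DC_central_move[of s] unfolding central_move_def list_half_size_def by simp
  then show "0 \<le> list_half_size s \<and> list_half_size s \<le> int (sum_list ds)" for s
    unfolding list_half_size_def by simp
  define N where "N = sum_list ds"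
  define m where "m = (\<lambda>s. crossing_half_size (\<pi> (s - 1)) (\<pi> s))"
  have hm: "list_half_size s = int (m s)" for s unfolding m_def list_half_size_def by simp
  have mN: "m s \<le> N" for s using cm[of s] unfolding N_def m_def list_half_size_def by simp
  have mv: "(N - m s < position (\<pi> (s - 1)) p \<and> position (\<pi> (s - 1)) p \<le> N + m s \<longrightarrow>
       position (\<pi> (s - 1)) p + position (\<pi> s) p = 2 * N + 1) \<and>
     (position (\<pi> (s - 1)) p \<le> N - m s \<longrightarrow> position (\<pi> s) p \<le> N - m s \<and>
        position (\<pi> s) p \<le> position (\<pi> (s - 1)) p + 1 \<and> position (\<pi> (s - 1)) p \<le> position (\<pi> s) p + 1)"
    if "p \<in> DC_points ds" for s p
    using DC_central_move[of s] DC_lists(2)[of "s - 1"] that unfolding central_move_def N_def m_def by auto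
  show "list_rank s p = 1 - list_rank (s - 1) p"
    if "p \<in> DC_points ds" "1 - list_half_size s \<le> list_rank (s - 1) p" "list_rank (s - 1) p \<le> list_half_size s" for s p
    using mv[OF that(1), of s] mN[of s] that(2,3)
    unfolding list_rank_def hm N_def[symmetric] by linarith
  show "list_half_size s < list_rank s p \<and> \<bar>list_rank s p - list_rank (s - 1) p\<bar> \<le> 1"
    if "p \<in> DC_points ds" "list_half_size s < list_rank (s - 1) p" for s p
    using mv[OF that(1), of s] mN[of s] that(2)
    unfolding list_rank_def hm N_def[symmetric] by linarith
  show "\<exists>!s. 1 \<le> s \<and> s \<le> 2 * int (sum_list ds) \<and> flips list_rank s p q"
    if "p \<in> DC_points ds" "q \<in> DC_points ds" "p \<noteq> q" for p q
    using DC_halfperiod that unfolding list_rank_flips[OF that] is_halfperiod_def by simp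
qed

interpretation M: central_motion "DC_points ds" uminus "int (sum_list ds)" list_half_size list_rank
  by (rule DC_motion)

lemma list_crossings:
  defines "\<tau> \<equiv> filter (\<lambda>s. 0 < list_half_size s) [1..int (2 * sum_list ds)]"
  shows "map list_half_size \<tau> = map int ds" "\<tau> = 1 # tl \<tau>"
proof -
  have iff: "(\<exists>b. crossing_switch (\<pi> (i - 1)) (\<pi> i) b) \<longleftrightarrow> 0 < crossing_half_size (\<pi> (i - 1)) (\<pi> i)" for i
    by (rule central_move_crossing[OF DC_lists(1,1) _ DC_lists(3) DC_central_move]) (use DC_lists in auto)
  have "ds = map (\<lambda>i. crossing_half_size (\<pi> (i - 1)) (\<pi> i)) \<tau>"
    using central_signature_half_sizes[of \<pi> "2 * sum_list ds", OF iff] DC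
    unfolding is_DC_cs_ncgen_def \<tau>_def list_half_size_def by simp
  then have "map int ds = map int (map (\<lambda>i. crossing_half_size (\<pi> (i - 1)) (\<pi> i)) \<tau>)" by simp
  then show "map list_half_size \<tau> = map int ds" unfolding list_half_size_def by (simp add: comp_def)
  have "0 < list_half_size 1" using DC iff[of 1] unfolding is_DC_cs_ncgen_def list_half_size_def by auto
  moreover have "[1..int (2 * sum_list ds)] = 1 # [2..int (2 * sum_list ds)]"
    using B.n_pos by (simp add: upto_rec1)
  ultimately show "\<tau> = 1 # tl \<tau>" unfolding \<tau>_def by simp
qed

text \<open>
  Each crossing determines the time and, through the signature, the size of the following one.
\<close>
lemma list_crossing_times:
  defines "\<tau> \<equiv> filter (\<lambda>s. 0 < list_half_size s) [1..int (2 * sum_list ds)]"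
  assumes "i < length ds"
  shows "\<tau> ! i = B.crossing_time (int i)" "list_half_size (\<tau> ! i) = block_size ds (int i)"
proof -
  have len_\<tau>: "length \<tau> = length ds" using list_crossings(1) unfolding \<tau>_def by (metis length_map)
  have hs: "list_half_size (\<tau> ! j) = block_size ds (int j)" if "j < length ds" for j
    using arg_cong[OF list_crossings(1), of "\<lambda>xs. xs ! j"] that len_\<tau> block_size_nth[OF that]
    unfolding \<tau>_def by simp
  then show "list_half_size (\<tau> ! i) = block_size ds (int i)" using assms(2) by blast
  have set_\<tau>: "set \<tau> = {s. 1 \<le> s \<and> s \<le> 2 * int (sum_list ds) \<and> 0 < list_half_size s}"
    unfolding \<tau>_def by auto
  have sorted: "sorted_wrt (<) \<tau>" unfolding \<tau>_def by (intro sorted_wrt_filter) simp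
  show "\<tau> ! i = B.crossing_time (int i)"
    using assms(2)
  proof (induction i)
    case 0
    then show ?case using list_crossings(2) first_crossing unfolding \<tau>_def[symmetric] by (metis nth_Cons_0 of_nat_0)
  next
    case (Suc i)
    define x where "x = \<tau> ! i"
    have x: "x = B.crossing_time (int i)" "list_half_size x = block_size ds (int i)"
      using Suc hs[of i] unfolding x_def by auto
    obtain d where d: "1 \<le> d" "list_half_size (x + list_half_size x + d) = d"
      "\<And>s. x < s \<Longrightarrow> s < x + list_half_size x + d \<Longrightarrow> list_half_size s = 0"
      using M.next_crossing[of x] x B.d_pos[of "int i"] B.d_less_n[of "int i"] by auto
    define y where "y = x + list_half_size x + d"
    have mem: "\<tau> ! j \<in> set \<tau>" if "j < length ds" for j using that len_\<tau> by simp
    have lt: "\<tau> ! j < \<tau> ! k" if "j < k" "k < length ds" for j k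
      using sorted_wrt_nth_less[OF sorted that(1)] that len_\<tau> by simp
    have "x < \<tau> ! Suc i" using lt[of i "Suc i"] Suc.prems unfolding x_def by simp
    moreover have "list_half_size (\<tau> ! Suc i) \<noteq> 0" using mem[OF Suc.prems] set_\<tau> by auto
    ultimately have "y \<le> \<tau> ! Suc i" using d(3) unfolding y_def by force
    moreover have "x \<in> set \<tau>" using mem[of i] Suc.prems unfolding x_def by simp
    moreover have "x < y" using d(1) x(2) B.d_pos[of "int i"] unfolding y_def by simp
    ultimately have "y \<in> set \<tau>" using set_\<tau> mem[OF Suc.prems] d(1,2) unfolding y_def[symmetric] by auto
    then obtain j where j: "j < length ds" "y = \<tau> ! j" using len_\<tau> by (metis in_set_conv_nth)
    have "\<not> j \<le> i" using lt[of j i] j \<open>x < y\<close> Suc.prems unfolding x_def by (cases "j = i") auto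
    then have "\<tau> ! Suc i \<le> y" using lt[of "Suc i" j] j by (cases "j = Suc i") auto
    then have e: "\<tau> ! Suc i = y" using \<open>y \<le> \<tau> ! Suc i\<close> by simp
    then have "d = block_size ds (int (Suc i))" using hs[OF Suc.prems] d(2) unfolding y_def by simp
    then show ?case using e x crossing_time_Suc[of "int i"] unfolding y_def by (simp add: add.commute)
  qed
qed

text \<open>
  Within a halfperiod the point or its conjugate enters the left half in one of the crossings, and
  from then on its trajectory is the one of the model; at time \<open>0\<close> the common height shows that the
  labels agree.
\<close>
lemma list_rank_model:
  assumes p: "p \<in> DC_points ds"
  shows "list_rank s p = B.rank s p"
proof -
  have ne: "p \<noteq> - p" using p unfolding DC_points_eq points_def by auto
  obtain x where x: "0 < x" "x \<le> 2 * int (sum_list ds)" "flips list_rank x p (- p)"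
    using M.flips_exists[OF p list_rank_conj(1)[OF p] ne, of 0] by auto
  have c: "1 - list_half_size x \<le> list_rank x p" "list_rank x p \<le> list_half_size x"
    using M.conjugate_flip_crossing[OF p x(3)] by auto
  then have "0 < list_half_size x" by linarith
  then obtain i where i: "i < length ds" "x = filter (\<lambda>s. 0 < list_half_size s) [1..int (2 * sum_list ds)] ! i"
  proof -
    have "x \<in> set (filter (\<lambda>s. 0 < list_half_size s) [1..int (2 * sum_list ds)])"
      using x \<open>0 < list_half_size x\<close> by simp
    moreover have "length (filter (\<lambda>s. 0 < list_half_size s) [1..int (2 * sum_list ds)]) = length ds"
      using arg_cong[OF list_crossings(1), of length] by simp
    ultimately show thesis using that by (metis in_set_conv_nth)
  qed
  have xi: "x = B.crossing_time (int i)" "list_half_size x = block_size ds (int i)"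
    using list_crossing_times[OF i(1)] i(2) by auto
  define q where "q = (if 1 \<le> list_rank x p then p else - p)"
  define a where "a = nat (list_rank x q - 1)"
  have q: "q \<in> DC_points ds" "list_rank x q = int a + 1" "int a < list_half_size x"
    using c list_rank_conj[OF p] p unfolding q_def a_def by auto
  have win: "list_rank (x + u) q = B.height (int i) (int a) (x + u)" if "0 \<le> u" "u < 2 * int (sum_list ds)" for u
    using M.trajectory[OF q that] B.height_left[of "int i" "x + u" "int a"] that xi by simp
  have qh: "list_rank s q = B.height (int i) (int a) s" for s
  proof -
    define k where "k = (s - x) div (2 * int (sum_list ds))"
    define u where "u = (s - x) mod (2 * int (sum_list ds))"
    have s: "s = (x + u) + 2 * int (sum_list ds) * k"
      using mult_div_mod_eq[of "2 * int (sum_list ds)" "s - x"] unfolding k_def u_def by linarith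
    have "0 \<le> u" "u < 2 * int (sum_list ds)" using B.n_pos unfolding u_def by auto
    then have "list_rank (x + u) q = B.height (int i) (int a) (x + u)" by (rule win)
    then show ?thesis
      using antiperiodic_multiple[of "\<lambda>s. list_rank s q" "2 * int (sum_list ds)" "x + u" k]
        antiperiodic_multiple[of "B.height (int i) (int a)" "2 * int (sum_list ds)" "x + u" k]
        list_rank_period[OF q(1)] B.height_per unfolding s by simp
  qed
  define j where "j = (if 1 \<le> list_rank x p then int i else int i + int (length ds))"
  have ph: "list_rank s p = B.height j (int a) s" for s
    using qh[of s] list_rank_conj(2)[OF p, of s] B.height_conj[of "int i" "int a" s]
    unfolding q_def j_def by (auto split: if_splits)
  have aj: "0 \<le> int a" "int a < block_size ds j" using q(3) xi(2) B.d_per[of "int i"] unfolding j_def by auto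
  have "B.label j (int a) = p"
    using ph[of 0] DC_start_rank[OF p] label_start_rank p unfolding B.label_def DC_points_eq by metis
  then show ?thesis using B.rank_label(2)[OF aj, of s] ph[of s] by simp
qed

lemma DC_unique: "\<pi> = B.arrangement"
proof
  fix s
  show "\<pi> s = B.arrangement s"
  proof (rule position_eqI)
    show "distinct (\<pi> s)" "distinct (B.arrangement s)" "set (\<pi> s) = set (B.arrangement s)"
      using DC_lists arrangement_facts by auto
    fix p assume "p \<in> set (\<pi> s)"
    then have p: "p \<in> DC_points ds" using DC_lists by simp
    then show "position (\<pi> s) p = position (B.arrangement s) p"
      using list_rank_model[OF p, of s] B.position_arrangement[of p s]
      unfolding list_rank_def DC_points_eq by simp
  qed
qed

end

theorem DC_cs_ncgen_eq: "DC_cs_ncgen ds = B.arrangement"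
  unfolding DC_cs_ncgen_def using arrangement_is_DC DC_unique by (rule the_equality)

end

section \<open>Geometric realizability as a condition on slopes\<close>

text \<open>
  The direction of a connecting line that is orthogonal to \<open>direction \<theta>\<close>, with the sign that makes the
  projection to \<open>direction \<phi>\<close> positive for \<open>\<phi>\<close> shortly before \<open>\<theta>\<close>.
\<close>
definition normal :: "real \<Rightarrow> real \<times> real" where
  "normal \<theta> = (sin \<theta>, - cos \<theta>)"

lemma normal_direction: "normal \<theta> \<bullet> direction \<phi> = sin (\<theta> - \<phi>)"
  unfolding normal_def direction_def by (simp add: sin_diff algebra_simps)

lemma normal_nonzero: "normal \<theta> \<noteq> 0"
  using sin_zero_abs_cos_one[of \<theta>] unfolding normal_def by (auto simp: zero_prod_def)

lemma orthogonal_to_direction: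
  assumes "x \<bullet> direction \<theta> = 0"
  shows "x = (x \<bullet> normal \<theta>) *\<^sub>R normal \<theta>"
proof -
  obtain a b where x: "x = (a, b)" by (cases x)
  have o: "a * cos \<theta> + b * sin \<theta> = 0" using assms unfolding x direction_def by simp
  have sq: "sin \<theta> * sin \<theta> + cos \<theta> * cos \<theta> = 1" using sin_cos_squared_add[of \<theta>] by (simp add: power2_eq_square)
  have "(a * sin \<theta> - b * cos \<theta>) * sin \<theta> = a * (sin \<theta> * sin \<theta> + cos \<theta> * cos \<theta>) - cos \<theta> * (a * cos \<theta> + b * sin \<theta>)"
    by algebra
  also have "\<dots> = a * 1 - cos \<theta> * 0" by (simp only: sq o)
  also have "\<dots> = a" by simp
  finally have 1: "(a * sin \<theta> - b * cos \<theta>) * sin \<theta> = a" .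
  have "(a * sin \<theta> - b * cos \<theta>) * - cos \<theta> = b * (sin \<theta> * sin \<theta> + cos \<theta> * cos \<theta>) - sin \<theta> * (a * cos \<theta> + b * sin \<theta>)"
    by algebra
  also have "\<dots> = b * 1 - sin \<theta> * 0" by (simp only: sq o)
  also have "\<dots> = b" by simp
  finally have 2: "(a * sin \<theta> - b * cos \<theta>) * - cos \<theta> = b" .
  have "x \<bullet> normal \<theta> = a * sin \<theta> - b * cos \<theta>" unfolding x normal_def by simp
  then show ?thesis using 1 2 unfolding x normal_def scaleR_Pair real_scaleR_def by simp
qed

lemma sin_add_multiple_pi: "sin (y + of_int m * pi) = (if even m then sin y else - sin y)"
  using sin_npi_int[of m] cos_npi_int[of m] by (simp add: sin_add mult.commute)

lemma sin_sign:
  fixes m :: int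
  assumes "of_int m * pi < x" "x < (of_int m + 1) * pi"
  shows "if even m then 0 < sin x else sin x < 0"
proof -
  have "0 < sin (x - of_int m * pi)" using assms by (intro sin_gt_zero) (auto simp: algebra_simps)
  then show ?thesis using sin_add_multiple_pi[of "x - of_int m * pi" m] by (auto split: if_splits)
qed

context blocks
begin

text \<open>
  \<open>V i a\<close> is the vector from the centre to the point \<open>(i, a)\<close>, and \<open>\<theta> \<tau>\<close> is the angle at which move \<open>\<tau>\<close> takes
  place.
\<close>
definition slope_realization :: "(int \<Rightarrow> int \<Rightarrow> real \<times> real) \<Rightarrow> (int \<Rightarrow> real) \<Rightarrow> bool" where
  "slope_realization V \<theta> \<longleftrightarrow> strict_mono \<theta> \<and> (\<forall>s. \<theta> (s + 2 * n) = \<theta> s + pi) \<and>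
     (\<forall>i a. V (i + t) a = - V i a) \<and>
     (\<forall>i a j b \<tau>. meets i a j b \<tau> \<longrightarrow> (\<exists>r>0. V i a - V j b = r *\<^sub>R normal (\<theta> \<tau>)))"

lemma angle_shift:
  assumes "\<And>s. \<theta> (s + 2 * n) = \<theta> s + pi"
  shows "\<theta> (s + 2 * n * k) = \<theta> s + of_int k * pi"
  using arithmetic_shift[of \<theta> "2 * n" pi s k] assms by simp

lemma label_eq_iff:
  assumes "0 \<le> a" "a < d i" "0 \<le> b" "b < d j"
  shows "label i a = label j b \<longleftrightarrow> a = b \<and> 2 * t dvd j - i"
proof -
  have "label i a = label j b \<longleftrightarrow> height i a 0 = height j b 0"
  proof
    assume "label i a = label j b"
    then show "height i a 0 = height j b 0"
      using rank_label(2)[OF assms(1,2), of 0] rank_label(2)[OF assms(3,4), of 0] by simp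
  next
    assume "height i a 0 = height j b 0"
    then show "label i a = label j b" unfolding label_def by simp
  qed
  then show ?thesis using height_eq_iff[OF assms] by simp
qed

definition point_meets :: "int \<Rightarrow> int \<Rightarrow> int \<Rightarrow> bool" where
  "point_meets p q \<tau> \<longleftrightarrow> (\<exists>i a j b. p = label i a \<and> q = label j b \<and> meets i a j b \<tau>)"

lemma point_meets_exists:
  assumes "p \<in> points n" "q \<in> points n" "p \<noteq> q"
  obtains \<tau> where "point_meets p q \<tau> \<or> point_meets q p \<tau>"
proof -
  obtain i a where ia: "0 \<le> a" "a < d i" "p = label i a" by (rule points_label[OF assms(1)])
  obtain j b where jb: "0 \<le> b" "b < d j" "q = label j b" by (rule points_label[OF assms(2)])
  have "\<not> (a = b \<and> 2 * t dvd j - i)" using label_eq_iff[of a i b j] ia jb assms(3) by auto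
  then obtain k \<tau> where m: "meets i a (j + t * (2 * k)) b \<tau> \<or> meets j b (i + t * (2 * k)) a \<tau>"
    by (rule meets_exists[OF ia(1,2) jb(1,2)])
  have l: "label (j + t * (2 * k)) b = q" "label (i + t * (2 * k)) a = p"
    using label_shift[of j "2 * k" b] label_shift[of i "2 * k" a] ia jb by simp_all
  from m show thesis
  proof
    assume "meets i a (j + t * (2 * k)) b \<tau>"
    then have "point_meets p q \<tau>" unfolding point_meets_def using ia(3) l(1) by blast
    then show thesis using that by blast
  next
    assume "meets j b (i + t * (2 * k)) a \<tau>"
    then have "point_meets q p \<tau>" unfolding point_meets_def using jb(3) l(2) by blast
    then show thesis using that by blast
  qed
qed

lemma point_meets_order:
  assumes "point_meets p q \<tau>"
  shows "rank s p < rank s q \<longleftrightarrow> odd ((s - \<tau>) div (2 * n))" "rank s p \<noteq> rank s q"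
    "p \<in> points n" "q \<in> points n" "p \<noteq> q"
proof -
  obtain i a j b where m: "p = label i a" "q = label j b" "meets i a j b \<tau>"
    using assms unfolding point_meets_def by blast
  then have v: "0 \<le> a" "a < d i" "0 \<le> b" "b < d j" unfolding meets_def by auto
  note r = rank_label(2)[OF v(1,2), of s] rank_label(2)[OF v(3,4), of s]
  show "rank s p < rank s q \<longleftrightarrow> odd ((s - \<tau>) div (2 * n))" "rank s p \<noteq> rank s q"
    using meets_order[OF m(3), of s] r unfolding m by auto
  then show "p \<noteq> q" by auto
  show "p \<in> points n" "q \<in> points n" using rank_label(1) v m by auto
qed

lemma point_meets_flips:
  assumes "point_meets p q \<tau>"
  shows "flips rank s p q \<longleftrightarrow> 2 * n dvd s - \<tau>"
proof -
  have e: "s - 1 - \<tau> = (s - \<tau>) - 1" by simp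
  show ?thesis unfolding flips_def point_meets_order(1)[OF assms] e
    by (rule odd_div_step) (use n_pos in simp)
qed

text \<open>
  The projection of \<open>normal (\<theta> \<tau>)\<close> to \<open>direction \<phi>\<close> is \<open>sin (\<theta> \<tau> - \<phi>)\<close>. It changes sign precisely at the angles
  \<open>\<theta> (\<tau> + 2 n k)\<close>, hence at the times at which the two points meet.
\<close>
theorem slope_realization_realizable:
  assumes "slope_realization V \<theta>"
  shows "geometrically_realizable (points n) arrangement"
proof -
  have mono: "strict_mono \<theta>" and per: "\<And>s. \<theta> (s + 2 * n) = \<theta> s + pi"
    and anti: "\<And>i a. V (i + t) a = - V i a"
    and meet: "\<And>i a j b \<tau>. meets i a j b \<tau> \<Longrightarrow> \<exists>r>0. V i a - V j b = r *\<^sub>R normal (\<theta> \<tau>)"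
    using assms unfolding slope_realization_def by blast+
  note shift = angle_shift[of \<theta>, OF per]
  have V_shift: "V (i + t * (2 * k)) a = V i a" for i a k
    using involution_shift[of "\<lambda>i. V i a" t uminus i "2 * k"] anti by simp
  define f where "f = (\<lambda>p. case inv_into indices (\<lambda>(i, a). label i a) p of (i, a) \<Rightarrow> V i a)"
  have f_label: "f (label i a) = V i a" if v: "0 \<le> a" "a < d i" for i a
  proof -
    obtain j b where jb: "inv_into indices (\<lambda>(i, a). label i a) (label i a) = (j, b)" by fastforce
    have mem: "label i a \<in> (\<lambda>(i, a). label i a) ` indices"
      using rank_label(1)[OF v] bij_betw_imp_surj_on[OF label_bij] by auto
    then have "(j, b) \<in> indices" "label j b = label i a"
      using inv_into_into[OF mem] f_inv_into_f[OF mem] unfolding jb by simp_all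
    then have "a = b" "2 * t dvd j - i"
      using label_eq_iff[of a i b j] v unfolding indices_def by auto
    then obtain k where "j - i = 2 * t * k" by blast
    then have "j = i + t * (2 * k)" by simp
    then have "V j b = V i a" using V_shift \<open>a = b\<close> by simp
    then show ?thesis unfolding f_def jb by simp
  qed
  have pm: "\<exists>r>0. f p - f q = r *\<^sub>R normal (\<theta> \<tau>)" if "point_meets p q \<tau>" for p q \<tau>
  proof -
    obtain i a j b where m: "p = label i a" "q = label j b" "meets i a j b \<tau>"
      using \<open>point_meets p q \<tau>\<close> unfolding point_meets_def by blast
    then show ?thesis using meet[OF m(3)] f_label unfolding meets_def by auto
  qed
  have crit: "(f p - f q) \<bullet> direction \<phi> = 0 \<longleftrightarrow> (\<exists>k. \<phi> = \<theta> (\<tau> + 2 * n * k))" if pq: "point_meets p q \<tau>" for p q \<tau> \<phi>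
  proof -
    obtain r where r: "0 < r" "f p - f q = r *\<^sub>R normal (\<theta> \<tau>)" using pm[OF pq] by blast
    have "(f p - f q) \<bullet> direction \<phi> = r * sin (\<theta> \<tau> - \<phi>)" unfolding r(2) by (simp add: normal_direction)
    then have "(f p - f q) \<bullet> direction \<phi> = 0 \<longleftrightarrow> (\<exists>k::int. \<theta> \<tau> - \<phi> = of_int k * pi)"
      using r(1) sin_zero_iff_int2[of "\<theta> \<tau> - \<phi>"] by simp
    also have "\<dots> \<longleftrightarrow> (\<exists>k. \<phi> = \<theta> (\<tau> + 2 * n * k))"
    proof
      assume "\<exists>k::int. \<theta> \<tau> - \<phi> = of_int k * pi"
      then obtain k :: int where "\<theta> \<tau> - \<phi> = of_int k * pi" by blast
      then have "\<phi> = \<theta> (\<tau> + 2 * n * (- k))" unfolding shift by simp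
      then show "\<exists>k. \<phi> = \<theta> (\<tau> + 2 * n * k)" by blast
    next
      assume "\<exists>k. \<phi> = \<theta> (\<tau> + 2 * n * k)"
      then obtain k where "\<phi> = \<theta> (\<tau> + 2 * n * k)" by blast
      then have "\<theta> \<tau> - \<phi> = of_int (- k) * pi" unfolding shift by simp
      then show "\<exists>k::int. \<theta> \<tau> - \<phi> = of_int k * pi" by blast
    qed
    finally show ?thesis .
  qed
  have inj: "inj_on f (points n)"
  proof (rule inj_onI, rule ccontr)
    fix p q assume pq: "p \<in> points n" "q \<in> points n" "f p = f q" "p \<noteq> q"
    obtain \<tau> where "point_meets p q \<tau> \<or> point_meets q p \<tau>" using point_meets_exists[OF pq(1,2,4)] .
    then have "\<exists>r>0. 0 = r *\<^sub>R normal (\<theta> \<tau>)"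
    proof
      assume "point_meets p q \<tau>"
      from pm[OF this] show ?thesis using pq(3) by simp
    next
      assume "point_meets q p \<tau>"
      from pm[OF this] show ?thesis using pq(3) by simp
    qed
    then show False using normal_nonzero[of "\<theta> \<tau>"] by simp
  qed
  define P where "P = f ` points n"
  have "circular_sequence P (\<lambda>s. map f (arrangement s))"
    unfolding circular_sequence_def
  proof (intro exI[of _ \<theta>] conjI allI impI)
    show "strict_mono \<theta>" by (rule mono)
    show "range \<theta> = critical_angles P"
    proof (intro equalityI subsetI)
      fix \<phi> assume "\<phi> \<in> range \<theta>"
      then obtain s where s: "\<phi> = \<theta> s" by blast
      obtain p q where pq: "p \<in> points n" "q \<in> points n" "p \<noteq> q" "flips rank s p q" using every_move_flips .
      obtain \<tau> where "point_meets p q \<tau> \<or> point_meets q p \<tau>" using point_meets_exists[OF pq(1,2,3)] .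
      moreover have "flips rank s q p" using motion.flips_commute[OF pq(1,2,3)] pq(4) by simp
      ultimately obtain x y where xy: "x \<in> points n" "y \<in> points n" "x \<noteq> y" "point_meets x y \<tau>" "flips rank s x y"
        using pq that[of p q] that[of q p] by blast
      then have "2 * n dvd s - \<tau>" using point_meets_flips[OF xy(4)] by simp
      then obtain k where "s - \<tau> = 2 * n * k" by (rule dvdE)
      then have "s = \<tau> + 2 * n * k" by simp
      then have "(f x - f y) \<bullet> direction \<phi> = 0" using crit[OF xy(4)] s by blast
      moreover have "f y \<noteq> f x" using inj_onD[OF inj, of y x] xy by auto
      moreover have "f x \<in> P" "f y \<in> P" using xy unfolding P_def by auto
      ultimately show "\<phi> \<in> critical_angles P" unfolding critical_angles_def by blast
    next
      fix \<phi> assume "\<phi> \<in> critical_angles P"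
      then obtain p q where pq: "p \<in> points n" "q \<in> points n" "f p \<noteq> f q" "(f q - f p) \<bullet> direction \<phi> = 0"
        unfolding critical_angles_def P_def by auto
      then have ne: "p \<noteq> q" by auto
      obtain \<tau> where "point_meets p q \<tau> \<or> point_meets q p \<tau>" using point_meets_exists[OF pq(1,2) ne] .
      moreover have "(f p - f q) \<bullet> direction \<phi> = 0" using pq(4) by (simp add: inner_diff_left)
      ultimately have "\<exists>k. \<phi> = \<theta> (\<tau> + 2 * n * k)"
        using crit[of p q \<tau> \<phi>] crit[of q p \<tau> \<phi>] pq(4) by blast
      then show "\<phi> \<in> range \<theta>" by auto
    qed
    fix s
    show "set (map f (arrangement s)) = P" unfolding P_def using set_arrangement by simp
    fix \<phi> assume \<phi>: "\<theta> s < \<phi> \<and> \<phi> < \<theta> (s + 1)"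
    show "sorted_wrt (\<lambda>p q. p \<bullet> direction \<phi> < q \<bullet> direction \<phi>) (map f (arrangement s))"
      unfolding sorted_wrt_iff_nth_less
    proof (intro allI impI)
      fix k l assume kl: "k < l" "l < length (map f (arrangement s))"
      define p q where "p = arrangement s ! k" and "q = arrangement s ! l"
      have pq: "p \<in> points n" "q \<in> points n" "rank s q < rank s p"
        using arrangement_nth[of k s] arrangement_nth[of l s] kl length_arrangement unfolding p_def q_def by auto
      have sgn: "if even ((s - \<tau>) div (2 * n)) then 0 < sin (\<phi> - \<theta> \<tau>) else sin (\<phi> - \<theta> \<tau>) < 0" for \<tau>
      proof (rule sin_sign)
        define m where "m = (s - \<tau>) div (2 * n)"
        have sm: "s = \<tau> + 2 * n * m + (s - \<tau>) mod (2 * n)" unfolding m_def using mult_div_mod_eq[of "2 * n" "s - \<tau>"] by linarith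
        have "0 \<le> (s - \<tau>) mod (2 * n)" "(s - \<tau>) mod (2 * n) < 2 * n" using n_pos by auto
        then have "\<tau> + 2 * n * m \<le> s" "s + 1 \<le> \<tau> + 2 * n * (m + 1)"
          using sm by (simp_all add: algebra_simps)
        then have "\<theta> (\<tau> + 2 * n * m) \<le> \<theta> s" "\<theta> (s + 1) \<le> \<theta> (\<tau> + 2 * n * (m + 1))"
          using strict_mono_less_eq[OF mono] by blast+
        then show "real_of_int ((s - \<tau>) div (2 * n)) * pi < \<phi> - \<theta> \<tau>"
          "\<phi> - \<theta> \<tau> < (real_of_int ((s - \<tau>) div (2 * n)) + 1) * pi"
          using \<phi> unfolding shift m_def by auto
      qed
      have "p \<noteq> q" using pq by auto
      then obtain \<tau> where "point_meets p q \<tau> \<or> point_meets q p \<tau>"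
        by (rule point_meets_exists[OF pq(1,2)])
      then have "f p \<bullet> direction \<phi> < f q \<bullet> direction \<phi>"
      proof
        assume m: "point_meets p q \<tau>"
        obtain r where r: "0 < r" "f p - f q = r *\<^sub>R normal (\<theta> \<tau>)" using pm[OF m] by blast
        have "even ((s - \<tau>) div (2 * n))" using point_meets_order(1)[OF m, of s] pq(3) by auto
        then have "0 < sin (\<phi> - \<theta> \<tau>)" using sgn[of \<tau>] by simp
        moreover have "(f p - f q) \<bullet> direction \<phi> = - (r * sin (\<phi> - \<theta> \<tau>))"
          unfolding r(2) using sin_minus[of "\<phi> - \<theta> \<tau>"] by (simp add: normal_direction)
        ultimately have "(f p - f q) \<bullet> direction \<phi> < 0" using r(1) by simp
        then show ?thesis by (simp add: inner_diff_left)
      next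
        assume m: "point_meets q p \<tau>"
        obtain r where r: "0 < r" "f q - f p = r *\<^sub>R normal (\<theta> \<tau>)" using pm[OF m] by blast
        have "odd ((s - \<tau>) div (2 * n))" using point_meets_order(1)[OF m, of s] pq(3) by auto
        then have "sin (\<phi> - \<theta> \<tau>) < 0" using sgn[of \<tau>] by simp
        moreover have "(f q - f p) \<bullet> direction \<phi> = - (r * sin (\<phi> - \<theta> \<tau>))"
          unfolding r(2) using sin_minus[of "\<phi> - \<theta> \<tau>"] by (simp add: normal_direction)
        ultimately have "0 < (f q - f p) \<bullet> direction \<phi>" using r(1) by (simp add: mult_pos_neg)
        then show ?thesis by (simp add: inner_diff_left)
      qed
      then show "map f (arrangement s) ! k \<bullet> direction \<phi> < map f (arrangement s) ! l \<bullet> direction \<phi>"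
        using kl unfolding p_def q_def by simp
    qed
  qed
  moreover have "finite P" unfolding P_def points_def by simp
  moreover have "combinatorially_equivalent (points n) arrangement P (\<lambda>s. map f (arrangement s))"
    unfolding combinatorially_equivalent_def
  proof (intro exI[of _ f] exI[of _ 0] conjI allI)
    show "bij_betw f (points n) P" using inj unfolding bij_betw_def P_def by simp
  qed simp
  ultimately show ?thesis unfolding geometrically_realizable_def by blast
qed

end

lemma tendsto_projection: "((\<lambda>\<phi>. x \<bullet> direction \<phi>) \<longlongrightarrow> x \<bullet> direction a) (at a within S)"
  unfolding direction_def by (intro tendsto_intros)

lemma projection_sign_change:
  assumes "l < c" "c < u"
    and "\<And>\<phi>. l < \<phi> \<Longrightarrow> \<phi> < c \<Longrightarrow> 0 < x \<bullet> direction \<phi>"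
    and "\<And>\<phi>. c < \<phi> \<Longrightarrow> \<phi> < u \<Longrightarrow> x \<bullet> direction \<phi> < 0"
  shows "\<exists>r>0. x = r *\<^sub>R normal c"
proof -
  have "0 \<le> x \<bullet> direction c"
  proof (rule tendsto_lowerbound[OF tendsto_projection])
    show "\<forall>\<^sub>F \<phi> in at_left c. 0 \<le> x \<bullet> direction \<phi>"
      using eventually_at_left_real[OF assms(1)] by (rule eventually_mono) (use assms(3) in \<open>auto intro: less_imp_le\<close>)
  qed simp
  moreover have "x \<bullet> direction c \<le> 0"
  proof (rule tendsto_upperbound[OF tendsto_projection])
    show "\<forall>\<^sub>F \<phi> in at_right c. x \<bullet> direction \<phi> \<le> 0"
      using eventually_at_right_real[OF assms(2)] by (rule eventually_mono) (use assms(4) in \<open>auto intro: less_imp_le\<close>)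
  qed simp
  ultimately have "x \<bullet> direction c = 0" by simp
  then have x: "x = (x \<bullet> normal c) *\<^sub>R normal c" by (rule orthogonal_to_direction)
  define \<phi> where "\<phi> = max ((l + c) / 2) (c - 1)"
  have "l < (l + c) / 2" "(l + c) / 2 < c" using assms(1) by (simp_all add: field_simps)
  then have \<phi>: "l < \<phi>" "\<phi> < c" "c - \<phi> \<le> 1" unfolding \<phi>_def by (auto simp: less_max_iff_disj)
  then have "0 < sin (c - \<phi>)" using pi_gt3 by (intro sin_gt_zero) auto
  moreover have "x \<bullet> direction \<phi> = (x \<bullet> normal c) * sin (c - \<phi>)"
    using arg_cong[OF x, of "\<lambda>y. y \<bullet> direction \<phi>"] by (simp add: normal_direction)
  ultimately have "0 < x \<bullet> normal c" using assms(3)[OF \<phi>(1,2)] by (simp add: zero_less_mult_iff)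
  then show ?thesis using x by blast
qed

context blocks
begin

text \<open>
  A pair that switches in move \<open>s\<close> switches again when the angle has grown by \<open>\<pi>\<close> and not before, so that \<open>\<theta> (s + 2 n)\<close> is \<open>\<theta> s + \<pi>\<close>.
  Conjugate pairs switch in the same move, in opposite order. Therefore the differences of points with
  their conjugates satisfy the same conditions as the points, and they are centrally symmetric.
\<close>
theorem realizable_slope_realization:
  assumes "geometrically_realizable (points n) arrangement"
  obtains V \<theta> where "slope_realization V \<theta>"
proof -
  obtain P \<sigma> where circ: "circular_sequence P \<sigma>" and eqv: "combinatorially_equivalent (points n) arrangement P \<sigma>"
    using assms unfolding geometrically_realizable_def by blast
  obtain f m where f: "bij_betw f (points n) P" and \<sigma>: "\<And>i. \<sigma> (i + m) = map f (arrangement i)"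
    using eqv unfolding combinatorially_equivalent_def by blast
  obtain \<theta>' where mono': "strict_mono \<theta>'" and crit': "range \<theta>' = critical_angles P"
    and sorted': "\<And>i \<phi>. \<theta>' i < \<phi> \<Longrightarrow> \<phi> < \<theta>' (i + 1) \<Longrightarrow>
      sorted_wrt (\<lambda>p q. p \<bullet> direction \<phi> < q \<bullet> direction \<phi>) (\<sigma> i)"
    using circ unfolding circular_sequence_def by blast
  define \<theta> where "\<theta> = (\<lambda>s. \<theta>' (s + m))"
  have mono: "strict_mono \<theta>" using mono' unfolding \<theta>_def strict_mono_def by simp
  have less: "\<theta> x < \<theta> y \<longleftrightarrow> x < y" "\<theta> x \<le> \<theta> y \<longleftrightarrow> x \<le> y" for x y
    using strict_mono_less[OF mono] strict_mono_less_eq[OF mono] by auto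
  have before: "0 < (f q - f p) \<bullet> direction \<phi>"
    if pq: "p \<in> points n" "q \<in> points n" "rank s q < rank s p" and \<phi>: "\<theta> s < \<phi>" "\<phi> < \<theta> (s + 1)" for p q s \<phi>
  proof -
    obtain k where k: "k < nat (2 * n)" "arrangement s ! k = p"
      using pq(1) set_arrangement[of s] length_arrangement[of s] by (metis in_set_conv_nth)
    obtain l where l: "l < nat (2 * n)" "arrangement s ! l = q"
      using pq(2) set_arrangement[of s] length_arrangement[of s] by (metis in_set_conv_nth)
    have kl: "k < l" using arrangement_nth[OF k(1), of s] arrangement_nth[OF l(1), of s] k(2) l(2) pq(3) by simp
    have eq: "s + m + 1 = s + 1 + m" by simp
    then have "sorted_wrt (\<lambda>p q. p \<bullet> direction \<phi> < q \<bullet> direction \<phi>) (\<sigma> (s + m))"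
      using sorted'[of "s + m" \<phi>, unfolded eq] \<phi> unfolding \<theta>_def by simp
    then have "f p \<bullet> direction \<phi> < f q \<bullet> direction \<phi>"
      using sorted_wrt_nth_less[OF _ kl, of "\<lambda>p q. p \<bullet> direction \<phi> < q \<bullet> direction \<phi>" "map f (arrangement s)"]
        k l length_arrangement[of s] unfolding \<sigma> by simp
    then show ?thesis by (simp add: inner_diff_left)
  qed
  have swap: "\<exists>r>0. f q - f p = r *\<^sub>R normal (\<theta> s)"
    if pq: "p \<in> points n" "q \<in> points n" "rank (s - 1) q < rank (s - 1) p" "rank s p < rank s q" for p q s
  proof (rule projection_sign_change)
    show "\<theta> (s - 1) < \<theta> s" "\<theta> s < \<theta> (s + 1)" unfolding less by simp_all
    show "0 < (f q - f p) \<bullet> direction \<phi>" if "\<theta> (s - 1) < \<phi>" "\<phi> < \<theta> s" for \<phi>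
      using before[OF pq(1,2,3), of \<phi>] that by simp
    show "(f q - f p) \<bullet> direction \<phi> < 0" if "\<theta> s < \<phi>" "\<phi> < \<theta> (s + 1)" for \<phi>
      using before[OF pq(2,1,4), of \<phi>] that by (simp add: inner_diff_left)
  qed
  have per: "\<theta> (s + 2 * n) = \<theta> s + pi" for s
  proof -
    obtain x y where xy: "x \<in> points n" "y \<in> points n" "x \<noteq> y" "flips rank s x y" using every_move_flips .
    have "rank s x \<noteq> rank s y" "rank (s - 1) x \<noteq> rank (s - 1) y" using rank_inj xy by blast+
    then consider "rank (s - 1) y < rank (s - 1) x" "rank s x < rank s y"
      | "rank (s - 1) x < rank (s - 1) y" "rank s y < rank s x"
      using xy(4) unfolding flips_def by linarith
    then obtain p q where pq: "p \<in> points n" "q \<in> points n" "p \<noteq> q"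
      "rank (s - 1) q < rank (s - 1) p" "rank s p < rank s q"
      using xy(1-3) by cases auto
    obtain r where r: "0 < r" "f q - f p = r *\<^sub>R normal (\<theta> s)" using swap[OF pq(1,2,4,5)] by blast
    have F: "(f q - f p) \<bullet> direction \<phi> = r * sin (\<theta> s - \<phi>)" for \<phi>
      unfolding r(2) by (simp add: normal_direction)
    have "\<theta> s + pi \<in> critical_angles P"
      unfolding critical_angles_def
    proof (intro CollectI bexI conjI)
      show "f p \<noteq> f q" using r normal_nonzero by auto
      show "(f q - f p) \<bullet> direction (\<theta> s + pi) = 0" unfolding F by simp
      show "f p \<in> P" "f q \<in> P" using pq f bij_betwE by blast+
    qed
    then obtain v where v: "\<theta> s + pi = \<theta>' v" unfolding crit'[symmetric] by blast
    define s' where "s' = v - m"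
    have s': "\<theta> s' = \<theta> s + pi" using v unfolding s'_def \<theta>_def by simp
    have "s < s'" using less(1)[of s s'] s' pi_gt_zero by simp
    have ne: "rank u p \<noteq> rank u q" for u using rank_inj pq by blast
    have mid: "rank u p < rank u q" if u: "s \<le> u" "u < s'" for u
    proof (rule ccontr)
      assume "\<not> ?thesis"
      then have o: "rank u q < rank u p" using ne[of u] by simp
      define \<phi> where "\<phi> = (\<theta> u + \<theta> (u + 1)) / 2"
      have \<phi>: "\<theta> u < \<phi>" "\<phi> < \<theta> (u + 1)" using less(1)[of u "u + 1"] unfolding \<phi>_def by simp_all
      moreover have "\<theta> s \<le> \<theta> u" "\<theta> (u + 1) \<le> \<theta> s + pi" using u s' less(2)[of s u] less(2)[of "u + 1" s'] by auto
      ultimately have "0 < sin (\<phi> - \<theta> s)" by (intro sin_gt_zero) auto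
      then have "(f q - f p) \<bullet> direction \<phi> < 0"
        unfolding F using r(1) sin_minus[of "\<phi> - \<theta> s"] by (simp add: mult_pos_neg)
      then show False using before[OF pq(1,2) o \<phi>] by simp
    qed
    have last: "rank s' q < rank s' p"
    proof (rule ccontr)
      assume "\<not> ?thesis"
      then have o: "rank s' p < rank s' q" using ne[of s'] by simp
      define \<phi> where "\<phi> = min ((\<theta> s' + \<theta> (s' + 1)) / 2) (\<theta> s' + 1)"
      have "\<theta> s' < (\<theta> s' + \<theta> (s' + 1)) / 2" "(\<theta> s' + \<theta> (s' + 1)) / 2 < \<theta> (s' + 1)"
        using less(1)[of s' "s' + 1"] by (simp_all add: field_simps)
      then have \<phi>: "\<theta> s' < \<phi>" "\<phi> < \<theta> (s' + 1)" unfolding \<phi>_def by (auto simp: min_less_iff_disj)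
      have "\<phi> \<le> \<theta> s' + 1" unfolding \<phi>_def by simp
      then have "0 < sin (\<phi> - \<theta> s')" using \<phi> pi_gt3 by (intro sin_gt_zero) auto
      moreover have "sin (\<theta> s - \<phi>) = sin (\<phi> - \<theta> s')"
        unfolding s' using sin_diff[of "\<phi> - \<theta> s" pi] sin_minus[of "\<phi> - \<theta> s"] by (simp add: algebra_simps)
      ultimately have "0 < (f q - f p) \<bullet> direction \<phi>" unfolding F using r(1) by simp
      then show False using before[OF pq(2,1) o \<phi>] by (simp add: inner_diff_left)
    qed
    have fl: "flips rank s p q" "flips rank s' p q"
      using pq mid[of "s' - 1"] last \<open>s < s'\<close> unfolding flips_def by auto
    have "2 * n dvd s' - s" using motion.flips_dvd[OF pq(1-3) fl(2,1)] .
    then have "s + 2 * n \<le> s'" using zdvd_imp_le[of "2 * n" "s' - s"] \<open>s < s'\<close> by simp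
    moreover have "\<not> s + 2 * n < s'"
    proof
      assume "s + 2 * n < s'"
      then have "\<not> flips rank (s + 2 * n) p q"
        using mid[of "s + 2 * n"] mid[of "s + 2 * n - 1"] n_pos unfolding flips_def by auto
      then show False using motion.flips_shift[OF pq(1-3)] fl(1) by simp
    qed
    ultimately have "s' = s + 2 * n" by simp
    then show ?thesis using s' by simp
  qed
  define V where "V = (\<lambda>i a. (1 / 2) *\<^sub>R (f (label i a) - f (label (i + t) a)))"
  have "slope_realization V \<theta>"
    unfolding slope_realization_def
  proof (intro conjI allI impI)
    show "strict_mono \<theta>" by (rule mono)
    show "\<theta> (s + 2 * n) = \<theta> s + pi" for s by (rule per)
    show "V (i + t) a = - V i a" for i a
    proof -
      have "label (i + t + t) a = label i a" using label_shift[of i 2 a] by (simp add: algebra_simps)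
      then show ?thesis unfolding V_def by (simp add: algebra_simps)
    qed
    fix i a j b \<tau> assume m: "meets i a j b \<tau>"
    then have v: "0 \<le> a" "a < d i" "0 \<le> b" "b < d j" unfolding meets_def by auto
    define p q where "p = label i a" and "q = label j b"
    have pm: "point_meets p q \<tau>" using m unfolding point_meets_def p_def q_def by blast
    have pq: "p \<in> points n" "q \<in> points n" "- p \<in> points n" "- q \<in> points n"
      using rank_label(1) v motion.cj_mem unfolding p_def q_def by auto
    have "(\<tau> - 1 - \<tau>) div (2 * n) = - 1"
      using n_pos by (intro int_div_pos_eq[of _ "2 * n" _ "2 * n - 1"]) auto
    then have "rank (\<tau> - 1) p < rank (\<tau> - 1) q" "\<not> rank \<tau> p < rank \<tau> q"
      using point_meets_order(1)[OF pm, of "\<tau> - 1"] point_meets_order(1)[OF pm, of \<tau>] by simp_all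
    then have o: "rank (\<tau> - 1) p < rank (\<tau> - 1) q" "rank \<tau> q < rank \<tau> p"
      using point_meets_order(2)[OF pm, of \<tau>] by auto
    obtain r where r: "0 < r" "f p - f q = r *\<^sub>R normal (\<theta> \<tau>)" using swap[OF pq(2,1) o] by blast
    have "rank (\<tau> - 1) (- q) < rank (\<tau> - 1) (- p)" "rank \<tau> (- p) < rank \<tau> (- q)"
      using o rank_conj pq by simp_all
    then obtain r' where r': "0 < r'" "f (- q) - f (- p) = r' *\<^sub>R normal (\<theta> \<tau>)"
      using swap[OF pq(3,4)] by blast
    have "V i a - V j b = (1 / 2) *\<^sub>R ((f p - f q) + (f (- q) - f (- p)))"
      unfolding V_def label_conj p_def q_def by (simp add: algebra_simps)
    also have "\<dots> = ((r + r') / 2) *\<^sub>R normal (\<theta> \<tau>)"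
      unfolding r(2) r'(2) by (simp add: algebra_simps add_divide_distrib)
    finally show "\<exists>r>0. V i a - V j b = r *\<^sub>R normal (\<theta> \<tau>)"
      using r(1) r'(1) by (intro exI[of _ "(r + r') / 2"]) simp
  qed
  then show thesis by (rule that)
qed

end

section \<open>Realizations from a decreasing sequence of slopes\<close>

lemma strict_mono_int_step:
  fixes f :: "int \<Rightarrow> real"
  assumes "\<And>s. f s < f (s + 1)"
  shows "strict_mono f"
proof (rule strict_monoI)
  fix x y :: int assume "x < y"
  then show "f x < f y"
  proof (induction y rule: int_gr_induct)
    case (step y)
    then show ?case using assms[of y] by simp
  qed (rule assms)
qed

context blocks
begin

lemma slope_realizationI:
  assumes mono: "strict_mono \<theta>" and per: "\<And>s. \<theta> (s + 2 * n) = \<theta> s + pi"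
    and anti: "\<And>i a. V (i + t) a = - V i a"
    and cross: "\<And>i a. 0 \<le> a \<Longrightarrow> a < d i \<Longrightarrow> \<exists>r>0. V i a = r *\<^sub>R normal (\<theta> (crossing_time i))"
    and incr: "\<And>i a b. 0 \<le> a \<Longrightarrow> a < b \<Longrightarrow> b < d i \<Longrightarrow>
      \<exists>r>0. V i b - V i a = r *\<^sub>R normal (\<theta> (crossing_time i))"
    and sums: "\<And>i j a b. 0 \<le> a \<Longrightarrow> a < d i \<Longrightarrow> 0 \<le> b \<Longrightarrow> b < d j \<Longrightarrow> i < j \<Longrightarrow> j < i + t \<Longrightarrow>
      \<exists>r>0. V i a + V j b = r *\<^sub>R normal (\<theta> (swap_time i a j b))"
  shows "slope_realization V \<theta>"
  unfolding slope_realization_def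
proof (intro conjI allI impI)
  show "strict_mono \<theta>" by (rule mono)
  show "\<theta> (s + 2 * n) = \<theta> s + pi" for s by (rule per)
  show "V (i + t) a = - V i a" for i a by (rule anti)
  fix i a j b \<tau> assume m: "meets i a j b \<tau>"
  then have v: "0 \<le> a" "a < d i" "0 \<le> b" "b < d j" unfolding meets_def by auto
  consider "i < j + t" "j < i" "\<tau> = swap_time i a (j + t) b" | "j = i - t" "\<tau> = crossing_time i"
    | "j = i" "b < a" "\<tau> = crossing_time i" using m unfolding meets_def by blast
  then show "\<exists>r>0. V i a - V j b = r *\<^sub>R normal (\<theta> \<tau>)"
  proof cases
    case 1
    then show ?thesis using sums[of a i b "j + t"] v d_per[of j] anti[of j b] by simp
  next
    case 2
    then have "V j b = - V i b" "b < d i" using anti[of j b] v d_per[of j] by simp_all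
    moreover obtain r r' where "0 < r" "V i a = r *\<^sub>R normal (\<theta> \<tau>)" "0 < r'" "V i b = r' *\<^sub>R normal (\<theta> \<tau>)"
      using cross[of a i] cross[of b i] v 2 \<open>b < d i\<close> by auto
    ultimately show ?thesis by (intro exI[of _ "r + r'"]) (simp add: scaleR_add_left)
  next
    case 3
    then show ?thesis using incr[of b a i] v by simp
  qed
qed

lemma D_shift: "D (i + t * k) = D i + n * k"
  using arithmetic_shift[of D t n i k] D_per by (simp add: mult.commute)

text \<open>
  The directions of the moves: crossing \<open>i0\<close> has the direction \<open>(1, 0)\<close>, the following moves of the
  halfperiod have the directions \<open>(g v, 1)\<close>, and from then on the signs alternate.
\<close>
definition slope_vector :: "int \<Rightarrow> (int \<Rightarrow> real) \<Rightarrow> int \<Rightarrow> real \<times> real" where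
  "slope_vector i0 g s = (let u = s - crossing_time i0; v = u mod (2 * n);
     w = (if v = 0 then (1, 0) else (g v, 1)) in if even (u div (2 * n)) then w else - w)"

lemma slope_vector_shift:
  "slope_vector i0 g (s + 2 * n * k) = (if even k then slope_vector i0 g s else - slope_vector i0 g s)"
proof -
  have e: "s + 2 * n * k - crossing_time i0 = (s - crossing_time i0) + 2 * n * k" by simp
  have "(s + 2 * n * k - crossing_time i0) div (2 * n) = (s - crossing_time i0) div (2 * n) + k"
    unfolding e using n_pos by simp
  moreover have "(s + 2 * n * k - crossing_time i0) mod (2 * n) = (s - crossing_time i0) mod (2 * n)"
    unfolding e by simp
  ultimately show ?thesis unfolding slope_vector_def Let_def by auto
qed

lemma slope_vector_eval:
  "slope_vector i0 g (crossing_time i0) = (1, 0)"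
  "0 < v \<Longrightarrow> v < 2 * n \<Longrightarrow> slope_vector i0 g (crossing_time i0 + v) = (g v, 1)"
  "slope_vector i0 g (crossing_time i0 + 2 * n) = (- 1, 0)"
  "2 * n < v \<Longrightarrow> v < 4 * n \<Longrightarrow> slope_vector i0 g (crossing_time i0 + v) = (- g (v - 2 * n), - 1)"
proof -
  show 1: "slope_vector i0 g (crossing_time i0) = (1, 0)" unfolding slope_vector_def by simp
  show 2: "slope_vector i0 g (crossing_time i0 + v) = (g v, 1)" if "0 < v" "v < 2 * n" for v
    using that unfolding slope_vector_def Let_def by simp
  show "slope_vector i0 g (crossing_time i0 + 2 * n) = (- 1, 0)"
    using slope_vector_shift[of i0 g "crossing_time i0" 1] 1 by simp
  show "slope_vector i0 g (crossing_time i0 + v) = (- g (v - 2 * n), - 1)" if "2 * n < v" "v < 4 * n"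
    using slope_vector_shift[of i0 g "crossing_time i0 + (v - 2 * n)" 1] 2[of "v - 2 * n"] that by simp
qed

text \<open>
  The angle \<open>\<theta>\<close> for which \<open>normal \<theta>\<close> is a positive multiple of \<open>slope_vector i0 g s\<close>, chosen so that it
  increases with \<open>s\<close> if \<open>g\<close> decreases.
\<close>
definition slope_angle :: "int \<Rightarrow> (int \<Rightarrow> real) \<Rightarrow> int \<Rightarrow> real" where
  "slope_angle i0 g s = (let u = s - crossing_time i0; v = u mod (2 * n) in
     pi / 2 + of_int (u div (2 * n)) * pi + (if v = 0 then 0 else pi / 2 - arctan (g v)))"

lemma normal_add_multiple_pi: "normal (y + of_int m * pi) = (if even m then normal y else - normal y)"
  using sin_npi_int[of m] cos_npi_int[of m] unfolding normal_def
  by (simp add: sin_add cos_add mult.commute)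

lemma slope_vector_normal:
  obtains r where "0 < r" "slope_vector i0 g s = r *\<^sub>R normal (slope_angle i0 g s)"
proof -
  define u v where "u = s - crossing_time i0" and "v = u mod (2 * n)"
  define y where "y = pi / 2 + (if v = 0 then 0 else pi / 2 - arctan (g v))"
  have "\<exists>r>0. (if v = 0 then (1, 0) else (g v, 1)) = r *\<^sub>R normal y"
  proof (cases "v = 0")
    case True
    then show ?thesis unfolding y_def normal_def by (intro exI[of _ 1]) simp
  next
    case False
    have "y = pi - arctan (g v)" unfolding y_def using False by simp
    then have "normal y = (sin (arctan (g v)), cos (arctan (g v)))"
      unfolding normal_def by simp
    then have "normal y = (g v / sqrt (1 + (g v)\<^sup>2), 1 / sqrt (1 + (g v)\<^sup>2))" by (simp add: sin_arctan cos_arctan)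
    moreover have "0 < sqrt (1 + (g v)\<^sup>2)" by (simp add: add_pos_nonneg)
    ultimately show ?thesis using False by (intro exI[of _ "sqrt (1 + (g v)\<^sup>2)"]) simp
  qed
  then obtain r where r: "0 < r" "(if v = 0 then (1, 0) else (g v, 1)) = r *\<^sub>R normal y" by blast
  have ang: "slope_angle i0 g s = y + of_int (u div (2 * n)) * pi"
    unfolding slope_angle_def Let_def u_def[symmetric] v_def[symmetric] y_def by simp
  have "slope_vector i0 g s = r *\<^sub>R normal (slope_angle i0 g s)"
    unfolding ang normal_add_multiple_pi slope_vector_def Let_def u_def[symmetric] v_def[symmetric] r(2) by simp
  then show thesis using that r(1) by blast
qed

lemma slope_angle_per: "slope_angle i0 g (s + 2 * n) = slope_angle i0 g s + pi"
proof -
  have e: "s + 2 * n - crossing_time i0 = (s - crossing_time i0) + 2 * n" by simp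
  have "(s + 2 * n - crossing_time i0) div (2 * n) = (s - crossing_time i0) div (2 * n) + 1"
    unfolding e by (rule div_add_self2) (use n_pos in simp)
  moreover have "(s + 2 * n - crossing_time i0) mod (2 * n) = (s - crossing_time i0) mod (2 * n)"
    unfolding e by (rule mod_add_self2)
  ultimately show ?thesis unfolding slope_angle_def Let_def by (simp add: algebra_simps)
qed

lemma slope_angle_mono:
  assumes decr: "\<And>v. 0 < v \<Longrightarrow> v + 1 < 2 * n \<Longrightarrow> g (v + 1) < g v"
  shows "strict_mono (slope_angle i0 g)"
proof (rule strict_mono_int_step)
  fix s
  define u where "u = s - crossing_time i0"
  define q v where "q = u div (2 * n)" and "v = u mod (2 * n)"
  have u: "u = 2 * n * q + v" unfolding q_def v_def by simp
  have v: "0 \<le> v" "v < 2 * n" using n_pos unfolding v_def by auto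
  have e: "s + 1 - crossing_time i0 = u + 1" unfolding u_def by simp
  have at: "- (pi / 2) < arctan y" "arctan y < pi / 2" for y using arctan_bounded[of y] by auto
  show "slope_angle i0 g s < slope_angle i0 g (s + 1)"
  proof (cases "v + 1 < 2 * n")
    case True
    have "(u + 1) div (2 * n) = q" "(u + 1) mod (2 * n) = v + 1"
      using int_div_pos_eq[of "u + 1" "2 * n" q "v + 1"] int_mod_pos_eq[of "u + 1" "2 * n" q "v + 1"] True u v by auto
    then show ?thesis
      unfolding slope_angle_def Let_def e u_def[symmetric] q_def[symmetric] v_def[symmetric]
      using at[of "g 1"] decr[of v] True v by (auto simp: arctan_less_iff)
  next
    case False
    then have v1: "v = 2 * n - 1" using v by simp
    have "u + 1 = 2 * n * (q + 1)" using u v1 by (simp add: algebra_simps)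
    then have "(u + 1) div (2 * n) = q + 1" "(u + 1) mod (2 * n) = 0" using n_pos by simp_all
    moreover have "v \<noteq> 0" using v1 n_pos by simp
    ultimately show ?thesis
      unfolding slope_angle_def Let_def e u_def[symmetric] q_def[symmetric] v_def[symmetric]
      using at[of "g v"] by (simp add: algebra_simps)
  qed
qed

text \<open>
  The vectors of one halfperiod of blocks suffice, since replacing \<open>i\<close> and \<open>j\<close> by \<open>i + t\<close> and \<open>j + t\<close> changes the signs on
  both sides.
\<close>
theorem slope_realization_by_slopes:
  assumes decr: "\<And>v. 0 < v \<Longrightarrow> v + 1 < 2 * n \<Longrightarrow> g (v + 1) < g v"
    and anti: "\<And>i a. V (i + t) a = - V i a"
    and cross: "\<And>i a. i0 \<le> i \<Longrightarrow> i < i0 + t \<Longrightarrow> 0 \<le> a \<Longrightarrow> a < d i \<Longrightarrow>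
      \<exists>r>0. V i a = r *\<^sub>R slope_vector i0 g (crossing_time i)"
    and incr: "\<And>i a b. i0 \<le> i \<Longrightarrow> i < i0 + t \<Longrightarrow> 0 \<le> a \<Longrightarrow> a < b \<Longrightarrow> b < d i \<Longrightarrow>
      \<exists>r>0. V i b - V i a = r *\<^sub>R slope_vector i0 g (crossing_time i)"
    and sums: "\<And>i j a b. i0 \<le> i \<Longrightarrow> i < i0 + t \<Longrightarrow> 0 \<le> a \<Longrightarrow> a < d i \<Longrightarrow> 0 \<le> b \<Longrightarrow> b < d j \<Longrightarrow>
      i < j \<Longrightarrow> j < i + t \<Longrightarrow> \<exists>r>0. V i a + V j b = r *\<^sub>R slope_vector i0 g (swap_time i a j b)"
  obtains \<theta> where "slope_realization V \<theta>"
proof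
  have V_shift: "V (i + t * k) a = (if even k then V i a else - V i a)" for i k a
    using involution_shift[of "\<lambda>i. V i a" t uminus i k] anti by simp
  have to_normal: "\<exists>r>0. x = r *\<^sub>R normal (slope_angle i0 g s)" if "\<exists>r>0. x = r *\<^sub>R slope_vector i0 g s" for x s
  proof -
    note x = that
    obtain r where r: "0 < r" "x = r *\<^sub>R slope_vector i0 g s" using x by blast
    obtain r' where r': "0 < r'" "slope_vector i0 g s = r' *\<^sub>R normal (slope_angle i0 g s)" by (rule slope_vector_normal)
    show ?thesis using r(1) r'(1) unfolding r(2) r'(2) by (intro exI[of _ "r * r'"]) simp
  qed
  have flip: "\<exists>r>0. (if even k then x else - x) = r *\<^sub>R slope_vector i0 g (s + 2 * n * k)"
    if "\<exists>r>0. x = r *\<^sub>R slope_vector i0 g s" for x s k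
    using that unfolding slope_vector_shift by auto
  have base: "\<exists>k i'. i = i' + t * k \<and> i0 \<le> i' \<and> i' < i0 + t" for i
  proof -
    have "i = (i0 + (i - i0) mod t) + t * ((i - i0) div t)" using mult_div_mod_eq[of t "i - i0"] by linarith
    moreover have "i0 \<le> i0 + (i - i0) mod t" "i0 + (i - i0) mod t < i0 + t" using t2 by auto
    ultimately show ?thesis by blast
  qed
  show "slope_realization V (slope_angle i0 g)"
  proof (rule slope_realizationI)
    show "strict_mono (slope_angle i0 g)" using decr by (rule slope_angle_mono)
    show "slope_angle i0 g (s + 2 * n) = slope_angle i0 g s + pi" for s by (rule slope_angle_per)
    show "V (i + t) a = - V i a" for i a by (rule anti)
    fix i a
    obtain k i' where i: "i = i' + t * k" "i0 \<le> i'" "i' < i0 + t" using base by blast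
    have di: "d i = d i'" unfolding i(1) by (rule d_shift)
    have Ti: "crossing_time i = crossing_time i' + 2 * n * k" unfolding i(1) by (rule crossing_time_shift)
    have Vi: "V i x = (if even k then V i' x else - V i' x)" for x unfolding i(1) by (rule V_shift)
    show "\<exists>r>0. V i a = r *\<^sub>R normal (slope_angle i0 g (crossing_time i))" if "0 \<le> a" "a < d i"
    proof -
      have h: "\<exists>r>0. V i' a = r *\<^sub>R slope_vector i0 g (crossing_time i')" using cross[OF i(2,3)] that di by simp
      show ?thesis unfolding Ti Vi by (rule to_normal[OF flip[OF h]])
    qed
    show "\<exists>r>0. V i b - V i a = r *\<^sub>R normal (slope_angle i0 g (crossing_time i))"
      if "0 \<le> a" "a < b" "b < d i" for b
    proof -
      have e: "V i b - V i a = (if even k then V i' b - V i' a else - (V i' b - V i' a))" unfolding Vi by simp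
      have h: "\<exists>r>0. V i' b - V i' a = r *\<^sub>R slope_vector i0 g (crossing_time i')"
        using incr[OF i(2,3)] that di by simp
      show ?thesis unfolding Ti e by (rule to_normal[OF flip[OF h]])
    qed
    show "\<exists>r>0. V i a + V j b = r *\<^sub>R normal (slope_angle i0 g (swap_time i a j b))"
      if "0 \<le> a" "a < d i" "0 \<le> b" "b < d j" "i < j" "j < i + t" for j b
    proof -
      define j' where "j' = j - t * k"
      have j: "j = j' + t * k" unfolding j'_def by simp
      have dj: "d j = d j'" unfolding j by (rule d_shift)
      have Vj: "V j x = (if even k then V j' x else - V j' x)" for x unfolding j by (rule V_shift)
      have e: "V i a + V j b = (if even k then V i' a + V j' b else - (V i' a + V j' b))" unfolding Vi Vj by simp
      have st: "swap_time i a j b = swap_time i' a j' b + 2 * n * k"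
        unfolding swap_time_def using D_shift[of "i' + 1" k] D_shift[of j' k] i(1) j by (simp add: algebra_simps)
      have "i' < j'" "j' < i' + t" using i(1) j that(5,6) by simp_all
      then have h: "\<exists>r>0. V i' a + V j' b = r *\<^sub>R slope_vector i0 g (swap_time i' a j' b)"
        using sums[OF i(2,3)] that(1-4) di dj by simp
      show ?thesis unfolding st e by (rule to_normal[OF flip[OF h]])
    qed
  qed
qed

end

section \<open>The realizable signatures\<close>

lemma normal_sum: "normal x + normal y = (2 * cos ((x - y) / 2)) *\<^sub>R normal ((x + y) / 2)"
  unfolding normal_def using sin_plus_sin[of x y] cos_plus_cos[of x y] by (simp add: algebra_simps)

lemma ray:
  fixes x y g :: real
  shows "0 < y \<Longrightarrow> x = g * y \<Longrightarrow> \<exists>r>0. (x, y) = r *\<^sub>R (g, 1)"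
    and "0 < x \<Longrightarrow> \<exists>r>0. (x, 0) = r *\<^sub>R (1, 0 :: real)"
    and "x < 0 \<Longrightarrow> \<exists>r>0. (x, 0) = r *\<^sub>R (- 1, 0 :: real)"
    and "y < 0 \<Longrightarrow> x = g * y \<Longrightarrow> \<exists>r>0. (x, y) = r *\<^sub>R (- g, - 1)"
  by (rule exI[of _ y], simp) (rule exI[of _ x], simp, rule exI[of _ "- x"], simp, rule exI[of _ "- y"], simp)

context blocks
begin

text \<open>
  The regular \<open>2 n\<close>-gon: the sum of two unit vectors points in the direction of the bisector.
\<close>
lemma all_ones_realization:
  assumes "\<And>i. d i = 1"
  obtains V \<theta> where "slope_realization V \<theta>"
proof -
  have Di: "D i = D 0 + i" for i
  proof (induction i rule: int_induct[where k = 0])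
    case (step1 i)
    then show ?case using D_Suc[of i] assms by simp
  next
    case (step2 i)
    then show ?case using D_Suc[of "i - 1"] assms by simp
  qed simp
  have tn: "t = n" using D_per[of 0] Di[of t] by simp
  define \<alpha> where "\<alpha> = pi / (2 * of_int n)"
  define c where "c = 2 * D 0 + e"
  define \<theta> where "\<theta> = (\<lambda>s::int. \<alpha> * of_int s)"
  define V where "V = (\<lambda>(i::int) (a::int). normal (\<alpha> * of_int (2 * i + 1 + c)))"
  have \<alpha>: "0 < \<alpha>" "\<alpha> * (2 * of_int n) = pi" using n_pos unfolding \<alpha>_def by simp_all
  have "slope_realization V \<theta>"
  proof (rule slope_realizationI)
    show "strict_mono \<theta>" using \<alpha>(1) unfolding \<theta>_def strict_mono_def by simp
    show "\<theta> (s + 2 * n) = \<theta> s + pi" for s using \<alpha>(2) unfolding \<theta>_def by (simp add: algebra_simps)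
    show "V (i + t) a = - V i a" for i a
    proof -
      have "\<alpha> * of_int (2 * (i + t) + 1 + c) = \<alpha> * of_int (2 * i + 1 + c) + of_int 1 * pi"
        unfolding tn using \<alpha>(2) by (simp add: algebra_simps)
      then show ?thesis unfolding V_def using normal_add_multiple_pi[of _ 1] by simp
    qed
    show "\<exists>r>0. V i a = r *\<^sub>R normal (\<theta> (crossing_time i))" for i a
    proof -
      have "crossing_time i = 2 * i + 1 + c" unfolding crossing_time_def c_def using Di[of i] Di[of "i + 1"] by simp
      then show ?thesis unfolding V_def \<theta>_def by (intro exI[of _ 1]) simp
    qed
    show "\<exists>r>0. V i b - V i a = r *\<^sub>R normal (\<theta> (crossing_time i))"
      if "0 \<le> a" "a < b" "b < d i" for i a b using that assms by simp
    show "\<exists>r>0. V i a + V j b = r *\<^sub>R normal (\<theta> (swap_time i a j b))"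
      if "0 \<le> a" "a < d i" "0 \<le> b" "b < d j" "i < j" "j < i + t" for i j a b
    proof -
      have ab: "a = 0" "b = 0" using that assms by simp_all
      have st: "swap_time i a j b = i + 1 + j + c"
        unfolding swap_time_def c_def ab using Di[of "i + 1"] Di[of j] by simp
      have "V i a + V j b = (2 * cos (\<alpha> * of_int (i - j))) *\<^sub>R normal (\<alpha> * of_int (i + 1 + j + c))"
        unfolding V_def normal_sum by (simp add: algebra_simps add_divide_distrib diff_divide_distrib)
      moreover have "0 < cos (\<alpha> * of_int (i - j))"
      proof (rule cos_gt_zero_pi)
        have "\<alpha> * of_int (j - i) < \<alpha> * of_int n" using \<alpha>(1) that(6) tn by simp
        moreover have "\<alpha> * of_int n = pi / 2" using \<alpha>(2) by simp
        ultimately show "- (pi / 2) < \<alpha> * of_int (i - j)" by (simp add: algebra_simps)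
        have "\<alpha> * of_int (i - j) < 0" using \<alpha>(1) that(5) by (simp add: mult_pos_neg)
        then show "\<alpha> * of_int (i - j) < pi / 2" using pi_gt_zero by linarith
      qed
      ultimately show ?thesis unfolding st \<theta>_def
        by (intro exI[of _ "2 * cos (\<alpha> * of_int (i - j))"]) simp
    qed
  qed
  then show thesis by (rule that)
qed

text \<open>
  Powers of \<open>2\<close> on the two coordinate axes: the quotient of \<open>2 ^ b\<close> and \<open>2 ^ a\<close> depends on \<open>b - a\<close> only.
\<close>
lemma two_blocks_realization:
  assumes t: "t = 2"
  obtains V \<theta> where "slope_realization V \<theta>"
proof -
  define p where "p = d 0"
  have D: "D 1 = D 0 + p" "D 2 = D 0 + n" "D 3 = D 0 + p + n" and d1: "d 1 = n - p" "d 2 = p"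
    using D_Suc[of 0] D_Suc[of 1] D_per[of 0] D_per[of 1] d_per[of 0] t unfolding p_def by simp_all
  have p: "1 \<le> p" "p < n" using d_pos[of 0] d_less_n[of 0] unfolding p_def by simp_all
  define V where "V = (\<lambda>(i::int) (a::int). (if even (i div 2) then 1 else - 1) *\<^sub>R (2 ^ nat a) *\<^sub>R
    (if even i then (1, 0) else (0 :: real, 1 :: real)))"
  define g :: "int \<Rightarrow> real" where
    "g = (\<lambda>v. if v < n then 2 powr (p - v) else if v = n then 0 else - (2 powr (v - 2 * n + p)))"
  have T: "crossing_time 0 = 2 * D 0 + p + e" "crossing_time 1 = crossing_time 0 + n"
    unfolding crossing_time_def using D by simp_all
  have pw: "2 powr (of_int (a - b)) * 2 ^ nat b = (2 ^ nat a :: real)" if "0 \<le> a" "0 \<le> b" for a b :: int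
    using that by (simp add: powr_diff flip: powr_realpow)
  have i01: "i = 0 \<or> i = 1" if "0 \<le> i" "i < 0 + t" for i using that t by auto
  have V: "V 0 a = (2 ^ nat a, 0)" "V 1 a = (0, 2 ^ nat a)" "V 2 a = (- (2 ^ nat a), 0)" for a
    unfolding V_def by simp_all
  have sv: "slope_vector 0 g (crossing_time 0 + n) = (0, 1)"
    using slope_vector_eval(2)[of n 0 g] n_pos unfolding g_def by simp
  have mono: "(2::real) ^ nat a < 2 ^ nat b" if "0 \<le> a" "a < b" for a b :: int using that by simp
  obtain \<theta> where "slope_realization V \<theta>"
  proof (rule slope_realization_by_slopes[of g V 0])
    show "g (v + 1) < g v" if "0 < v" "v + 1 < 2 * n" for v
    proof -
      consider "v + 1 < n" | "v + 1 = n" | "v = n" | "n < v" by linarith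
      then show ?thesis by cases (simp_all add: g_def)
    qed
    show "V (i + t) a = - V i a" for i a unfolding V_def t by simp
    show "\<exists>r>0. V i a = r *\<^sub>R slope_vector 0 g (crossing_time i)" if "0 \<le> i" "i < 0 + t" for i a
      using i01[OF that]
    proof
      assume "i = 0"
      then show ?thesis using slope_vector_eval(1)[of 0 g] V(1)[of a] ray(2)[of "2 ^ nat a"] by simp
    next
      assume "i = 1"
      then show ?thesis using sv V(2)[of a] ray(1)[of "2 ^ nat a" 0 0] T(2) by simp
    qed
    show "\<exists>r>0. V i b - V i a = r *\<^sub>R slope_vector 0 g (crossing_time i)"
      if "0 \<le> i" "i < 0 + t" "0 \<le> a" "a < b" for i a b
      using i01[OF that(1,2)]
    proof
      assume "i = 0"
      then show ?thesis
        using slope_vector_eval(1)[of 0 g] V(1) ray(2)[of "2 ^ nat b - 2 ^ nat a"] mono[OF that(3,4)] by simp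
    next
      assume "i = 1"
      then show ?thesis
        using sv V(2) ray(1)[of "2 ^ nat b - 2 ^ nat a" 0 0] T(2) mono[OF that(3,4)] by simp
    qed
    show "\<exists>r>0. V i a + V j b = r *\<^sub>R slope_vector 0 g (swap_time i a j b)"
      if ij: "0 \<le> i" "i < 0 + t" and ab: "0 \<le> a" "a < d i" "0 \<le> b" "b < d j" and "i < j" "j < i + t" for i j a b
    proof -
      have j: "j = i + 1" using that t by simp
      from i01[OF ij] show ?thesis
      proof
        assume i: "i = 0"
        define v where "v = p + b - a"
        have v: "0 < v" "v < n" using ab i j d1 unfolding v_def p_def by simp_all
        have "swap_time i a j b = crossing_time 0 + v" unfolding swap_time_def i j T v_def using D by simp
        moreover have "g v = 2 powr (a - b)" using v unfolding g_def v_def by simp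
        ultimately show ?thesis
          using slope_vector_eval(2)[of v 0 g] v V(1)[of a] V(2)[of b] pw[OF ab(1,3)]
            ray(1)[of "2 ^ nat b" "2 ^ nat a" "g v"] i j by simp
      next
        assume i: "i = 1"
        define v where "v = 2 * n - p + b - a"
        have v: "n < v" "v < 2 * n" using ab i j d1 unfolding v_def by simp_all
        have "swap_time i a j b = crossing_time 0 + v" unfolding swap_time_def i j T v_def using D by simp
        moreover have "g v = - (2 powr (b - a))" using v unfolding g_def v_def by simp
        ultimately show ?thesis
          using slope_vector_eval(2)[of v 0 g] v p V(2)[of a] V(3)[of b] pw[OF ab(3,1)]
            ray(1)[of "2 ^ nat a" "- (2 ^ nat b)" "g v"] i j by simp
      qed
    qed
  qed
  then show thesis by (rule that)
qed

text \<open>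
  The large block is \<open>(1, 0), \<dots>, (m, 0)\<close>; the two others have the same height above this line and
  horizontal distance \<open>1\<close>, so all slopes that should agree do.
\<close>
lemma single_large_block_realization:
  assumes t: "t = 3" and d1: "d (i0 + 1) = 1" "d (i0 + 2) = 1"
  obtains V \<theta> where "slope_realization V \<theta>"
proof -
  define m where "m = d i0"
  have m: "1 \<le> m" using d_pos unfolding m_def by simp
  have D: "D (i0 + 1) = D i0 + m" "D (i0 + 2) = D i0 + m + 1" "D (i0 + 3) = D i0 + m + 2"
    using D_Suc[of i0] D_Suc[of "i0 + 1", unfolded index_shifts] D_Suc[of "i0 + 2", unfolded index_shifts] d1
    unfolding m_def by simp_all
  have n: "n = m + 2" using D_per[of i0] D(3) t by simp
  have s4: "i0 + 1 + t = i0 + 4" "i0 + 3 + 1 = i0 + 4" using t by simp_all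
  have D4: "D (i0 + 4) = D i0 + 2 * m + 2" using D_per[of "i0 + 1", unfolded s4] D(1) n by simp
  have d34: "d (i0 + 3) = m" "d (i0 + 4) = 1"
    using d_per[of i0] d_per[of "i0 + 1", unfolded s4] t d1 unfolding m_def by simp_all
  define V where "V = (\<lambda>(i::int) (a::int). (if even ((i - i0) div 3) then 1 else - 1) *\<^sub>R
    (if (i - i0) mod 3 = 0 then (of_int a + 1, 0) else if (i - i0) mod 3 = 1 then (1 / 2, 1) else (- 1 / 2 :: real, 1 :: real)))"
  define g :: "int \<Rightarrow> real" where
    "g = (\<lambda>v. if v \<le> m + 1 then m + 3 / 2 - v else if v = m + 2 then 0 else m + 5 / 2 - v)"
  define T where "T = crossing_time i0"
  have Tv: "crossing_time (i0 + 1) = T + (m + 1)" "crossing_time (i0 + 2) = T + (m + 3)"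
    unfolding T_def crossing_time_def index_shifts using D by simp_all
  have V: "V i0 a = (of_int a + 1, 0)" "V (i0 + 1) a = (1 / 2, 1)" "V (i0 + 2) a = (- 1 / 2, 1)"
    "V (i0 + 3) a = (- of_int a - 1, 0)" "V (i0 + 4) a = (- 1 / 2, - 1)" for a
    unfolding V_def by simp_all
  have sv: "slope_vector i0 g (T + v) = (g v, 1)" if "0 < v" "v < 2 * n" for v
    unfolding T_def using slope_vector_eval(2) that by simp
  have sv0: "slope_vector i0 g T = (1, 0)" "slope_vector i0 g (T + 2 * n) = (- 1, 0)"
    unfolding T_def by (rule slope_vector_eval)+
  have i3: "i = i0 \<or> i = i0 + 1 \<or> i = i0 + 2" if "i0 \<le> i" "i < i0 + t" for i using that t by auto
  obtain \<theta> where "slope_realization V \<theta>"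
  proof (rule slope_realization_by_slopes[of g V i0])
    show "g (v + 1) < g v" if "0 < v" "v + 1 < 2 * n" for v unfolding g_def by auto
    show "V (i + t) a = - V i a" for i a
    proof -
      have eq: "i + t - i0 = (i - i0) + 3" using t by simp
      have "(i - i0 + 3) div 3 = (i - i0) div 3 + 1" "(i - i0 + 3) mod 3 = (i - i0) mod 3"
        using div_add_self2[of 3 "i - i0"] mod_add_self2[of "i - i0" 3] by simp_all
      then show ?thesis unfolding V_def eq by simp
    qed
    show "\<exists>r>0. V i a = r *\<^sub>R slope_vector i0 g (crossing_time i)"
      if "i0 \<le> i" "i < i0 + t" "0 \<le> a" "a < d i" for i a
    proof -
      note ii = i3[OF that(1,2)]
      consider "i = i0" | "i = i0 + 1" | "i = i0 + 2" using ii by blast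
      then show ?thesis
      proof cases
        case 1
        then show ?thesis using sv0(1) V(1)[of a] ray(2)[of "of_int a + 1"] that(3) unfolding T_def by simp
      next
        case 2
        then show ?thesis unfolding 2 Tv V using m n sv[of "m + 1"] by (simp add: ray(1) g_def)
      next
        case 3
        then show ?thesis unfolding 3 Tv V using m n sv[of "m + 3"] by (simp add: ray(1) g_def)
      qed
    qed
    show "\<exists>r>0. V i b - V i a = r *\<^sub>R slope_vector i0 g (crossing_time i)"
      if "i0 \<le> i" "i < i0 + t" "0 \<le> a" "a < b" "b < d i" for i a b
    proof -
      have "i = i0" using i3[OF that(1,2)] that(3-5) d1 by auto
      then show ?thesis using sv0(1) V(1) ray(2)[of "of_int b - of_int a"] that(4) unfolding T_def by simp
    qed
    show "\<exists>r>0. V i a + V j b = r *\<^sub>R slope_vector i0 g (swap_time i a j b)"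
      if ij: "i0 \<le> i" "i < i0 + t" and ab: "0 \<le> a" "a < d i" "0 \<le> b" "b < d j" and "i < j" "j < i + t" for i j a b
    proof -
      have T': "T = 2 * D i0 + m + e" unfolding T_def crossing_time_def using D by simp
      have js: "j = i + 1 \<or> j = i + 2" using \<open>i < j\<close> \<open>j < i + t\<close> t by linarith
      have "i = i0 \<and> j = i0 + 1 \<or> i = i0 \<and> j = i0 + 2 \<or> i = i0 + 1 \<and> j = i0 + 2 \<or>
          i = i0 + 1 \<and> j = i0 + 3 \<or> i = i0 + 2 \<and> j = i0 + 3 \<or> i = i0 + 2 \<and> j = i0 + 4"
        using i3[OF ij] js by auto
      then consider "i = i0" "j = i0 + 1" | "i = i0" "j = i0 + 2" | "i = i0 + 1" "j = i0 + 2"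
        | "i = i0 + 1" "j = i0 + 3" | "i = i0 + 2" "j = i0 + 3" | "i = i0 + 2" "j = i0 + 4"
        by blast
      then show ?thesis
      proof cases
        case 1
        then have "b = 0" "a < m" using ab d1 unfolding m_def by simp_all
        moreover have "swap_time i a j b = T + (m - a)" unfolding swap_time_def 1 T' index_shifts s4 using D \<open>b = 0\<close> by simp
        ultimately show ?thesis using sv[of "m - a"] ab n unfolding 1 V by (simp add: ray(1) g_def)
      next
        case 2
        then have "b = 0" "a < m" using ab d1 unfolding m_def by simp_all
        moreover have "swap_time i a j b = T + (m + 1 - a)" unfolding swap_time_def 2 T' index_shifts s4 using D \<open>b = 0\<close> by simp
        ultimately show ?thesis using sv[of "m + 1 - a"] ab n unfolding 2 V by (simp add: ray(1) g_def)
      next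
        case 3
        then have "b = 0" "a = 0" using ab d1 by simp_all
        then have "swap_time i a j b = T + (m + 2)" unfolding swap_time_def 3 T' index_shifts s4 using D by simp
        then show ?thesis using sv[of "m + 2"] m n unfolding 3 V by (simp add: ray(1) g_def)
      next
        case 4
        then have "a = 0" "b < m" using ab d1 d34 by simp_all
        moreover have "swap_time i a j b = T + (m + 3 + b)" unfolding swap_time_def 4 T' index_shifts s4 using D \<open>a = 0\<close> by simp
        ultimately show ?thesis using sv[of "m + 3 + b"] ab m n unfolding 4 V by (simp add: ray(1) g_def)
      next
        case 5
        then have "a = 0" "b < m" using ab d1 d34 by simp_all
        moreover have "swap_time i a j b = T + (m + 4 + b)" unfolding swap_time_def 5 T' index_shifts s4 using D \<open>a = 0\<close> by simp
        ultimately show ?thesis using sv[of "m + 4 + b"] ab m n unfolding 5 V by (simp add: ray(1) g_def)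
      next
        case 6
        then have "a = 0" "b = 0" using ab d1 d34 by simp_all
        then have "swap_time i a j b = T + 2 * n" unfolding swap_time_def 6 T' n index_shifts s4 using D D4 by simp
        then show ?thesis using sv0(2) unfolding 6 V by (simp add: ray(3))
      qed
    qed
  qed
  then show thesis by (rule that)
qed

text \<open>
  Three lines with \<open>c 0 + c 2 = c 1\<close> and points at \<open>1\<close> and \<open>\<phi>\<close> on each of them. The slopes agree because of \<open>\<phi>\<^sup>2 = \<phi> + 1\<close>.
\<close>
lemma golden_realization:
  assumes t: "t = 3" and d2: "\<And>i. d i = 2"
  obtains V \<theta> where "slope_realization V \<theta>"
proof -
  define \<phi> :: real where "\<phi> = (1 + sqrt 5) / 2"
  have \<phi>2: "\<phi> * \<phi> = \<phi> + 1" unfolding \<phi>_def by (simp add: field_simps)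
  have "(2::real) < sqrt 5" by (rule real_less_rsqrt) (simp add: power2_eq_square)
  moreover have "sqrt 5 < (7 / 3 :: real)" by (rule real_less_lsqrt) (simp_all add: power2_eq_square)
  ultimately have \<phi>b: "3 / 2 < \<phi>" "\<phi> < 5 / 3" unfolding \<phi>_def by simp_all
  have D: "D 1 = D 0 + 2" "D 2 = D 0 + 4" "D 3 = D 0 + 6" "D 4 = D 0 + 8"
    using D_Suc[of 0] D_Suc[of 1] D_Suc[of 2] D_Suc[of 3] d2 by simp_all
  have n: "n = 6" using D_per[of 0] D(3) t by simp
  define x :: "int \<Rightarrow> real" where "x = (\<lambda>a. if a = 0 then 1 else \<phi>)"
  define V where "V = (\<lambda>(i::int) (a::int). (if even (i div 3) then 1 else - 1) *\<^sub>R x a *\<^sub>R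
    (if i mod 3 = 0 then (1, 0) else if i mod 3 = 1 then (1, 1) else (0 :: real, 1 :: real)))"
  define g :: "int \<Rightarrow> real" where
    "g = (\<lambda>v. if v = 1 then \<phi> + 1 else if v = 2 then 2 else if v = 3 then \<phi> else if v = 4 then 1
      else if v = 5 then \<phi> - 1 else if v = 6 then 1 / 2 else if v = 7 then 2 - \<phi> else if v = 8 then 0
      else if v = 9 then 1 - \<phi> else if v = 10 then - 1 else - \<phi>)"
  have gv: "g 1 = \<phi> + 1" "g 2 = 2" "g 3 = \<phi>" "g 4 = 1" "g 5 = \<phi> - 1" "g 6 = 1 / 2" "g 7 = 2 - \<phi>"
    "g 8 = 0" "g 9 = 1 - \<phi>" "g 10 = - 1" "g 11 = - \<phi>" unfolding g_def by simp_all
  have golden: "\<phi> * \<phi> = \<phi> + 1" "(\<phi> - 1) * \<phi> = 1" "(\<phi> - 1) * (\<phi> + 1) = \<phi>" "(2 - \<phi>) * (1 + \<phi>) = 1"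
    "(2 - \<phi>) * \<phi> = \<phi> - 1" "(1 - \<phi>) * \<phi> = - 1" "(\<phi> + 1) * (1 - \<phi>) = - \<phi>" "\<phi> * (\<phi> - 1) = 1"
    unfolding left_diff_distrib distrib_right right_diff_distrib distrib_left \<phi>2 by simp_all
  define T where "T = crossing_time 0"
  have T': "T = 2 * D 0 + 2 + e" unfolding T_def crossing_time_def using D by simp
  have Tv: "crossing_time 1 = T + 4" "crossing_time 2 = T + 8" unfolding T' crossing_time_def using D by simp_all
  have V: "V 0 a = (x a, 0)" "V 1 a = (x a, x a)" "V 2 a = (0, x a)" "V 3 a = (- x a, 0)" "V 4 a = (- x a, - x a)" for a
    unfolding V_def by simp_all
  have sv: "slope_vector 0 g (T + v) = (g v, 1)" if "0 < v" "v < 12" for v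
    unfolding T_def using slope_vector_eval(2)[of v 0 g] that n by simp
  have sv0: "slope_vector 0 g T = (1, 0)" "slope_vector 0 g (T + 12) = (- 1, 0)" "slope_vector 0 g (T + 13) = (- g 1, - 1)"
    unfolding T_def using slope_vector_eval(1)[of 0 g] slope_vector_eval(3)[of 0 g] slope_vector_eval(4)[of 13 0 g] n by simp_all
  have i3: "i = 0 \<or> i = 1 \<or> i = 2" if "0 \<le> i" "i < 0 + t" for i using that t by auto
  have a2: "a = 0 \<or> a = 1" if "0 \<le> a" "a < d i" for a i using that d2 by auto
  obtain \<theta> where "slope_realization V \<theta>"
  proof (rule slope_realization_by_slopes[of g V 0])
    show "g (v + 1) < g v" if "0 < v" "v + 1 < 2 * n" for v
    proof -
      have "v = 1 \<or> v = 2 \<or> v = 3 \<or> v = 4 \<or> v = 5 \<or> v = 6 \<or> v = 7 \<or> v = 8 \<or> v = 9 \<or> v = 10"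
        using that n by presburger
      then show ?thesis using \<phi>b unfolding g_def by auto
    qed
    show "V (i + t) a = - V i a" for i a unfolding V_def t by simp
    have xp: "0 < x a" for a using \<phi>b unfolding x_def by simp
    show "\<exists>r>0. V i a = r *\<^sub>R slope_vector 0 g (crossing_time i)" if "0 \<le> i" "i < 0 + t" for i a
    proof -
      note ii = i3[OF that]
      consider "i = 0" | "i = 1" | "i = 2" using ii by blast
      then show ?thesis
      proof cases
        case 1
        then show ?thesis using sv0(1) V(1)[of a] xp[of a] unfolding T_def by (simp add: ray(2))
      next
        case 2
        then show ?thesis using sv[of 4] V(2)[of a] xp[of a] Tv by (simp add: ray(1) g_def)
      next
        case 3
        then show ?thesis using sv[of 8] V(3)[of a] xp[of a] Tv by (simp add: ray(1) g_def)
      qed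
    qed
    show "\<exists>r>0. V i b - V i a = r *\<^sub>R slope_vector 0 g (crossing_time i)"
      if "0 \<le> i" "i < 0 + t" "0 \<le> a" "a < b" "b < d i" for i a b
    proof -
      have xl: "0 < x b - x a" using that d2 \<phi>b unfolding x_def by simp
      note ii = i3[OF that(1,2)]
      consider "i = 0" | "i = 1" | "i = 2" using ii by blast
      then show ?thesis
      proof cases
        case 1
        then show ?thesis using sv0(1) V(1) xl unfolding T_def by (simp add: ray(2))
      next
        case 2
        then show ?thesis using sv[of 4] V(2) xl Tv by (simp add: ray(1) g_def)
      next
        case 3
        then show ?thesis using sv[of 8] V(3) xl Tv by (simp add: ray(1) g_def)
      qed
    qed
    show "\<exists>r>0. V i a + V j b = r *\<^sub>R slope_vector 0 g (swap_time i a j b)"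
      if ij: "0 \<le> i" "i < 0 + t" and ab: "0 \<le> a" "a < d i" "0 \<le> b" "b < d j" and "i < j" "j < i + t" for i j a b
    proof -
      have aa: "a = 0 \<or> a = 1" and bb: "b = 0 \<or> b = 1" using a2[OF ab(1,2)] a2[OF ab(3,4)] by simp_all
      have ab01: "0 \<le> a" "a \<le> 1" "0 \<le> b" "b \<le> 1" using aa bb by auto
      have key: "\<exists>r>0. (y, z) = r *\<^sub>R slope_vector 0 g (T + v)"
        if "0 < v" "v < 12" "0 < z" "y = g v * z" for v y z
        unfolding sv[OF that(1,2)] using that(3,4) by (rule ray(1))
      have js: "j = i + 1 \<or> j = i + 2" using \<open>i < j\<close> \<open>j < i + t\<close> t by linarith
      have "i = 0 \<and> j = 1 \<or> i = 0 \<and> j = 2 \<or> i = 1 \<and> j = 2 \<or> i = 1 \<and> j = 3 \<or> i = 2 \<and> j = 3 \<or> i = 2 \<and> j = 4"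
        using i3[OF ij] js by auto
      then consider "i = 0" "j = 1" | "i = 0" "j = 2" | "i = 1" "j = 2" | "i = 1" "j = 3"
        | "i = 2" "j = 3" | "i = 2" "j = 4" by blast
      then show ?thesis
      proof cases
        case 1
        have st: "swap_time i a j b = T + (2 + b - a)" unfolding swap_time_def T' 1 using D by simp
        have "\<exists>r>0. (x a + x b, x b) = r *\<^sub>R slope_vector 0 g (T + (2 + b - a))"
        proof (rule key)
          show "0 < 2 + b - a" "2 + b - a < 12" using ab01 by simp_all
          show "0 < x b" using xp[of a] xp[of b] by simp
          show "x a + x b = g (2 + b - a) * (x b)" using aa bb by (elim disjE) (simp_all add: x_def gv golden)
        qed
        then show ?thesis unfolding st unfolding 1 V by simp
      next
        case 2
        have st: "swap_time i a j b = T + (4 + b - a)" unfolding swap_time_def T' 2 using D by simp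
        have "\<exists>r>0. (x a, x b) = r *\<^sub>R slope_vector 0 g (T + (4 + b - a))"
        proof (rule key)
          show "0 < 4 + b - a" "4 + b - a < 12" using ab01 by simp_all
          show "0 < x b" using xp[of a] xp[of b] by simp
          show "x a = g (4 + b - a) * (x b)" using aa bb by (elim disjE) (simp_all add: x_def gv golden)
        qed
        then show ?thesis unfolding st unfolding 2 V by simp
      next
        case 3
        have st: "swap_time i a j b = T + (6 + b - a)" unfolding swap_time_def T' 3 using D by simp
        have "\<exists>r>0. (x a, x a + x b) = r *\<^sub>R slope_vector 0 g (T + (6 + b - a))"
        proof (rule key)
          show "0 < 6 + b - a" "6 + b - a < 12" using ab01 by simp_all
          show "0 < x a + x b" using xp[of a] xp[of b] by simp
          show "x a = g (6 + b - a) * (x a + x b)" using aa bb by (elim disjE) (simp_all add: x_def gv golden)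
        qed
        then show ?thesis unfolding st unfolding 3 V by simp
      next
        case 4
        have st: "swap_time i a j b = T + (8 + b - a)" unfolding swap_time_def T' 4 using D by simp
        have "\<exists>r>0. (x a - x b, x a) = r *\<^sub>R slope_vector 0 g (T + (8 + b - a))"
        proof (rule key)
          show "0 < 8 + b - a" "8 + b - a < 12" using ab01 by simp_all
          show "0 < x a" using xp[of a] xp[of b] by simp
          show "x a - x b = g (8 + b - a) * (x a)" using aa bb by (elim disjE) (simp_all add: x_def gv golden)
        qed
        then show ?thesis unfolding st unfolding 4 V by simp
      next
        case 5
        have st: "swap_time i a j b = T + (10 + b - a)" unfolding swap_time_def T' 5 using D by simp
        have "\<exists>r>0. (- x b, x a) = r *\<^sub>R slope_vector 0 g (T + (10 + b - a))"
        proof (rule key)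
          show "0 < 10 + b - a" "10 + b - a < 12" using ab01 by simp_all
          show "0 < x a" using xp[of a] xp[of b] by simp
          show "- x b = g (10 + b - a) * (x a)" using aa bb by (elim disjE) (simp_all add: x_def gv golden)
        qed
        then show ?thesis unfolding st unfolding 5 V by simp
      next
        case 6
        have st: "swap_time i a j b = T + (12 + b - a)" unfolding swap_time_def T' 6 using D by simp
        consider "b = a" | "a = 0" "b = 1" | "a = 1" "b = 0" using aa bb by auto
        then show ?thesis
        proof cases
          case 1
          then show ?thesis unfolding st unfolding 6 V using sv0(2) xp[of a] ray(3)[of "- x a"] by simp
        next
          case 2
          have "\<exists>r>0. (- \<phi>, 1 - \<phi>) = r *\<^sub>R (- g 1, - 1)"
            by (rule ray(4)) (use \<phi>b in \<open>simp_all add: gv golden\<close>)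
          then show ?thesis unfolding st unfolding 6 V using sv0(3) 2 by (simp add: x_def)
        next
          case 3
          have "\<exists>r>0. (- 1, \<phi> - 1) = r *\<^sub>R slope_vector 0 g (T + 11)"
            by (rule key) (use \<phi>b in \<open>simp_all add: gv golden\<close>)
          then show ?thesis unfolding st unfolding 6 V using 3 by (simp add: x_def)
        qed
      qed
    qed
  qed
  then show thesis by (rule that)
qed

end

section \<open>Obstructions to realizability\<close>

definition cross :: "real \<times> real \<Rightarrow> real \<times> real \<Rightarrow> real" where
  "cross x y = fst x * snd y - snd x * fst y"

lemma cross_combination:
  "cross (\<alpha> *\<^sub>R x + \<beta> *\<^sub>R y) (\<gamma> *\<^sub>R x + \<delta> *\<^sub>R y) = (\<alpha> * \<delta> - \<beta> * \<gamma>) * cross x y"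
  unfolding cross_def by (simp add: algebra_simps)

lemma cross_normal: "cross (r *\<^sub>R normal \<alpha>) (r' *\<^sub>R normal \<beta>) = r * r' * sin (\<beta> - \<alpha>)"
  unfolding cross_def normal_def by (simp add: sin_diff algebra_simps)

locale slope_configuration = blocks +
  fixes V :: "int \<Rightarrow> int \<Rightarrow> real \<times> real" and \<theta> :: "int \<Rightarrow> real"
  assumes realization: "slope_realization V \<theta>"
begin

lemma angle_mono: "strict_mono \<theta>" and angle_per: "\<theta> (s + 2 * n) = \<theta> s + pi"
  and V_conj: "V (i + t) a = - V i a"
  and V_meets: "meets i a j b \<tau> \<Longrightarrow> \<exists>r>0. V i a - V j b = r *\<^sub>R normal (\<theta> \<tau>)"
  using realization unfolding slope_realization_def by blast+

lemma V_sum: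
  assumes "0 \<le> a" "a < d i" "0 \<le> b" "b < d j" "i < j" "j < i + t"
  shows "\<exists>r>0. V i a + V j b = r *\<^sub>R normal (\<theta> (swap_time i a j b))"
proof -
  have "meets i a (j - t) b (swap_time i a j b)"
    using assms d_per[of "j - t"] unfolding meets_def by simp
  moreover have "V (j - t) b = - V j b" using V_conj[of "j - t" b] by simp
  ultimately show ?thesis using V_meets[of i a "j - t" b] by simp
qed

lemma V_crossing:
  assumes "0 \<le> a" "a < d i"
  shows "\<exists>r>0. V i a = r *\<^sub>R normal (\<theta> (crossing_time i))"
proof -
  have "meets i a (i - t) a (crossing_time i)" using assms d_per[of "i - t"] unfolding meets_def by simp
  then obtain r where r: "0 < r" "V i a - V (i - t) a = r *\<^sub>R normal (\<theta> (crossing_time i))"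
    using V_meets by blast
  have "V i a - V (i - t) a = 2 *\<^sub>R V i a" using V_conj[of "i - t" a] by (simp add: scaleR_2)
  then have "V i a = (1 / 2) *\<^sub>R (r *\<^sub>R normal (\<theta> (crossing_time i)))" using r(2) by simp
  then show ?thesis using r(1) by (intro exI[of _ "r / 2"]) simp
qed

lemma V_increasing:
  assumes "0 \<le> a" "a < b" "b < d i"
  shows "\<exists>r>0. V i b - V i a = r *\<^sub>R normal (\<theta> (crossing_time i))"
  using V_meets[of i b i a "crossing_time i"] assms unfolding meets_def by simp

text \<open>
  The place of the point \<open>(i, a)\<close> on the line of its block, in units of the innermost point.
\<close>
definition ratio :: "int \<Rightarrow> int \<Rightarrow> real" where
  "ratio i a = (V i a \<bullet> V i 0) / (V i 0 \<bullet> V i 0)"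

lemma V_first_nonzero: "V i 0 \<noteq> 0"
proof -
  have "0 < d i" using d_pos[of i] by simp
  then obtain r where "0 < r" "V i 0 = r *\<^sub>R normal (\<theta> (crossing_time i))" using V_crossing[of 0 i] by auto
  then show ?thesis using normal_nonzero by simp
qed

lemma ratio_0: "ratio i 0 = 1"
  using V_first_nonzero unfolding ratio_def by simp

lemma V_ratio:
  assumes "0 \<le> a" "a < d i"
  shows "V i a = ratio i a *\<^sub>R V i 0"
proof -
  have "0 < d i" using d_pos[of i] by simp
  then obtain r where r: "0 < r" "V i 0 = r *\<^sub>R normal (\<theta> (crossing_time i))" using V_crossing[of 0 i] by auto
  obtain r' where r': "V i a = r' *\<^sub>R normal (\<theta> (crossing_time i))" using V_crossing[OF assms] by auto
  have "V i a = (r' / r) *\<^sub>R V i 0" unfolding r' r(2) using r(1) by simp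
  moreover then have "ratio i a = r' / r" using V_first_nonzero[of i] unfolding ratio_def by simp
  ultimately show ?thesis by simp
qed

lemma ratio_less:
  assumes "0 \<le> a" "a < b" "b < d i"
  shows "ratio i a < ratio i b"
proof -
  have "0 < d i" using d_pos[of i] by simp
  then obtain r where r: "0 < r" "V i 0 = r *\<^sub>R normal (\<theta> (crossing_time i))" using V_crossing[of 0 i] by auto
  obtain r' where r': "0 < r'" "V i b - V i a = r' *\<^sub>R normal (\<theta> (crossing_time i))" using V_increasing[OF assms] by auto
  have "V i b - V i a = (r' / r) *\<^sub>R V i 0" unfolding r' r(2) using r(1) by simp
  moreover have "V i b - V i a = (ratio i b - ratio i a) *\<^sub>R V i 0"
    using V_ratio[of a i] V_ratio[of b i] assms by (simp add: scaleR_diff_left)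
  ultimately have "ratio i b - ratio i a = r' / r" using V_first_nonzero[of i] by (metis scaleR_cancel_right)
  moreover have "0 < r' / r" using r(1) r'(1) by simp
  ultimately show ?thesis by simp
qed

lemma ratio_ge_1: "0 \<le> a \<Longrightarrow> a < d i \<Longrightarrow> 1 \<le> ratio i a"
  using ratio_less[of 0 a i] ratio_0[of i] by (cases "a = 0") auto

lemma cross_adjacent: "0 < cross (V i 0) (V (i + 1) 0)"
proof -
  have "0 < d i" "0 < d (i + 1)" using d_pos[of i] d_pos[of "i + 1"] by simp_all
  then obtain r r' where r: "0 < r" "V i 0 = r *\<^sub>R normal (\<theta> (crossing_time i))"
    "0 < r'" "V (i + 1) 0 = r' *\<^sub>R normal (\<theta> (crossing_time (i + 1)))"
    using V_crossing[of 0 i] V_crossing[of 0 "i + 1"] by auto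
  have "crossing_time i < crossing_time (i + 1)"
    using crossing_time_less[of i "i + 1"] d_pos[of i] d_pos[of "i + 1"] by simp
  moreover have "crossing_time (i + 1) < crossing_time i + 2 * n"
    using crossing_time_less[of "i + 1" "i + t"] crossing_time_per[of i] t2 d_pos[of "i + 1"] d_pos[of "i + t"] by simp
  ultimately have "\<theta> (crossing_time i) < \<theta> (crossing_time (i + 1))"
    "\<theta> (crossing_time (i + 1)) < \<theta> (crossing_time i) + pi"
    using strict_mono_less[OF angle_mono] angle_per[of "crossing_time i"] by metis+
  then have "0 < sin (\<theta> (crossing_time (i + 1)) - \<theta> (crossing_time i))" by (intro sin_gt_zero) auto
  then show ?thesis unfolding r(2,4) cross_normal using r(1,3) by simp
qed

text \<open>
  Two pairs that meet at the same time have parallel sums; in the basis of two innermost vectors this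
  is the equation of a determinant.
\<close>
lemma parallel_sums:
  assumes "0 \<le> a" "a < d i" "0 \<le> b" "b < d j" "i < j" "j < i + t"
    and "0 \<le> a'" "a' < d i'" "0 \<le> b'" "b' < d j'" "i' < j'" "j' < i' + t"
    and "swap_time i a j b = swap_time i' a' j' b'"
    and "V i a + V j b = \<alpha> *\<^sub>R V k 0 + \<beta> *\<^sub>R V (k + 1) 0"
    and "V i' a' + V j' b' = \<gamma> *\<^sub>R V k 0 + \<delta> *\<^sub>R V (k + 1) 0"
  shows "\<alpha> * \<delta> = \<beta> * \<gamma>"
proof -
  obtain r r' where "V i a + V j b = r *\<^sub>R normal (\<theta> (swap_time i a j b))"
    "V i' a' + V j' b' = r' *\<^sub>R normal (\<theta> (swap_time i a j b))"
    using V_sum[OF assms(1-6)] V_sum[OF assms(7-12)] assms(13) by auto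
  then have "cross (V i a + V j b) (V i' a' + V j' b') = 0" by (simp add: cross_normal)
  then have "(\<alpha> * \<delta> - \<beta> * \<gamma>) * cross (V k 0) (V (k + 1) 0) = 0" unfolding assms(14,15) cross_combination .
  then show ?thesis using cross_adjacent[of k] by simp
qed

lemma parallel_crossing:
  assumes "0 \<le> a" "a < d i" "0 \<le> b" "b < d j" "i < j" "j < i + t"
    and "swap_time i a j b = crossing_time k"
    and "V i a + V j b = \<alpha> *\<^sub>R V k 0 + \<beta> *\<^sub>R V (k + 1) 0"
  shows "\<beta> = 0"
proof -
  have "0 < d k" using d_pos[of k] by simp
  then obtain r r' where "V i a + V j b = r *\<^sub>R normal (\<theta> (crossing_time k))"
    "V k 0 = r' *\<^sub>R normal (\<theta> (crossing_time k))"
    using V_sum[OF assms(1-6)] V_crossing[of 0 k] assms(7) by auto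
  then have "cross (V i a + V j b) (V k 0) = 0" by (simp add: cross_normal)
  then have "cross (\<alpha> *\<^sub>R V k 0 + \<beta> *\<^sub>R V (k + 1) 0) (1 *\<^sub>R V k 0 + 0 *\<^sub>R V (k + 1) 0) = 0"
    unfolding assms(8) by simp
  then show ?thesis unfolding cross_combination using cross_adjacent[of k] by simp
qed

text \<open>
  The innermost points of the blocks \<open>i - 1\<close> and \<open>i + 1\<close> meet at crossing \<open>i\<close>, in the direction of block \<open>i\<close>.
\<close>
lemma three_term:
  assumes "3 \<le> t"
  obtains l where "V (i - 1) 0 + V (i + 1) 0 = l *\<^sub>R V i 0"
proof -
  have dd: "0 < d k" for k using d_pos[of k] by simp
  have "swap_time (i - 1) 0 (i + 1) 0 = crossing_time i" unfolding swap_time_def crossing_time_def by simp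
  then obtain r r' where r: "V (i - 1) 0 + V (i + 1) 0 = r *\<^sub>R normal (\<theta> (crossing_time i))"
    "0 < r'" "V i 0 = r' *\<^sub>R normal (\<theta> (crossing_time i))"
    using V_sum[of 0 "i - 1" 0 "i + 1"] V_crossing[of 0 i] dd assms by auto
  have "V (i - 1) 0 + V (i + 1) 0 = (r / r') *\<^sub>R V i 0" unfolding r(1,3) using r(2) by simp
  then show thesis by (rule that)
qed

text \<open>
  The factor whose existence \<open>three_term\<close> states.
\<close>
definition lam :: "int \<Rightarrow> real" where
  "lam i = (SOME l. V (i - 1) 0 + V (i + 1) 0 = l *\<^sub>R V i 0)"

lemma lam:
  assumes "3 \<le> t"
  shows "V (i - 1) 0 = lam i *\<^sub>R V i 0 - V (i + 1) 0" "V (i + 1) 0 = lam i *\<^sub>R V i 0 - V (i - 1) 0"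
proof -
  obtain l where "V (i - 1) 0 + V (i + 1) 0 = l *\<^sub>R V i 0" using three_term[OF assms] .
  then have "V (i - 1) 0 + V (i + 1) 0 = lam i *\<^sub>R V i 0" unfolding lam_def by (rule someI)
  then show "V (i - 1) 0 = lam i *\<^sub>R V i 0 - V (i + 1) 0" "V (i + 1) 0 = lam i *\<^sub>R V i 0 - V (i - 1) 0"
    by (auto simp: eq_diff_eq add.commute)
qed

text \<open>
  In adjacent blocks the time of meeting depends on \<open>b - a\<close> only.
\<close>
lemma adjacent_ratios:
  assumes "0 \<le> a" "a < d i" "0 \<le> b" "b < d (i + 1)" "0 \<le> a'" "a' < d i" "0 \<le> b'" "b' < d (i + 1)"
    and "b - a = b' - a'"
  shows "ratio i a * ratio (i + 1) b' = ratio (i + 1) b * ratio i a'"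
proof (rule parallel_sums[where i = i and j = "i + 1" and i' = i and j' = "i + 1" and k = i])
  show "swap_time i a (i + 1) b = swap_time i a' (i + 1) b'" using assms(9) unfolding swap_time_def by simp
  show "V i a + V (i + 1) b = ratio i a *\<^sub>R V i 0 + ratio (i + 1) b *\<^sub>R V (i + 1) 0"
    "V i a' + V (i + 1) b' = ratio i a' *\<^sub>R V i 0 + ratio (i + 1) b' *\<^sub>R V (i + 1) 0"
    using V_ratio[of a i] V_ratio[of a' i] V_ratio[of b "i + 1"] V_ratio[of b' "i + 1"] assms by simp_all
qed (use assms t2 in auto)

text \<open>
  The innermost point of block \<open>i - 1\<close> meets the point \<open>m\<close> of block \<open>i + 1\<close> when the point \<open>d i - m\<close> of block \<open>i\<close>
  meets the innermost one of block \<open>i + 1\<close>.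
\<close>
lemma lam_next:
  assumes "3 \<le> t" "1 \<le> m" "m \<le> d i" "m < d (i + 1)"
  shows "lam i = (ratio (i + 1) m - 1) * ratio i (d i - m)"
proof -
  have "lam i * 1 = (ratio (i + 1) m - 1) * ratio i (d i - m)"
  proof (rule parallel_sums[where i = "i - 1" and j = "i + 1" and a = 0 and b = m
        and i' = i and j' = "i + 1" and a' = "d i - m" and b' = 0 and k = i])
    show "swap_time (i - 1) 0 (i + 1) m = swap_time i (d i - m) (i + 1) 0"
      using D_Suc[of i] unfolding swap_time_def by simp
    show "V (i - 1) 0 + V (i + 1) m = lam i *\<^sub>R V i 0 + (ratio (i + 1) m - 1) *\<^sub>R V (i + 1) 0"
      using lam(1)[OF assms(1), of i] V_ratio[of m "i + 1"] assms by (simp add: algebra_simps)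
    show "V i (d i - m) + V (i + 1) 0 = ratio i (d i - m) *\<^sub>R V i 0 + 1 *\<^sub>R V (i + 1) 0"
      using V_ratio[of "d i - m" i] assms by simp
  qed (use assms d_pos[of "i - 1"] in auto)
  then show ?thesis by simp
qed

lemma lam_prev:
  assumes "3 \<le> t" "1 \<le> m" "m \<le> d i" "m < d (i - 1)"
  shows "lam i = (ratio (i - 1) m - 1) * ratio i (d i - m)"
proof -
  have "(ratio (i - 1) m - 1) * ratio i (d i - m) = lam i * 1"
  proof (rule parallel_sums[where i = "i - 1" and j = "i + 1" and a = m and b = 0
        and i' = "i - 1" and j' = i and a' = 0 and b' = "d i - m" and k = "i - 1"])
    show "swap_time (i - 1) m (i + 1) 0 = swap_time (i - 1) 0 i (d i - m)"
      using D_Suc[of i] unfolding swap_time_def by simp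
    show "V (i - 1) m + V (i + 1) 0 = (ratio (i - 1) m - 1) *\<^sub>R V (i - 1) 0 + lam i *\<^sub>R V (i - 1 + 1) 0"
      using lam(2)[OF assms(1), of i] V_ratio[of m "i - 1"] assms by (simp add: algebra_simps)
    show "V (i - 1) 0 + V i (d i - m) = 1 *\<^sub>R V (i - 1) 0 + ratio i (d i - m) *\<^sub>R V (i - 1 + 1) 0"
      using V_ratio[of "d i - m" i] assms by simp
  qed (use assms d_pos[of "i + 1"] d_pos[of "i - 1"] in auto)
  then show ?thesis by simp
qed

lemma lam_recursion:
  assumes "3 \<le> t" "d i = 1" "1 \<le> m" "m < d (i + 1)"
  shows "ratio (i + 1) m = 1 + lam i * ratio (i + 1) (m - 1)"
proof -
  have "lam i * ratio (i + 1) (m - 1) = (ratio (i + 1) m - 1) * 1"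
  proof (rule parallel_sums[where i = "i - 1" and j = "i + 1" and a = 0 and b = m
        and i' = i and j' = "i + 1" and a' = 0 and b' = "m - 1" and k = i])
    show "swap_time (i - 1) 0 (i + 1) m = swap_time i 0 (i + 1) (m - 1)"
      using D_Suc[of i] assms unfolding swap_time_def by simp
    show "V (i - 1) 0 + V (i + 1) m = lam i *\<^sub>R V i 0 + (ratio (i + 1) m - 1) *\<^sub>R V (i + 1) 0"
      using lam(1)[OF assms(1), of i] V_ratio[of m "i + 1"] assms by (simp add: algebra_simps)
    show "V i 0 + V (i + 1) (m - 1) = 1 *\<^sub>R V i 0 + ratio (i + 1) (m - 1) *\<^sub>R V (i + 1) 0"
      using V_ratio[of "m - 1" "i + 1"] assms by simp
  qed (use assms d_pos[of "i - 1"] in auto)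
  then show ?thesis by simp
qed

text \<open>
  The innermost points of the blocks \<open>i - 1\<close> and \<open>i + 2\<close> meet when the outermost ones of the blocks \<open>i\<close> and
  \<open>i + 1\<close> do.
\<close>
lemma lam_adjacent:
  assumes "4 \<le> t"
  shows "(lam i - 1) * ratio (i + 1) (d (i + 1) - 1) = (lam (i + 1) - 1) * ratio i (d i - 1)"
proof (rule parallel_sums[where i = "i - 1" and j = "i + 2" and a = 0 and b = 0
      and i' = i and j' = "i + 1" and a' = "d i - 1" and b' = "d (i + 1) - 1" and k = i])
  have t3: "3 \<le> t" using assms by simp
  show "swap_time (i - 1) 0 (i + 2) 0 = swap_time i (d i - 1) (i + 1) (d (i + 1) - 1)"
    using D_Suc[of i] D_Suc[of "i + 1", unfolded index_shifts] unfolding swap_time_def index_shifts by simp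
  show "V (i - 1) 0 + V (i + 2) 0 = (lam i - 1) *\<^sub>R V i 0 + (lam (i + 1) - 1) *\<^sub>R V (i + 1) 0"
    unfolding lam(1)[OF t3, of i] lam(2)[OF t3, of "i + 1", unfolded index_shifts] by (simp add: algebra_simps)
  show "V i (d i - 1) + V (i + 1) (d (i + 1) - 1) =
      ratio i (d i - 1) *\<^sub>R V i 0 + ratio (i + 1) (d (i + 1) - 1) *\<^sub>R V (i + 1) 0"
    using V_ratio[of "d i - 1" i] V_ratio[of "d (i + 1) - 1" "i + 1"] d_pos[of i] d_pos[of "i + 1"] by simp
qed (use assms d_pos[of "i - 1"] d_pos[of "i + 2"] d_pos[of i] d_pos[of "i + 1"] in auto)

text \<open>
  By \<open>adjacent_ratios\<close> both blocks start with \<open>1\<close>, \<open>q\<close>, and a third point would be at \<open>q\<^sup>2\<close>. Then \<open>lam_next\<close> or \<open>lam_prev\<close>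
  for \<open>m = 1\<close> and \<open>m = 2\<close> gives \<open>(q - 1) q = q\<^sup>2 - 1\<close>, which contradicts \<open>q > 1\<close>.
\<close>
lemma adjacent_large_blocks:
  assumes t3: "3 \<le> t" and d2: "2 \<le> d i" "2 \<le> d (i + 1)"
  shows "d i = 2" "d (i + 1) = 2" "ratio i 1 = ratio (i + 1) 1" "1 < ratio i 1"
proof -
  define q where "q = ratio i 1"
  show q1: "1 < ratio i 1" using ratio_less[of 0 1 i] ratio_0[of i] d2 by simp
  show qq: "ratio i 1 = ratio (i + 1) 1"
    using adjacent_ratios[of 0 i 0 1 1] d2 ratio_0[of i] ratio_0[of "i + 1"] by simp
  show "d (i + 1) = 2"
  proof (rule ccontr)
    assume "d (i + 1) \<noteq> 2"
    then have d3: "3 \<le> d (i + 1)" using d2 by simp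
    define y where "y = ratio i (d i - 2)"
    have "ratio (i + 1) 2 = q * q"
      using adjacent_ratios[of 0 i 1 1 2] d2 d3 ratio_0[of i] qq unfolding q_def by simp
    moreover have "y * q = ratio i (d i - 1)"
      using adjacent_ratios[of "d i - 2" i 0 "d i - 1" 1] d2 ratio_0[of "i + 1"] qq unfolding q_def y_def by simp
    ultimately have "(q - 1) * (y * q) = (q * q - 1) * y"
      using lam_next[OF t3, of 1 i] lam_next[OF t3, of 2 i] d2 d3 qq unfolding q_def y_def by simp
    then have "(q - 1) * y = 0" by (simp add: algebra_simps)
    moreover have "1 \<le> y" using ratio_ge_1[of "d i - 2" i] d2 unfolding y_def by simp
    ultimately show False using q1 unfolding q_def by simp
  qed
  show "d i = 2"
  proof (rule ccontr)
    assume "d i \<noteq> 2"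
    then have d3: "3 \<le> d i" using d2 by simp
    define y where "y = ratio (i + 1) (d (i + 1) - 2)"
    have "ratio i 2 = q * q"
      using adjacent_ratios[of 1 i 0 2 1] d2 d3 ratio_0[of "i + 1"] qq unfolding q_def by simp
    moreover have "ratio (i + 1) (d (i + 1) - 1) = y * q"
      using adjacent_ratios[of 0 i "d (i + 1) - 2" 1 "d (i + 1) - 1"] d2 ratio_0[of i] qq unfolding q_def y_def by simp
    moreover have "lam (i + 1) = (ratio i 1 - 1) * ratio (i + 1) (d (i + 1) - 1)"
      "lam (i + 1) = (ratio i 2 - 1) * ratio (i + 1) (d (i + 1) - 2)"
      using lam_prev[OF t3, of 1 "i + 1"] lam_prev[OF t3, of 2 "i + 1"] d2 d3 by simp_all
    ultimately have "lam (i + 1) = (q - 1) * (y * q)" "lam (i + 1) = (q * q - 1) * y"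
      unfolding q_def[symmetric] y_def[symmetric] by (simp_all only:)
    then have "(q - 1) * (y * q) = (q * q - 1) * y" by (rule subst)
    then have "(q - 1) * y = 0" by (simp add: algebra_simps)
    moreover have "1 \<le> y" using ratio_ge_1[of "d (i + 1) - 2" "i + 1"] d2 unfolding y_def by simp
    ultimately show False using q1 unfolding q_def by simp
  qed
qed

text \<open>
  Here \<open>c (i - 1) = - c (i + 2)\<close>, and applying the three-term relation twice leaves a linear relation
  between independent vectors.
\<close>
lemma lam_triple:
  assumes t3: "t = 3"
  shows "lam i = 1"
proof -
  have e: "i - 1 + t = i + 2" using t3 by simp
  have "V (i - 1) 0 = - V (i + 2) 0" using V_conj[of "i - 1" 0, unfolded e] by simp
  moreover have "V (i + 2) 0 = lam (i + 1) *\<^sub>R V (i + 1) 0 - V i 0"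
    using lam(2)[of "i + 1", unfolded index_shifts] t3 by simp
  ultimately have "lam i *\<^sub>R V i 0 + (- 1) *\<^sub>R V (i + 1) 0 = 1 *\<^sub>R V i 0 + (- lam (i + 1)) *\<^sub>R V (i + 1) 0"
    using lam(1)[of i] t3 by simp
  then have "(lam i - 1) *\<^sub>R V i 0 + (lam (i + 1) - 1) *\<^sub>R V (i + 1) 0 = 0" by (simp add: algebra_simps)
  then have "cross ((lam i - 1) *\<^sub>R V i 0 + (lam (i + 1) - 1) *\<^sub>R V (i + 1) 0) (0 *\<^sub>R V i 0 + 1 *\<^sub>R V (i + 1) 0) = 0"
    unfolding cross_def by simp
  then show ?thesis unfolding cross_combination using cross_adjacent[of i] by simp
qed

text \<open>
  If the third block were single, then \<open>lam_next\<close> at the first block would give \<open>(q - 1) q = 1\<close>, and at the third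
  one \<open>q - 1 = 1\<close>.
\<close>
lemma triple_with_large_pair:
  assumes t3: "t = 3" and d2: "2 \<le> d i" "2 \<le> d (i + 1)"
  shows "d i = 2 \<and> d (i + 1) = 2 \<and> d (i + 2) = 2"
proof -
  note al = adjacent_large_blocks[OF _ d2]
  have d: "d i = 2" "d (i + 1) = 2" using al(1,2) t3 by simp_all
  have "2 \<le> d (i + 2)"
  proof (rule ccontr)
    assume "\<not> ?thesis"
    then have d1: "d (i + 2) = 1" using d_pos[of "i + 2"] by simp
    define q where "q = ratio i 1"
    have "(q - 1) * q = 1" using lam_next[of 1 i] lam_triple[OF t3, of i] d al(3) t3 unfolding q_def by simp
    moreover have "V (i + 3) a = - V i a" for a using V_conj[of i a] t3 by simp
    then have "ratio (i + 3) 1 = q" unfolding ratio_def q_def by simp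
    moreover have "d (i + 3) = 2" using d_per[of i] d t3 by simp
    ultimately show False
      using lam_next[of 1 "i + 2", unfolded index_shifts] lam_triple[OF t3, of "i + 2"] d1 t3 ratio_0[of "i + 2"]
      by simp
  qed
  then show ?thesis using adjacent_large_blocks(2)[of "i + 1", unfolded index_shifts] d t3 by simp
qed

text \<open>
  Let \<open>q\<close> be the second ratio of block \<open>i\<close>; then \<open>lam (i + 1) = q - 1\<close>. The meeting of the second point of block \<open>i\<close> with
  the innermost one of block \<open>i + 3\<close> is parallel to \<open>c (i + 1)\<close> if block \<open>i + 2\<close> is single; this gives \<open>lam (i + 2) = q\<close>,
  but \<open>lam_adjacent\<close> gives \<open>lam (i + 2) = lam (i + 1)\<close>. Otherwise it is parallel to a meeting of the blocks \<open>i + 1\<close> and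
  \<open>i + 2\<close>, and for the second to last point \<open>y\<close> of block \<open>i + 2\<close> one gets \<open>(3 - 2 q) y = 1\<close>. But the ratios of block \<open>i + 2\<close>
  satisfy \<open>x' = 1 + (q - 1) x\<close> and stay below the fixed point \<open>1 / (2 - q)\<close>, which is less than \<open>1 / (3 - 2 q)\<close>.
\<close>
lemma large_block_followed_by_single:
  assumes t4: "4 \<le> t" and d2: "2 \<le> d i" and d1: "d (i + 1) = 1"
  shows False
proof -
  have t3: "3 \<le> t" using t4 by simp
  define q where "q = ratio i 1"
  have q1: "1 < q" using ratio_less[of 0 1 i] ratio_0[of i] d2 unfolding q_def by simp
  have l1: "lam (i + 1) = q - 1" using lam_prev[OF t3, of 1 "i + 1"] d2 d1 ratio_0[of "i + 1"] unfolding q_def by simp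
  define l2 where "l2 = lam (i + 2)"
  have c0: "V i 0 = (q - 1) *\<^sub>R V (i + 1) 0 - V (i + 2) 0" using lam(1)[OF t3, of "i + 1", unfolded index_shifts] l1 by simp
  have c3: "V (i + 3) 0 = l2 *\<^sub>R V (i + 2) 0 - V (i + 1) 0"
    using lam(2)[OF t3, of "i + 2", unfolded index_shifts] unfolding l2_def .
  have sum: "V i 1 + V (i + 3) 0 = (q * (q - 1) - 1) *\<^sub>R V (i + 1) 0 + (l2 - q) *\<^sub>R V (i + 1 + 1) 0"
  proof -
    have "V i 1 = q *\<^sub>R V i 0" using V_ratio[of 1 i] d2 unfolding q_def by simp
    then show ?thesis unfolding c0 c3 index_shifts by (simp add: algebra_simps)
  qed
  have adj: "(q - 2) * ratio (i + 2) (d (i + 2) - 1) = l2 - 1"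
    using lam_adjacent[OF t4, of "i + 1", unfolded index_shifts] l1 d1 ratio_0[of "i + 1"] unfolding l2_def by simp
  have D: "D (i + 2) = D (i + 1) + 1" "D (i + 3) = D (i + 2) + d (i + 2)"
    using D_Suc[of "i + 1", unfolded index_shifts] D_Suc[of "i + 2", unfolded index_shifts] d1 by simp_all
  show False
  proof (cases "d (i + 2) = 1")
    case True
    have "l2 - q = 0"
    proof (rule parallel_crossing[where i = i and j = "i + 3" and a = 1 and b = 0 and k = "i + 1", OF _ _ _ _ _ _ _ sum])
      show "swap_time i 1 (i + 3) 0 = crossing_time (i + 1)"
        using D True unfolding swap_time_def crossing_time_def index_shifts by simp
    qed (use d2 d_pos[of "i + 3"] t4 in auto)
    moreover have "q - 2 = l2 - 1" using adj True ratio_0[of "i + 2"] by simp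
    ultimately show False by simp
  next
    case False
    then have d2': "2 \<le> d (i + 2)" using d_pos[of "i + 2"] by simp
    define y where "y = ratio (i + 2) (d (i + 2) - 2)"
    have y1: "1 \<le> y" using ratio_ge_1[of "d (i + 2) - 2" "i + 2"] d2' unfolding y_def by simp
    have "(q * (q - 1) - 1) * y = (l2 - q) * 1"
    proof (rule parallel_sums[where i = i and j = "i + 3" and a = 1 and b = 0
          and i' = "i + 1" and j' = "i + 2" and a' = 0 and b' = "d (i + 2) - 2" and k = "i + 1", OF _ _ _ _ _ _ _ _ _ _ _ _ _ sum])
      show "swap_time i 1 (i + 3) 0 = swap_time (i + 1) 0 (i + 2) (d (i + 2) - 2)"
        using D unfolding swap_time_def index_shifts by simp
      show "V (i + 1) 0 + V (i + 2) (d (i + 2) - 2) = 1 *\<^sub>R V (i + 1) 0 + y *\<^sub>R V (i + 1 + 1) 0"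
        using V_ratio[of "d (i + 2) - 2" "i + 2"] d2' unfolding y_def index_shifts by simp
    qed (use d2 d2' d1 d_pos[of "i + 3"] t4 in auto)
    moreover have rec: "ratio (i + 2) m = 1 + (q - 1) * ratio (i + 2) (m - 1)" if "1 \<le> m" "m < d (i + 2)" for m
      using lam_recursion[OF t3, of "i + 1" m, unfolded index_shifts] that d1 l1 by simp
    then have "ratio (i + 2) (d (i + 2) - 1) = 1 + (q - 1) * y"
      using rec[of "d (i + 2) - 1"] d2' unfolding y_def by simp
    ultimately have "(q * (q - 1) - 1) * y = (q - 2) * (1 + (q - 1) * y) + 1 - q" using adj by simp
    then have yq: "(3 - 2 * q) * y = 1" by (simp add: algebra_simps)
    then have "0 < 3 - 2 * q" using y1 by (smt (verit) mult_nonpos_nonneg)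
    \<comment> \<open>the recursion stays below its fixed point\<close>
    have "(2 - q) * ratio (i + 2) (int m) < 1" if "int m < d (i + 2)" for m
      using that
    proof (induction m)
      case 0
      then show ?case using q1 ratio_0[of "i + 2"] by simp
    next
      case (Suc m)
      have r: "ratio (i + 2) (int (Suc m)) = 1 + (q - 1) * ratio (i + 2) (int m)"
        using rec[of "int (Suc m)"] Suc.prems by simp
      have "(2 - q) * ratio (i + 2) (int (Suc m)) = (2 - q) + (q - 1) * ((2 - q) * ratio (i + 2) (int m))"
        unfolding r by (simp add: algebra_simps)
      also have "\<dots> < (2 - q) + (q - 1) * 1"
        using Suc q1 by (intro add_strict_left_mono mult_strict_left_mono) auto
      finally show ?case by simp
    qed
    from this[of "nat (d (i + 2) - 2)"] have "(2 - q) * y < 1" using d2' unfolding y_def by simp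
    then have "(2 - q) * y < (3 - 2 * q) * y" using yq by simp
    then have "2 - q < 3 - 2 * q" using y1 by (simp add: mult_less_cancel_right)
    then show False using q1 by simp
  qed
qed

text \<open>
  All three blocks are \<open>1\<close>, \<open>q\<close>, and \<open>lam (i + 1) = lam (i + 2) = q (q - 1)\<close>. The second point of block \<open>i\<close> and the innermost one of block
  \<open>i + 3\<close> meet when the second point of block \<open>i + 1\<close> meets the innermost one of block \<open>i + 2\<close>. This forces \<open>q\<^sup>2 = 1\<close>.
\<close>
lemma three_large_blocks:
  assumes t4: "4 \<le> t" and d2: "2 \<le> d i" "2 \<le> d (i + 1)" "2 \<le> d (i + 2)"
  shows False
proof -
  have t3: "3 \<le> t" using t4 by simp
  define q where "q = ratio i 1"
  note a1 = adjacent_large_blocks[OF t3 d2(1,2)]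
  have a2: "d (i + 2) = 2" "ratio (i + 1) 1 = ratio (i + 2) 1"
    using adjacent_large_blocks[OF t3, of "i + 1", unfolded index_shifts] d2 by simp_all
  have x: "ratio (i + 1) 1 = q" "ratio (i + 2) 1 = q" "1 < q" using a1 a2 unfolding q_def by simp_all
  have l: "lam (i + 1) = (q - 1) * q" "lam (i + 2) = (q - 1) * q"
    using lam_next[OF t3, of 1 "i + 1", unfolded index_shifts] lam_prev[OF t3, of 1 "i + 2", unfolded index_shifts]
      a1(1,2) a2(1) x by simp_all
  define l where "l = (q - 1) * q"
  have c0: "V i 0 = l *\<^sub>R V (i + 1) 0 - V (i + 2) 0" using lam(1)[OF t3, of "i + 1", unfolded index_shifts] l unfolding l_def by simp
  have c3: "V (i + 3) 0 = l *\<^sub>R V (i + 2) 0 - V (i + 1) 0"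
    using lam(2)[OF t3, of "i + 2", unfolded index_shifts] l unfolding l_def by simp
  have "(q * l - 1) * 1 = (l - q) * q"
  proof (rule parallel_sums[where i = i and j = "i + 3" and a = 1 and b = 0
        and i' = "i + 1" and j' = "i + 2" and a' = 1 and b' = 0 and k = "i + 1"])
    show "swap_time i 1 (i + 3) 0 = swap_time (i + 1) 1 (i + 2) 0"
      using D_Suc[of "i + 1", unfolded index_shifts] D_Suc[of "i + 2", unfolded index_shifts] a1(2) a2(1)
      unfolding swap_time_def index_shifts by simp
    show "V i 1 + V (i + 3) 0 = (q * l - 1) *\<^sub>R V (i + 1) 0 + (l - q) *\<^sub>R V (i + 1 + 1) 0"
    proof -
      have "V i 1 = q *\<^sub>R V i 0" using V_ratio[of 1 i] d2 unfolding q_def by simp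
      then show ?thesis unfolding c0 c3 index_shifts by (simp add: algebra_simps)
    qed
    show "V (i + 1) 1 + V (i + 2) 0 = q *\<^sub>R V (i + 1) 0 + 1 *\<^sub>R V (i + 1 + 1) 0"
      using V_ratio[of 1 "i + 1"] d2 x unfolding index_shifts by simp
  qed (use d2 d_pos[of "i + 3"] t4 in auto)
  then have "q * q = 1" by (simp add: algebra_simps)
  then show False using x(3) by (smt (verit) mult_less_cancel_left2)
qed

theorem large_block_obstruction:
  assumes "4 \<le> t"
  shows "d i = 1"
proof (rule ccontr)
  assume "d i \<noteq> 1"
  then have d: "2 \<le> d i" using d_pos[of i] by simp
  then have d1: "2 \<le> d (i + 1)" using large_block_followed_by_single[OF assms d] d_pos[of "i + 1"] by force
  then have "2 \<le> d (i + 2)"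
    using large_block_followed_by_single[OF assms d1, unfolded index_shifts] d_pos[of "i + 2"] by force
  then show False using three_large_blocks[OF assms d d1] by simp
qed

end

section \<open>The classification\<close>

context dc_signature
begin

lemma realizable_iff_slope_realization:
  "geometrically_realizable (DC_points ds) (DC_cs_ncgen ds) \<longleftrightarrow> (\<exists>V \<theta>. B.slope_realization V \<theta>)"
  unfolding DC_cs_ncgen_eq DC_points_eq
  using B.slope_realization_realizable B.realizable_slope_realization by metis

lemma all_block_sizes:
  assumes "\<And>k. k < length ds \<Longrightarrow> ds ! k = c"
  shows "block_size ds i = int c"
proof -
  have "0 < int (length ds)" using len by linarith
  then have "0 \<le> i mod int (length ds)" "i mod int (length ds) < int (length ds)"
    by (rule pos_mod_sign, rule pos_mod_bound)
  then have "nat (i mod int (length ds)) < length ds" by linarith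
  then show ?thesis using assms unfolding block_size_def by simp
qed

lemma triple_block_sizes:
  assumes "ds = [a, b, c]"
  shows "block_size ds 0 = int a" "block_size ds 1 = int b" "block_size ds 2 = int c"
    "block_size ds 3 = int a" "block_size ds 4 = int b"
  unfolding block_size_def assms by simp_all

lemma realizable_cases:
  assumes "(\<forall>d\<in>set ds. d = 1) \<or> length ds = 2 \<or> (length ds = 3 \<and> count_list ds 1 \<ge> 2) \<or> ds = [2, 2, 2]"
  shows "\<exists>V \<theta>. B.slope_realization V \<theta>"
proof -
  consider "\<forall>d\<in>set ds. d = 1" | "length ds = 2" | "length ds = 3" "count_list ds 1 \<ge> 2" | "ds = [2, 2, 2]"
    using assms by blast
  then show ?thesis
  proof cases
    case 1
    then have "block_size ds i = 1" for i using all_block_sizes[of 1 i] by simp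
    then show ?thesis using B.all_ones_realization by blast
  next
    case 2
    then show ?thesis using B.two_blocks_realization by (metis of_nat_numeral)
  next
    case 3
    obtain a b c where ds: "ds = [a, b, c]" using 3(1) by (auto simp: length_Suc_conv numeral_3_eq_3)
    have t: "int (length ds) = 3" using 3 by simp
    note bs = triple_block_sizes[OF ds]
    have "b = 1 \<and> c = 1 \<or> c = 1 \<and> a = 1 \<or> a = 1 \<and> b = 1" using 3(2) unfolding ds by (auto split: if_splits)
    then obtain i where "block_size ds (i + 1) = 1" "block_size ds (i + 2) = 1"
      using bs that[of 0] that[of 1] that[of 2] by auto
    then show ?thesis using B.single_large_block_realization[OF t] by blast
  next
    case 4
    have "ds ! k = 2" if "k < length ds" for k using that 4 by (auto simp: less_Suc_eq numeral_3_eq_3)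
    then have "block_size ds i = 2" for i using all_block_sizes[of 2 i] by simp
    moreover have "int (length ds) = 3" using 4 by simp
    ultimately show ?thesis using B.golden_realization by blast
  qed
qed

lemma slope_realization_cases:
  assumes "B.slope_realization V \<theta>"
  shows "(\<forall>d\<in>set ds. d = 1) \<or> length ds = 2 \<or> (length ds = 3 \<and> count_list ds 1 \<ge> 2) \<or> ds = [2, 2, 2]"
proof -
  interpret C: slope_configuration "block_size ds" "block_start ds" "int (length ds)" "int (sum_list ds)"
    "1 - int (hd ds)" V \<theta>
    by unfold_locales (rule assms)
  consider "length ds = 2" | "length ds = 3" | "4 \<le> length ds" using len by linarith
  then show ?thesis
  proof cases
    case 2
    obtain a b c where ds: "ds = [a, b, c]" using 2 by (auto simp: length_Suc_conv numeral_3_eq_3)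
    have t: "int (length ds) = 3" using 2 by simp
    note bs = triple_block_sizes[OF ds]
    have abc: "0 < a" "0 < b" "0 < c" using pos ds by auto
    have "a = 2 \<and> b = 2 \<and> c = 2" if "2 \<le> a \<and> 2 \<le> b \<or> 2 \<le> b \<and> 2 \<le> c \<or> 2 \<le> c \<and> 2 \<le> a"
      using that C.triple_with_large_pair[OF t, of 0] C.triple_with_large_pair[OF t, of 1]
        C.triple_with_large_pair[OF t, of 2] bs by auto
    then have "a = 1 \<and> b = 1 \<or> b = 1 \<and> c = 1 \<or> c = 1 \<and> a = 1 \<or> a = 2 \<and> b = 2 \<and> c = 2"
      using abc by linarith
    then show ?thesis unfolding ds by auto
  next
    case 3
    have "d = 1" if d: "d \<in> set ds" for d
    proof -
      obtain k where k: "k < length ds" "ds ! k = d" using d by (metis in_set_conv_nth)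
      then show ?thesis using C.large_block_obstruction[of "int k"] block_size_nth[of k] 3 by simp
    qed
    then show ?thesis by blast
  qed simp
qed

end

theorem theorem4p2:
  fixes ds :: "nat list"
  assumes "length ds \<ge> 2"
    and "\<forall>d\<in>set ds. d > 0"
  shows "geometrically_realizable (DC_points ds) (DC_cs_ncgen ds) \<longleftrightarrow>
           (\<forall>d\<in>set ds. d = 1) \<or>
           length ds = 2 \<or>
           (length ds = 3 \<and> count_list ds 1 \<ge> 2) \<or>
           ds = [2, 2, 2]"
proof -
  interpret dc_signature ds using assms by unfold_locales
  show ?thesis
    unfolding realizable_iff_slope_realization using realizable_cases slope_realization_cases by blast
qed

end
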